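(* If there is a complete (connected) Bochner-Kähler manifold $(M,g,\Omega)$ whose reduced momentum mapping has image in the momentum cell $C(p_D,\mu)$, where $p_D$ is the reduced characteristic polynomial of $M$ and $C(p_D,\mu)$ is its momentum cell, then $C(p_D,\mu)$ is bounded.
   Context: $\mathbb C^n$ consists of columns, $z^*$ is conjugate transpose, $\mathfrak u(n)=\{a\in M_n(\mathbb C):a^*=-a\}$. For a connected Kähler manifold $(M,g,\Omega)$ of complex dimension $n\ge1$, the unitary coframe bundle $\pi:P\to M$ has fiber $P_x$ = the complex-linear isometries $u:T_xM\to\mathbb C^n$, with right $U(n)$-action $u\cdot a=a^{-1}\circ u$. Let $\omega(v)=u(\pi'(v))$ for $v\in T_uP$ (so $\pi^*\Omega=-\frac i2\omega^*\wedge\omega$) and let $\phi$ be the unique $\mathfrak u(n)$-valued $1$-form with $d\omega=-\phi\wedge\omega$. The structure is Bochner-Kähler if there are $H:P\to i\mathfrak u(n)$ (Hermitian matrices), $T:P\to\mathbb C^n$, $V:P\to\mathbb R$ with $$d\phi=-\phi\wedge\phi+H\,\omega^*\wedge\omega-H\,\omega\wedge\omega^*-\omega\wedge\omega^*H+(\omega^*\wedge H\omega)\,I_n+(\operatorname{tr}H)\bigl(\omega^*\wedge\omega\,I_n-\omega\wedge\omega^*\bigr),$$ $$dH=-\phi H+H\phi+T\omega^*+\omega T^*,\qquad dT=-\phi T+\bigl(H^2+(\operatorname{tr}H)H+V I_n\bigr)\omega,$$ $$dV=(\operatorname{tr}H)(T^*\omega+\omega^*T)+(T^*H\omega+\omega^*HT).$$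 For $n\ge2$ this is equivalent to the vanishing of the Bochner curvature; for $n=1$ it is the definition. $H,T,V$ are unique. Bochner-Kähler structures are assumed real-analytic. Let $h_k$ be the $k$-th elementary symmetric function of the eigenvalues of $H$ (a function on $M$), $Z_{k+1}$ the vector field with $\Omega(Z_{k+1},\cdot)=-dh_k$ ($1\le k\le n$), and $m$ the dimension of the real span of $Z_2,\ldots,Z_{n+1}$ (the cohomogeneity). Let $N=\{dh_1\wedge\cdots\wedge dh_m=0\}$, $M^\circ=M\setminus N$ ($M^\circ=M$ if $m=0$), an open dense set. The polynomial $p_h(t)=\det(tI_n-H)$ factors uniquely as $p_h=p_{h''}p_{h'}$, where $p_{h''}$ is monic of degree $n-m$ with constant coefficients and $p_{h'}(t)=t^m-h'_1t^{m-1}+\cdots+(-1)^mh'_m$ has real-analytic coefficients on $M$ and its roots are real, and are distinct and functionally independent on $M^\circ$. The reduced momentum mapping is $h'=(h'_1,\ldots,h'_m):M\to\mathbb R^m$. The polynomial $p_C(t)=\det(tI_n-H)(t^2+h_1t+V)+T^*\operatorname{Cof}(tI_n-H)T$ (with $R\operatorname{Cof}(R)=\det(R)I_n$) has constant coefficients; $p_D=p_C/p_{h''}$ is the reduced characteristic polynomial, monic of degree $m+2$. Momentum cell: for each real root $r_i$ of $p_D$, let $\mu_i$ be the number of roots of $p_{h'}$ at $x\in M^\circ$ strictly greater than $r_i$ (independent of $x\in M^\circ$). $C(p_D,\mu)\subset\mathbb R^m$ is the set of $(x_1,\ldots,x_m)$ such that, for every real root $r_i$ of $p_D$, $(-1)^{\mu_i}\bigl(r_i^m-r_i^{m-1}x_1+\cdots+(-1)^mx_m\bigr)\ge0$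 if $r_i$ is a simple root and $>0$ if $r_i$ is a multiple root. It contains $h'(M)$. *)

theory Defs
  imports
    "HOL-Analysis.Analysis"
    "HOL-Library.Function_Algebras"
begin

section \<open>Function spaces as real vector spaces\<close>

text \<open>Tangent vectors and vector fields are functions below; the library provides their
  pointwise addition, but not the pointwise real vector space structure.\<close>

instantiation "fun" :: (type, real_vector) real_vector
begin

definition scaleR_fun :: "real \<Rightarrow> ('a \<Rightarrow> 'b) \<Rightarrow> 'a \<Rightarrow> 'b" where
  "scaleR_fun r f = (\<lambda>x. r *\<^sub>R f x)"

instance
  by standard (simp_all add: scaleR_fun_def plus_fun_def fun_eq_iff scaleR_right_distrib
      scaleR_left_distrib)

end


section \<open>Calculus on Euclidean spaces and on embedded submanifolds\<close>

definition real_analytic_on :: "('e::euclidean_space \<Rightarrow> real) \<Rightarrow> 'e set \<Rightarrow> bool" where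
  "real_analytic_on f S \<longleftrightarrow>
    (\<forall>a\<in>S. \<exists>r>0. \<exists>c :: ('e \<Rightarrow> nat) \<Rightarrow> real. \<forall>z\<in>ball a r.
      ((\<lambda>\<alpha>. c \<alpha> * (\<Prod>b\<in>Basis. ((z - a) \<bullet> b) ^ \<alpha> b)) has_sum f z) (Basis \<rightarrow>\<^sub>E UNIV))"

definition holomorphic_map_on ::
    "(complex^'n \<Rightarrow> complex^'n) \<Rightarrow> (complex^'n::finite) set \<Rightarrow> bool" where
  "holomorphic_map_on f S \<longleftrightarrow>
    (\<forall>z\<in>S. \<exists>D. (f has_derivative D) (at z) \<and> (\<forall>c v. D (c *s v) = c *s D v))"

definition tangent_vectors :: "'e::real_normed_vector set \<Rightarrow> 'e \<Rightarrow> 'e set" where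
  "tangent_vectors S p =
    {v. \<exists>\<gamma>. \<gamma> 0 = p \<and> (\<forall>t::real. \<gamma> t \<in> S) \<and> (\<gamma> has_vector_derivative v) (at 0)}"

text \<open>A 1-form on an embedded submanifold \<open>S\<close> is given by any map \<open>\<alpha>\<close> with \<open>\<alpha> p\<close> linear on
  the ambient space; only the restriction of \<open>\<alpha> p\<close> to the tangent space at \<open>p \<in> S\<close> matters.
  A 2-form is evaluated on pairs of tangent vectors, with the convention
  \<open>(\<alpha> \<and> \<beta>)(v,w) = \<alpha>(v) \<beta>(w) - \<alpha>(w) \<beta>(v)\<close> and, accordingly,
  \<open>d\<alpha>(v,w) = (D\<^sub>v \<alpha>)(w) - (D\<^sub>w \<alpha>)(v)\<close>. For \<open>v, w\<close> tangent to \<open>S\<close> this value does not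
  depend on the representative \<open>\<alpha>\<close>.\<close>

definition has_differential_on ::
    "('e::real_normed_vector \<Rightarrow> 'f::real_normed_vector) \<Rightarrow> ('e \<Rightarrow> 'e \<Rightarrow> 'f) \<Rightarrow> 'e set \<Rightarrow> bool" where
  "has_differential_on f \<alpha> S \<longleftrightarrow>
    (\<forall>p\<in>S. \<exists>D. (f has_derivative D) (at p within S) \<and> (\<forall>v\<in>tangent_vectors S p. D v = \<alpha> p v))"

definition has_exterior_derivative_on ::
    "('e::real_normed_vector \<Rightarrow> 'e \<Rightarrow> 'f::real_normed_vector) \<Rightarrow>
     ('e \<Rightarrow> 'e \<Rightarrow> 'e \<Rightarrow> 'f) \<Rightarrow> 'e set \<Rightarrow> bool" where
  "has_exterior_derivative_on \<alpha> \<beta> S \<longleftrightarrow>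
    (\<forall>p\<in>S. \<exists>D. (\<forall>w. ((\<lambda>q. \<alpha> q w) has_derivative (\<lambda>v. D v w)) (at p within S)) \<and>
      (\<forall>v\<in>tangent_vectors S p. \<forall>w\<in>tangent_vectors S p. \<beta> p v w = D v w - D w v))"


section \<open>Hermitian matrices\<close>

definition adjoint_matrix :: "complex^'n^'n \<Rightarrow> complex^'n^'n::finite" where
  "adjoint_matrix B = (\<chi> i j. cnj (B $ j $ i))"

text \<open>\<open>herm v w\<close> is the scalar \<open>v\<^sup>* w\<close> and \<open>outer v w\<close> is the matrix \<open>v w\<^sup>*\<close>.\<close>

definition herm :: "complex^'n::finite \<Rightarrow> complex^'n \<Rightarrow> complex" where
  "herm v w = (\<Sum>i\<in>UNIV. cnj (v $ i) * w $ i)"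

definition outer :: "complex^'n::finite \<Rightarrow> complex^'n \<Rightarrow> complex^'n^'n" where
  "outer v w = (\<chi> i j. v $ i * cnj (w $ j))"

definition mscale :: "complex \<Rightarrow> complex^'n^'n \<Rightarrow> complex^'n^'n::finite" where
  "mscale c B = (\<chi> i j. c * B $ i $ j)"

text \<open>The matrix \<open>t I - B\<close> over the polynomials in \<open>t\<close>.\<close>

definition char_matrix :: "complex^'n^'n::finite \<Rightarrow> complex poly^'n^'n" where
  "char_matrix B = (\<chi> i j. [:- B $ i $ j, if i = j then 1 else 0:])"

text \<open>The matrix with \<open>R ** Cof R = mat (det R)\<close>: the \<open>(i,j)\<close> entry is the determinant of
  \<open>R\<close> with row \<open>j\<close> replaced by the \<open>i\<close>-th unit row.\<close>

definition Cof :: "'r::comm_ring_1^'n^'n::finite \<Rightarrow> 'r^'n^'n" where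
  "Cof R = (\<chi> i j. det (\<chi> k l. if k = j then (if l = i then 1 else 0) else R $ k $ l))"

definition eigenvalues :: "complex^'n^'n::finite \<Rightarrow> 'n \<Rightarrow> complex" where
  "eigenvalues B = (SOME l. det (char_matrix B) = (\<Prod>i\<in>UNIV. [:- l i, 1:]))"

definition elem_sym :: "nat \<Rightarrow> ('n::finite \<Rightarrow> 'r::comm_ring_1) \<Rightarrow> 'r" where
  "elem_sym k l = (\<Sum>I | card I = k. \<Prod>i\<in>I. l i)"


section \<open>Complex manifolds\<close>

text \<open>The manifold is the whole type \<open>'a\<close>. A tangent vector at \<open>x\<close> is the family of its
  coordinate representations in the charts around \<open>x\<close> (and \<open>0\<close> in the other charts).\<close>

type_synonym ('a, 'n) chart = "'a set \<times> ('a \<Rightarrow> complex^'n)"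
type_synonym ('a, 'n) tvec = "('a, 'n) chart \<Rightarrow> complex^'n"
type_synonym ('a, 'n) metric = "'a \<Rightarrow> ('a, 'n) tvec \<Rightarrow> ('a, 'n) tvec \<Rightarrow> real"

definition chart_image :: "('a, 'n::finite) chart \<Rightarrow> (complex^'n) set" where
  "chart_image c = snd c ` fst c"

definition chart_inv :: "('a, 'n::finite) chart \<Rightarrow> complex^'n \<Rightarrow> 'a" where
  "chart_inv c = inv_into (fst c) (snd c)"

definition charts_at :: "('a, 'n::finite) chart set \<Rightarrow> 'a \<Rightarrow> ('a, 'n) chart set" where
  "charts_at A x = {c \<in> A. x \<in> fst c}"

definition complex_atlas :: "('a::topological_space, 'n::finite) chart set \<Rightarrow> bool" where
  "complex_atlas A \<longleftrightarrow>
    (\<forall>x. charts_at A x \<noteq> {}) \<and>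
    (\<forall>c\<in>A. open (fst c) \<and> open (chart_image c) \<and>
      homeomorphism (fst c) (chart_image c) (snd c) (chart_inv c)) \<and>
    (\<forall>c\<in>A. \<forall>c'\<in>A. holomorphic_map_on (snd c' \<circ> chart_inv c) (snd c ` (fst c \<inter> fst c')))"

definition coord_vector ::
    "('a, 'n::finite) chart set \<Rightarrow> ('a, 'n) chart \<Rightarrow> 'a \<Rightarrow> complex^'n \<Rightarrow> ('a, 'n) tvec" where
  "coord_vector A c x w = (\<lambda>c'. if c' \<in> charts_at A x
     then frechet_derivative (snd c' \<circ> chart_inv c) (at (snd c x)) w else 0)"

definition tangent_space :: "('a, 'n::finite) chart set \<Rightarrow> 'a \<Rightarrow> ('a, 'n) tvec set" where
  "tangent_space A x = {v. (\<forall>c\<in>charts_at A x. v = coord_vector A c x (v c)) \<and>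
     (\<forall>c. c \<notin> charts_at A x \<longrightarrow> v c = 0)}"

definition cscale :: "complex \<Rightarrow> ('a, 'n::finite) tvec \<Rightarrow> ('a, 'n) tvec" where
  "cscale a v = (\<lambda>c. a *s v c)"

definition analytic_function ::
    "('a, 'n::finite) chart set \<Rightarrow> ('a \<Rightarrow> real) \<Rightarrow> bool" where
  "analytic_function A f \<longleftrightarrow> (\<forall>c\<in>A. real_analytic_on (f \<circ> chart_inv c) (chart_image c))"

text \<open>Differentiability and the differential do not depend on the chart chosen.\<close>

definition some_chart :: "('a, 'n::finite) chart set \<Rightarrow> 'a \<Rightarrow> ('a, 'n) chart" where
  "some_chart A x = (SOME c. c \<in> charts_at A x)"

definition differentiable_at ::
    "('a, 'n::finite) chart set \<Rightarrow> ('a \<Rightarrow> real) \<Rightarrow> 'a \<Rightarrow> bool" where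
  "differentiable_at A f x \<longleftrightarrow>
    (let c = some_chart A x in (f \<circ> chart_inv c) differentiable (at (snd c x)))"

definition differential ::
    "('a, 'n::finite) chart set \<Rightarrow> ('a \<Rightarrow> real) \<Rightarrow> 'a \<Rightarrow> ('a, 'n) tvec \<Rightarrow> real" where
  "differential A f x v =
    (let c = some_chart A x in frechet_derivative (f \<circ> chart_inv c) (at (snd c x)) (v c))"

text \<open>\<open>df\<^sub>1 \<and> \<dots> \<and> df\<^sub>m \<noteq> 0\<close> at the point \<open>x\<close>; for \<open>m = 0\<close> the empty wedge product is \<open>1\<close>.\<close>

definition wedge_nonzero_at ::
    "('a, 'n::finite) chart set \<Rightarrow> nat \<Rightarrow> (nat \<Rightarrow> 'a \<Rightarrow> real) \<Rightarrow> 'a \<Rightarrow> bool" where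
  "wedge_nonzero_at A m f x \<longleftrightarrow>
    (\<exists>v :: nat \<Rightarrow> ('a, 'n) tvec. (\<forall>i\<in>{1..m}. v i \<in> tangent_space A x) \<and>
      (\<Sum>\<sigma> | \<sigma> permutes {1..m}. of_int (sign \<sigma>) * (\<Prod>i\<in>{1..m}. differential A (f i) x (v (\<sigma> i))))
        \<noteq> 0)"


section \<open>Kaehler metrics and completeness\<close>

definition kaehler_form :: "('a, 'n::finite) metric \<Rightarrow> ('a, 'n) metric" where
  "kaehler_form g x v w = g x (cscale \<i> v) w"

definition hermitian_metric :: "('a, 'n::finite) chart set \<Rightarrow> ('a, 'n) metric \<Rightarrow> bool" where
  "hermitian_metric A g \<longleftrightarrow>
    (\<forall>x. \<forall>v\<in>tangent_space A x. \<forall>w\<in>tangent_space A x.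
      (\<forall>z\<in>tangent_space A x. g x (v + w) z = g x v z + g x w z) \<and>
      (\<forall>r. g x (r *\<^sub>R v) w = r * g x v w) \<and>
      g x v w = g x w v \<and>
      (v \<noteq> 0 \<longrightarrow> g x v v > 0) \<and>
      g x (cscale \<i> v) (cscale \<i> w) = g x v w)"

definition analytic_metric :: "('a, 'n::finite) chart set \<Rightarrow> ('a, 'n) metric \<Rightarrow> bool" where
  "analytic_metric A g \<longleftrightarrow>
    (\<forall>c\<in>A. \<forall>a b. real_analytic_on
      (\<lambda>z. let x = chart_inv c z in g x (coord_vector A c x a) (coord_vector A c x b))
      (chart_image c))"

definition closed_2form :: "('a, 'n::finite) chart set \<Rightarrow> ('a, 'n) metric \<Rightarrow> bool" where
  "closed_2form A \<Omega> \<longleftrightarrow>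
    (\<forall>c\<in>A. \<forall>z\<in>chart_image c. \<forall>a b e.
      (let \<Omega>c = (\<lambda>v w z. let x = chart_inv c z in \<Omega> x (coord_vector A c x v) (coord_vector A c x w))
       in frechet_derivative (\<Omega>c b e) (at z) a + frechet_derivative (\<Omega>c e a) (at z) b
          + frechet_derivative (\<Omega>c a b) (at z) e = 0))"

definition kaehler_manifold ::
    "('a::{t2_space,second_countable_topology}, 'n::finite) chart set \<Rightarrow> ('a, 'n) metric \<Rightarrow> bool" where
  "kaehler_manifold A g \<longleftrightarrow>
    complex_atlas A \<and> hermitian_metric A g \<and> analytic_metric A g \<and>
    closed_2form A (kaehler_form g)"

definition velocity ::
    "('a, 'n::finite) chart set \<Rightarrow> (real \<Rightarrow> 'a) \<Rightarrow> real \<Rightarrow> ('a, 'n) tvec" where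
  "velocity A \<gamma> t = (\<lambda>c. if c \<in> charts_at A (\<gamma> t)
     then vector_derivative (snd c \<circ> \<gamma>) (at t) else 0)"

definition speed ::
    "('a, 'n::finite) chart set \<Rightarrow> ('a, 'n) metric \<Rightarrow> (real \<Rightarrow> 'a) \<Rightarrow> real \<Rightarrow> real" where
  "speed A g \<gamma> t = sqrt (g (\<gamma> t) (velocity A \<gamma> t) (velocity A \<gamma> t))"

text \<open>Piecewise C1 is understood as in the library: C1 off a finite set, with no condition on
  the derivative there, whence the integrability condition.\<close>

definition rectifiable_curve ::
    "('a::topological_space, 'n::finite) chart set \<Rightarrow> ('a, 'n) metric \<Rightarrow> (real \<Rightarrow> 'a) \<Rightarrow> bool" where
  "rectifiable_curve A g \<gamma> \<longleftrightarrow>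
    path \<gamma> \<and>
    (\<exists>F. finite F \<and> (\<forall>c\<in>A. (snd c \<circ> \<gamma>) C1_differentiable_on {t \<in> {0..1} - F. \<gamma> t \<in> fst c})) \<and>
    speed A g \<gamma> integrable_on {0..1}"

definition riemannian_dist ::
    "('a::topological_space, 'n::finite) chart set \<Rightarrow> ('a, 'n) metric \<Rightarrow> 'a \<Rightarrow> 'a \<Rightarrow> real" where
  "riemannian_dist A g x y =
    Inf {integral {0..1} (speed A g \<gamma>) | \<gamma>.
      rectifiable_curve A g \<gamma> \<and> pathstart \<gamma> = x \<and> pathfinish \<gamma> = y}"

definition complete_metric ::
    "('a::topological_space, 'n::finite) chart set \<Rightarrow> ('a, 'n) metric \<Rightarrow> bool" where
  "complete_metric A g \<longleftrightarrow>
    (\<forall>\<sigma> :: nat \<Rightarrow> 'a.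
      (\<forall>\<epsilon>>0. \<exists>N. \<forall>i\<ge>N. \<forall>j\<ge>N. riemannian_dist A g (\<sigma> i) (\<sigma> j) < \<epsilon>) \<longrightarrow>
      (\<exists>x. (\<lambda>i. riemannian_dist A g (\<sigma> i) x) \<longlonglongrightarrow> 0))"


section \<open>The unitary coframe bundle\<close>

type_synonym ('a, 'n) coframe = "'a \<times> (('a, 'n) tvec \<Rightarrow> complex^'n)"

definition coframe_bundle ::
    "('a, 'n::finite) chart set \<Rightarrow> ('a, 'n) metric \<Rightarrow> ('a, 'n) coframe set" where
  "coframe_bundle A g =
    {(x, u). u \<in> extensional (tangent_space A x) \<and>
      u ` tangent_space A x = UNIV \<and>
      (\<forall>v\<in>tangent_space A x. \<forall>w\<in>tangent_space A x.
        u (v + w) = u v + u w \<and> (\<forall>a. u (cscale a v) = a *s u v) \<and> u v \<bullet> u w = g x v w)}"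

text \<open>Over the domain of a chart, the bundle is identified with an embedded submanifold
  \<open>bundle_chart\<close> of the vector space of pairs \<open>(z, B)\<close>: the point has coordinates \<open>z\<close>, and the
  coframe is \<open>v \<mapsto> B v\<close> in the coordinates of the chart.\<close>

definition coframe_of ::
    "('a, 'n::finite) chart set \<Rightarrow> ('a, 'n) chart \<Rightarrow> (complex^'n) \<times> (complex^'n^'n) \<Rightarrow> ('a, 'n) coframe" where
  "coframe_of A c = (\<lambda>(z, B). (chart_inv c z, \<lambda>v\<in>tangent_space A (chart_inv c z). B *v v c))"

definition bundle_chart ::
    "('a, 'n::finite) chart set \<Rightarrow> ('a, 'n) metric \<Rightarrow> ('a, 'n) chart \<Rightarrow>
     ((complex^'n) \<times> (complex^'n^'n)) set" where
  "bundle_chart A g c = {p. fst p \<in> chart_image c \<and> coframe_of A c p \<in> coframe_bundle A g}"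

text \<open>The tautological form \<open>\<omega>(v) = u(\<pi>'(v))\<close>: a tangent vector \<open>v\<close> at \<open>(z, B)\<close> projects to
  the vector with coordinates \<open>fst v\<close>.\<close>

definition taut_form ::
    "(complex^'n) \<times> (complex^'n^'n) \<Rightarrow> (complex^'n) \<times> (complex^'n^'n) \<Rightarrow> complex^'n::finite" where
  "taut_form p v = snd p *v fst v"

definition connection_form ::
    "('a, 'n::finite) chart set \<Rightarrow> ('a, 'n) metric \<Rightarrow> ('a, 'n) chart \<Rightarrow>
     ((complex^'n) \<times> (complex^'n^'n) \<Rightarrow> (complex^'n) \<times> (complex^'n^'n) \<Rightarrow> complex^'n^'n) \<Rightarrow> bool" where
  "connection_form A g c \<phi> \<longleftrightarrow>
    (\<forall>p\<in>bundle_chart A g c. linear (\<phi> p) \<and>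
      (\<forall>v\<in>tangent_vectors (bundle_chart A g c) p. adjoint_matrix (\<phi> p v) = - \<phi> p v)) \<and>
    has_exterior_derivative_on taut_form
      (\<lambda>p v w. - (\<phi> p v *v taut_form p w - \<phi> p w *v taut_form p v))
      (bundle_chart A g c)"


section \<open>Bochner-Kaehler structures\<close>

definition curvature_rhs ::
    "complex^'n^'n \<Rightarrow> complex^'n^'n \<Rightarrow> complex^'n^'n \<Rightarrow> complex^'n \<Rightarrow> complex^'n \<Rightarrow> complex^'n^'n::finite" where
  "curvature_rhs H \<phi>v \<phi>w \<omega>v \<omega>w =
    (let s = herm \<omega>v \<omega>w - herm \<omega>w \<omega>v;
         S = outer \<omega>v \<omega>w - outer \<omega>w \<omega>v
     in - (\<phi>v ** \<phi>w - \<phi>w ** \<phi>v)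
        + mscale s H - H ** S - S ** H
        + mat (herm \<omega>v (H *v \<omega>w) - herm \<omega>w (H *v \<omega>v))
        + mscale (trace H) (mat s - S))"

text \<open>The structure functions \<open>H\<close>, \<open>T\<close>, \<open>V\<close> are functions on the coframe bundle; their values
  off the bundle are irrelevant.\<close>

definition bochner_kaehler ::
    "('a, 'n::finite) chart set \<Rightarrow> ('a, 'n) metric \<Rightarrow> (('a, 'n) coframe \<Rightarrow> complex^'n^'n) \<Rightarrow>
     (('a, 'n) coframe \<Rightarrow> complex^'n) \<Rightarrow> (('a, 'n) coframe \<Rightarrow> real) \<Rightarrow> bool" where
  "bochner_kaehler A g H T V \<longleftrightarrow>
    (\<forall>u\<in>coframe_bundle A g. adjoint_matrix (H u) = H u) \<and>
    (\<forall>c\<in>A. \<exists>\<phi>. connection_form A g c \<phi> \<and>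
      (let P = bundle_chart A g c;
           \<omega> = taut_form;
           Hc = H \<circ> coframe_of A c;
           Tc = T \<circ> coframe_of A c;
           Vc = (\<lambda>p. complex_of_real (V (coframe_of A c p)))
       in
        has_exterior_derivative_on \<phi>
          (\<lambda>p v w. curvature_rhs (Hc p) (\<phi> p v) (\<phi> p w) (\<omega> p v) (\<omega> p w)) P \<and>
        has_differential_on Hc
          (\<lambda>p v. - (\<phi> p v ** Hc p) + Hc p ** \<phi> p v + outer (Tc p) (\<omega> p v) + outer (\<omega> p v) (Tc p)) P \<and>
        has_differential_on Tc
          (\<lambda>p v. - (\<phi> p v *v Tc p)
             + (Hc p ** Hc p + mscale (trace (Hc p)) (Hc p) + mat (Vc p)) *v \<omega> p v) P \<and>
        has_differential_on Vc
          (\<lambda>p v. trace (Hc p) * (herm (Tc p) (\<omega> p v) + herm (\<omega> p v) (Tc p))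
             + (herm (Tc p) (Hc p *v \<omega> p v) + herm (\<omega> p v) (Hc p *v Tc p))) P))"

text \<open>The quantities below are invariant under the unitary group, hence do not depend on the
  coframe chosen at \<open>x\<close>.\<close>

definition some_coframe ::
    "('a, 'n::finite) chart set \<Rightarrow> ('a, 'n) metric \<Rightarrow> 'a \<Rightarrow> ('a, 'n) coframe" where
  "some_coframe A g x = (SOME p. p \<in> coframe_bundle A g \<and> fst p = x)"

text \<open>\<open>det (t I - H)\<close> and the polynomial \<open>p_C\<close> below have real coefficients; they are taken to
  be real polynomials via the real parts.\<close>

definition h_poly ::
    "('a, 'n::finite) chart set \<Rightarrow> ('a, 'n) metric \<Rightarrow> (('a, 'n) coframe \<Rightarrow> complex^'n^'n) \<Rightarrow>
     'a \<Rightarrow> real poly" where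
  "h_poly A g H x = map_poly Re (det (char_matrix (H (some_coframe A g x))))"

definition h_fun ::
    "('a, 'n::finite) chart set \<Rightarrow> ('a, 'n) metric \<Rightarrow> (('a, 'n) coframe \<Rightarrow> complex^'n^'n) \<Rightarrow>
     nat \<Rightarrow> 'a \<Rightarrow> real" where
  "h_fun A g H k x = Re (elem_sym k (eigenvalues (H (some_coframe A g x))))"

definition C_poly ::
    "('a, 'n::finite) chart set \<Rightarrow> ('a, 'n) metric \<Rightarrow> (('a, 'n) coframe \<Rightarrow> complex^'n^'n) \<Rightarrow>
     (('a, 'n) coframe \<Rightarrow> complex^'n) \<Rightarrow> (('a, 'n) coframe \<Rightarrow> real) \<Rightarrow> 'a \<Rightarrow> real poly" where
  "C_poly A g H T V x =
    (let u = some_coframe A g x; R = char_matrix (H u)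
     in map_poly Re
       (det R * [:complex_of_real (V u), complex_of_real (h_fun A g H 1 x), 1:]
        + (\<Sum>i\<in>UNIV. \<Sum>j\<in>UNIV. [:cnj (T u $ i):] * Cof R $ i $ j * [:T u $ j:])))"

text \<open>The vector field \<open>Z\<^bsub>k+1\<^esub>\<close>.\<close>

definition momentum_field ::
    "('a, 'n::finite) chart set \<Rightarrow> ('a, 'n) metric \<Rightarrow> (('a, 'n) coframe \<Rightarrow> complex^'n^'n) \<Rightarrow>
     nat \<Rightarrow> 'a \<Rightarrow> ('a, 'n) tvec" where
  "momentum_field A g H k x =
    (THE v. v \<in> tangent_space A x \<and>
      (\<forall>w\<in>tangent_space A x. kaehler_form g x v w = - differential A (h_fun A g H k) x w))"

definition cohomogeneity ::
    "('a, 'n::finite) chart set \<Rightarrow> ('a, 'n) metric \<Rightarrow> (('a, 'n) coframe \<Rightarrow> complex^'n^'n) \<Rightarrow> nat" where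
  "cohomogeneity A g H = dim (span (momentum_field A g H ` {1..CARD('n)}))"

definition regular_set ::
    "('a, 'n::finite) chart set \<Rightarrow> ('a, 'n) metric \<Rightarrow> (('a, 'n) coframe \<Rightarrow> complex^'n^'n) \<Rightarrow> 'a set" where
  "regular_set A g H = {x. wedge_nonzero_at A (cohomogeneity A g H) (h_fun A g H) x}"

text \<open>The reduced polynomial \<open>p_{h'}\<close> at \<open>x\<close> and its coefficients \<open>h'\<^sub>k\<close>, for a given constant
  factor \<open>q\<close> of \<open>p_h\<close>.\<close>

definition reduced_poly ::
    "('a, 'n::finite) chart set \<Rightarrow> ('a, 'n) metric \<Rightarrow> (('a, 'n) coframe \<Rightarrow> complex^'n^'n) \<Rightarrow>
     real poly \<Rightarrow> 'a \<Rightarrow> real poly" where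
  "reduced_poly A g H q x = h_poly A g H x div q"

definition reduced_h ::
    "('a, 'n::finite) chart set \<Rightarrow> ('a, 'n) metric \<Rightarrow> (('a, 'n) coframe \<Rightarrow> complex^'n^'n) \<Rightarrow>
     real poly \<Rightarrow> nat \<Rightarrow> 'a \<Rightarrow> real" where
  "reduced_h A g H q k x =
    (-1) ^ k * coeff (reduced_poly A g H q x) (cohomogeneity A g H - k)"

definition ordered_root :: "('a \<Rightarrow> real poly) \<Rightarrow> nat \<Rightarrow> 'a \<Rightarrow> real" where
  "ordered_root p i x = sorted_list_of_set {t. poly (p x) t = 0} ! (i - 1)"

text \<open>\<open>q\<close> is the factor \<open>p_{h''}\<close> of \<open>p_h\<close>.\<close>

definition constant_factor ::
    "('a, 'n::finite) chart set \<Rightarrow> ('a, 'n) metric \<Rightarrow> (('a, 'n) coframe \<Rightarrow> complex^'n^'n) \<Rightarrow>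
     real poly \<Rightarrow> bool" where
  "constant_factor A g H q \<longleftrightarrow>
    (let m = cohomogeneity A g H; p = reduced_poly A g H q in
      lead_coeff q = 1 \<and> degree q + m = CARD('n) \<and>
      (\<forall>x. h_poly A g H x = q * p x) \<and>
      (\<forall>k\<in>{1..m}. analytic_function A (reduced_h A g H q k)) \<and>
      (\<forall>x t. poly (map_poly complex_of_real (p x)) t = 0 \<longrightarrow> t \<in> \<real>) \<and>
      (\<forall>x\<in>regular_set A g H.
        card {t. poly (p x) t = 0} = m \<and>
        (\<forall>i\<in>{1..m}. differentiable_at A (ordered_root p i) x) \<and>
        wedge_nonzero_at A m (ordered_root p) x))"

text \<open>Points \<open>(x\<^sub>1, \<dots>, x\<^sub>m)\<close> of \<open>\<real>\<^sup>m\<close> are the functions in \<open>{1..m} \<rightarrow>\<^sub>E UNIV\<close>.\<close>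

definition reduced_momentum ::
    "('a, 'n::finite) chart set \<Rightarrow> ('a, 'n) metric \<Rightarrow> (('a, 'n) coframe \<Rightarrow> complex^'n^'n) \<Rightarrow>
     real poly \<Rightarrow> 'a \<Rightarrow> nat \<Rightarrow> real" where
  "reduced_momentum A g H q x = (\<lambda>k\<in>{1..cohomogeneity A g H}. reduced_h A g H q k x)"

text \<open>The next two are evaluated at a point; they are independent of it (for \<open>root_index\<close>, as
  long as it is a regular point).\<close>

definition reduced_char_poly ::
    "('a, 'n::finite) chart set \<Rightarrow> ('a, 'n) metric \<Rightarrow> (('a, 'n) coframe \<Rightarrow> complex^'n^'n) \<Rightarrow>
     (('a, 'n) coframe \<Rightarrow> complex^'n) \<Rightarrow> (('a, 'n) coframe \<Rightarrow> real) \<Rightarrow> real poly \<Rightarrow> 'a \<Rightarrow> real poly" where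
  "reduced_char_poly A g H T V q x = C_poly A g H T V x div q"

definition root_index ::
    "('a, 'n::finite) chart set \<Rightarrow> ('a, 'n) metric \<Rightarrow> (('a, 'n) coframe \<Rightarrow> complex^'n^'n) \<Rightarrow>
     real poly \<Rightarrow> 'a \<Rightarrow> real \<Rightarrow> nat" where
  "root_index A g H q x r = card {t. poly (reduced_poly A g H q x) t = 0 \<and> t > r}"

definition momentum_cell :: "nat \<Rightarrow> real poly \<Rightarrow> (real \<Rightarrow> nat) \<Rightarrow> (nat \<Rightarrow> real) set" where
  "momentum_cell m p \<mu> =
    {x \<in> {1..m} \<rightarrow>\<^sub>E UNIV. \<forall>r. poly p r = 0 \<longrightarrow>
      (let s = (-1) ^ \<mu> r * (r ^ m + (\<Sum>k=1..m. (-1) ^ k * r ^ (m - k) * x k))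
       in if order r p = 1 then s \<ge> 0 else s > 0)}"

definition bounded_in_Rm :: "nat \<Rightarrow> (nat \<Rightarrow> real) set \<Rightarrow> bool" where
  "bounded_in_Rm m C \<longleftrightarrow> (\<exists>b. \<forall>x\<in>C. L2_set x {1..m} \<le> b)"

end

(* Write p_h = q * p with p the reduced polynomial. In an eigenbasis of H with eigenvalues l_k,
   p_C = p_h (t^2 + h_1 t + V) + sum_k |T_k|^2 prod_{j <> k} (t - l_j), so that at a root r of p
   the value of p_D is p'(r) times the sum of |T_k|^2 over l_k = r. At a regular point these sums
   are positive, hence p_D has a root just below each root of p; let S be the set of these m roots.
   For any p whose coefficients lie in the cell, p = prod_{s in S} (t - s) - sum_{s in S} a_s
   prod_{s' <> s} (t - s') with weights a_s >= 0. If p_D has a root R to the right of all roots of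
   p, then p(R) >= 0 bounds the weights, and the cell is bounded. Otherwise p_D > 0 on some
   half-line t >= t0 with p(t0) < 0 at the regular point. On the region where p(t0) < 0 the function
   f = (- p(t0))^(-1/2) is positive and tends to infinity at the boundary, and the structure
   equations together with a_s >= 0 bound |grad f| below by a positive constant; by Ekeland's
   variational principle this is impossible on a complete manifold. *)
theory Submission
  imports Defs "HOL-Complex_Analysis.Cauchy_Integral_Formula"
begin

section \<open>Hermitian matrices\<close>

text \<open>The exponent -1/2 is dictated by the structure equations. With
  \<open>w = (t - H)^{-1} T\<close> they give \<open>d p_h(t) = -2 p_h(t) Re(w^* \<omega>)\<close>,
  hence \<open>|grad G| = 2 G |w|\<close> for \<open>G = - p(t0)\<close>, and
  \<open>|grad G^{-1/2}| = |w| / sqrt G\<close>. As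
  \<open>|w|^2 = sum_k |T_k|^2 / (t0 - l_k)^2\<close>, a lower bound for the slope is the algebraic
  inequality \<open>|w|^2 >= C G\<close>. The weights make it provable uniformly on M: the
  inequalities of the cell at S say that all a_s in
  \<open>p / prod (t - s) = 1 - sum a_s / (t - s)\<close> are nonnegative. Ekeland's principle
  replaces geodesics and gradient flows: it asks for the triangle inequality, short segments in
  charts, and the fact that convergence in distance implies convergence in a chart. One obstacle
  shapes the calculus. H, T and V live on the coframe bundle, so derivatives on M are taken along
  local sections. These are built with a matrix square root, whose derivative is computed at the
  identity, so every point gets a section based at itself.\<close>

lemma herm_add_left: "herm (v + w) z = herm v z + herm w z"
  by (simp add: herm_def algebra_simps sum.distrib)

lemma herm_add_right: "herm z (v + w) = herm z v + herm z w"
  by (simp add: herm_def algebra_simps sum.distrib)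

lemma herm_scale_left: "herm (c *s v) w = cnj c * herm v w"
  by (simp add: herm_def algebra_simps sum_distrib_left)

lemma herm_scale_right: "herm v (c *s w) = c * herm v w"
  by (simp add: herm_def algebra_simps sum_distrib_left)

lemma scaleR_eq_scale: "r *\<^sub>R (v::complex^'n) = complex_of_real r *s v"
  by (simp add: vec_eq_iff) (simp add: scaleR_conv_of_real)

lemma herm_minus_left: "herm (- v) w = - herm v w"
  by (simp add: herm_def sum_negf)

lemma herm_minus_right: "herm v (- w) = - herm v w"
  by (simp add: herm_def sum_negf)

lemma herm_diff_left: "herm (v - w) z = herm v z - herm w z"
  by (simp add: herm_def algebra_simps sum_subtractf)

lemma herm_diff_right: "herm z (v - w) = herm z v - herm z w"
  by (simp add: herm_def algebra_simps sum_subtractf)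

lemma herm_zero_left [simp]: "herm 0 w = 0" and herm_zero_right [simp]: "herm w 0 = 0"
  by (simp_all add: herm_def)

lemma herm_sum_left: "herm (\<Sum>i\<in>I. f i) w = (\<Sum>i\<in>I. herm (f i) w)"
  by (induction I rule: infinite_finite_induct) (simp_all add: herm_add_left)

lemma herm_sum_right: "herm w (\<Sum>i\<in>I. f i) = (\<Sum>i\<in>I. herm w (f i))"
  by (induction I rule: infinite_finite_induct) (simp_all add: herm_add_right)

lemmas herm_linear = herm_add_left herm_add_right herm_scale_left herm_scale_right
  herm_minus_left herm_minus_right herm_diff_left herm_diff_right

lemma cnj_herm: "cnj (herm v w) = herm w v"
  by (simp add: herm_def mult.commute)

lemma Re_herm: "Re (herm v w) = v \<bullet> w"
  by (simp add: herm_def inner_vec_def inner_complex_def)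

lemma herm_self: "herm v v = complex_of_real ((norm v)\<^sup>2)"
proof (rule complex_eqI)
  show "Re (herm v v) = Re (complex_of_real ((norm v)\<^sup>2))"
    by (simp add: Re_herm dot_square_norm)
  show "Im (herm v v) = Im (complex_of_real ((norm v)\<^sup>2))"
    using arg_cong[OF cnj_herm[of v v], of Im] by simp
qed

lemma norm_scale_vec: "norm (c *s (v::complex^'n)) = cmod c * norm v"
  by (simp add: norm_vec_def norm_mult L2_set_right_distrib)

lemma adjoint_matrix_adjoint [simp]: "adjoint_matrix (adjoint_matrix B) = B"
  by (simp add: adjoint_matrix_def vec_eq_iff)

lemma herm_mult_right: "herm v (B *v w) = herm (adjoint_matrix B *v v) w"
proof -
  have "herm v (B *v w) = (\<Sum>i\<in>UNIV. \<Sum>j\<in>UNIV. cnj (v $ i) * (B $ i $ j * w $ j))"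
    by (simp add: herm_def matrix_vector_mult_def sum_distrib_left)
  also have "\<dots> = (\<Sum>j\<in>UNIV. \<Sum>i\<in>UNIV. cnj (v $ i) * (B $ i $ j * w $ j))"
    by (rule sum.swap)
  also have "\<dots> = herm (adjoint_matrix B *v v) w"
    by (simp add: herm_def matrix_vector_mult_def adjoint_matrix_def sum_distrib_right sum_distrib_left mult_ac)
  finally show ?thesis .
qed

lemma herm_mult_left: "herm (B *v v) w = herm v (adjoint_matrix B *v w)"
  by (simp add: herm_mult_right)

lemma adjoint_matrix_mult: "adjoint_matrix (B ** C) = adjoint_matrix C ** adjoint_matrix B"
  by (simp add: adjoint_matrix_def matrix_matrix_mult_def vec_eq_iff mult.commute)

lemma adjoint_matrix_mat [simp]: "adjoint_matrix (mat c) = mat (cnj c)"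
  by (simp add: adjoint_matrix_def mat_def vec_eq_iff)

lemma adjoint_matrix_diff: "adjoint_matrix (B - C) = adjoint_matrix B - adjoint_matrix C"
  by (simp add: adjoint_matrix_def vec_eq_iff)

lemma mat_mult_vec [simp]: "mat c *v (v::'r::comm_semiring_1^'n) = c *s v"
proof -
  have "(\<Sum>j\<in>UNIV. (if i = j then c else 0) * v $ j) = c * v $ i" for i
    by (subst sum.cong[OF refl, of _ _ "\<lambda>j. if i = j then c * v $ j else 0"]) auto
  then show ?thesis
    by (simp add: vec_eq_iff matrix_vector_mult_def mat_def)
qed

lemma outer_mult_vec: "outer a b *v c = herm b c *s a"
  by (simp add: outer_def vec_eq_iff matrix_vector_mult_def herm_def sum_distrib_left sum_distrib_right mult_ac)

lemma mult_vec_scale: "B *v (c *s v) = c *s (B *v (v::'r::comm_semiring_1^'n))"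
  by (simp add: vec_eq_iff matrix_vector_mult_def sum_distrib_left mult_ac)

lemma mult_vec_sum: "(B::'r::comm_ring_1^'n^'m) *v (\<Sum>i\<in>I. f i) = (\<Sum>i\<in>I. B *v f i)"
  by (induction I rule: infinite_finite_induct) (simp_all add: matrix_vector_right_distrib)

lemma mscale_mult_vec: "mscale c B *v v = c *s (B *v v)"
  by (simp add: mscale_def vec_eq_iff matrix_vector_mult_def sum_distrib_left mult_ac)

lemma mat_mult_left: "mat c ** B = mscale c B"
proof -
  have "(\<Sum>k\<in>UNIV. (if i = k then c else 0) * B $ k $ j) = c * B $ i $ j" for i j
    by (subst sum.cong[OF refl, of _ _ "\<lambda>k. if i = k then c * B $ k $ j else 0"]) auto
  then show ?thesis
    by (simp add: vec_eq_iff matrix_matrix_mult_def mat_def mscale_def)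
qed

lemma mat_mult_right: "B ** mat c = mscale c B"
proof -
  have "(\<Sum>k\<in>UNIV. B $ i $ k * (if k = j then c else 0)) = c * B $ i $ j" for i j
    by (subst sum.cong[OF refl, of _ _ "\<lambda>k. if k = j then c * B $ i $ k else 0"]) auto
  then show ?thesis
    by (simp add: vec_eq_iff matrix_matrix_mult_def mat_def mscale_def)
qed

lemma matrix_diff_ldistrib: "B ** (C - D) = B ** C - B ** (D::'r::comm_ring_1^'n^'m)"
  by (simp add: vec_eq_iff matrix_matrix_mult_def algebra_simps sum_subtractf)

lemma matrix_diff_rdistrib: "(C - D) ** B = C ** B - (D::'r::comm_ring_1^'n^'m) ** B"
  by (simp add: vec_eq_iff matrix_matrix_mult_def algebra_simps sum_subtractf)

lemma mult_mscale: "B ** mscale c C = mscale c (B ** C)"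
  by (simp add: vec_eq_iff matrix_matrix_mult_def mscale_def sum_distrib_left mult_ac)

lemma mscale_mult: "mscale c B ** C = mscale c (B ** C)"
  by (simp add: vec_eq_iff matrix_matrix_mult_def mscale_def sum_distrib_left mult_ac)

lemma mult_outer: "B ** outer a b = outer (B *v a) b"
  by (simp add: outer_def vec_eq_iff matrix_matrix_mult_def matrix_vector_mult_def sum_distrib_right sum_distrib_left mult_ac)

lemma trace_outer: "trace (outer a b) = herm b a"
  by (simp add: outer_def trace_def herm_def mult.commute)

section \<open>Orthonormal bases and the spectral theorem\<close>

definition onb :: "('n::finite \<Rightarrow> complex^'n) \<Rightarrow> bool" where
  "onb e \<longleftrightarrow> (\<forall>i j. herm (e i) (e j) = (if i = j then 1 else 0))"

lemma onb_matrix: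
  assumes "onb e"
  defines "E \<equiv> (\<chi> i k. e k $ i)"
  shows "adjoint_matrix E ** E = mat 1" "E ** adjoint_matrix E = mat 1"
proof -
  show 1: "adjoint_matrix E ** E = mat 1"
    using assms(1)
    by (simp add: onb_def E_def adjoint_matrix_def matrix_matrix_mult_def mat_def vec_eq_iff herm_def)
  then show "E ** adjoint_matrix E = mat 1"
    by (simp add: matrix_left_right_inverse)
qed

lemma onb_expand:
  assumes "onb e"
  shows "v = (\<Sum>k\<in>UNIV. herm (e k) v *s e k)"
proof -
  define E :: "complex^'a^'a" where "E = (\<chi> i k. e k $ i)"
  have "v = E *v (adjoint_matrix E *v v)"
    using onb_matrix(2)[OF assms] by (simp add: matrix_vector_mul_assoc E_def)
  also have "\<dots> = (\<Sum>k\<in>UNIV. herm (e k) v *s e k)"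
    by (simp add: vec_eq_iff matrix_vector_mult_def E_def adjoint_matrix_def herm_def mult.commute)
  finally show ?thesis .
qed

lemma onb_parseval:
  assumes "onb e"
  shows "herm v w = (\<Sum>k\<in>UNIV. cnj (herm (e k) v) * herm (e k) w)"
proof -
  have "herm v w = herm (\<Sum>k\<in>UNIV. herm (e k) v *s e k) w"
    using onb_expand[OF assms, of v] by simp
  then show ?thesis by (simp add: herm_sum_left herm_scale_left)
qed

text \<open>With the basis vectors as columns of a unitary matrix E, B is the conjugate by E of a
  diagonal matrix; determinant and trace do not see the conjugation.\<close>

lemma onb_diag:
  assumes "onb e" "\<And>k. B *v e k = l k *s e k"
  shows "det (mat t - B) = (\<Prod>k\<in>UNIV. t - l k)" "trace B = (\<Sum>k\<in>UNIV. l k)"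
proof -
  define E :: "complex^'a^'a" where "E = (\<chi> i k. e k $ i)"
  define D :: "complex^'a^'a" where "D = (\<chi> i k. if i = k then l k else 0)"
  note E = onb_matrix[OF assms(1), folded E_def]
  have BE: "B ** E = E ** D"
  proof -
    have "(B ** E) $ i $ k = (E ** D) $ i $ k" for i k
    proof -
      have "(B ** E) $ i $ k = (B *v e k) $ i"
        by (simp add: matrix_matrix_mult_def matrix_vector_mult_def E_def)
      also have "\<dots> = (E ** D) $ i $ k"
        by (simp add: assms(2) matrix_matrix_mult_def E_def D_def mult.commute if_distrib[of "\<lambda>x. _ * x"] cong: if_cong)
      finally show ?thesis .
    qed
    then show ?thesis by (simp add: vec_eq_iff)
  qed
  have B: "B = E ** (D ** adjoint_matrix E)"
    using arg_cong[OF BE, of "\<lambda>X. X ** adjoint_matrix E"]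
    by (simp add: matrix_mul_assoc[symmetric] E)
  have tE: "mat t - B = E ** ((mat t - D) ** adjoint_matrix E)"
  proof -
    have "E ** (mat t ** adjoint_matrix E) = mat t"
      by (simp add: mat_mult_left mult_mscale E) (simp add: mscale_def mat_def vec_eq_iff)
    then show ?thesis
      by (simp add: B matrix_diff_ldistrib matrix_diff_rdistrib matrix_mul_assoc)
  qed
  have "det (mat t - B) = det (mat t - D) * (det E * det (adjoint_matrix E))"
    by (simp add: tE det_mul)
  also have "det E * det (adjoint_matrix E) = 1"
    using E(2) by (metis det_mul det_I)
  also have "det (mat t - D) = (\<Prod>k\<in>UNIV. t - l k)"
    by (subst det_diagonal) (simp_all add: D_def mat_def)
  finally show "det (mat t - B) = (\<Prod>k\<in>UNIV. t - l k)" by simp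
  have "trace B = trace (D ** (adjoint_matrix E ** E))"
    unfolding B by (subst trace_mul_sym) (simp add: matrix_mul_assoc)
  then show "trace B = (\<Sum>k\<in>UNIV. l k)"
    by (simp add: E trace_def D_def)
qed

text \<open>There are fewer conditions than dimensions: otherwise the linear map of all pairings
  would be injective, hence surjective, although its coordinate \<open>i0\<close> is always
  0.\<close>

lemma nonzero_orthogonal_vector:
  fixes e :: "'n::finite \<Rightarrow> complex^'n"
  assumes "i0 \<notin> I"
  shows "\<exists>v. v \<noteq> 0 \<and> (\<forall>i\<in>I. herm (e i) v = 0)"
proof (rule ccontr)
  assume no: "\<not> ?thesis"
  define f :: "complex^'n \<Rightarrow> complex^'n" where
    "f v = (\<chi> i. if i \<in> I then herm (e i) v else 0)" for v
  have lin: "linear f"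
    by (rule linearI) (simp_all add: f_def vec_eq_iff herm_add_right herm_scale_right scaleR_eq_scale
        scaleR_conv_of_real)
  have "inj f"
    unfolding linear_injective_0[OF lin]
  proof (intro allI impI)
    fix v assume "f v = 0"
    then have fz: "f v $ i = 0" for i by simp
    have "herm (e i) v = 0" if "i \<in> I" for i
      using fz[of i] that by (simp add: f_def)
    then show "v = 0" using no by blast
  qed
  then have "surj f" using linear_injective_imp_surjective[OF lin] by simp
  then obtain v where "f v = axis i0 1" by (metis surjD)
  then have "f v $ i0 = 1" by simp
  then show False using assms by (simp add: f_def)
qed

text \<open>A unit vector v maximizing the Rayleigh quotient on W makes \<open>D = l - B\<close>
  positive semidefinite on W with \<open>v \<bullet> D v = 0\<close>; such a v lies in the kernel of
  D.\<close>

lemma rayleigh_eigenvector: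
  fixes B :: "complex^'n^'n::finite"
  assumes herm: "adjoint_matrix B = B"
    and sub: "subspace W" and inv: "\<And>v. v \<in> W \<Longrightarrow> B *v v \<in> W" and nz: "v0 \<in> W" "v0 \<noteq> 0"
  shows "\<exists>v\<in>W. norm v = 1 \<and> (\<exists>l::real. B *v v = complex_of_real l *s v)"
proof -
  define S where "S = W \<inter> sphere 0 1"
  have "compact S"
    unfolding S_def by (intro closed_Int_compact closed_subspace sub) simp
  moreover have "sgn v0 \<in> S"
    using nz sub by (auto simp: S_def sgn_div_norm subspace_def)
  moreover have cont: "continuous_on S (\<lambda>v. v \<bullet> (B *v v))"
    by (intro continuous_intros linear_continuous_on linear_linear[THEN iffD2] ) 
       (simp add: linear_linear linear_iff matrix_vector_right_distrib scaleR_eq_scale mult_vec_scale)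
  ultimately obtain v where v: "v \<in> S" "\<And>u. u \<in> S \<Longrightarrow> u \<bullet> (B *v u) \<le> v \<bullet> (B *v v)"
    using continuous_attains_sup[of S "\<lambda>v. v \<bullet> (B *v v)"] by blast
  define l where "l = v \<bullet> (B *v v)"
  define D where "D u = l *\<^sub>R u - B *v u" for u
  have D_lin: "D (u + w) = D u + D w" "D (r *\<^sub>R u) = r *\<^sub>R D u" for u w r
    by (simp_all add: D_def matrix_vector_right_distrib scaleR_eq_scale mult_vec_scale algebra_simps
        vector_ssub_ldistrib)
  have D_sym: "u \<bullet> D w = D u \<bullet> w" for u w
  proof -
    have "u \<bullet> (B *v w) = (B *v u) \<bullet> w"
      by (simp add: Re_herm[symmetric] herm_mult_left herm)
    then show ?thesis by (simp add: D_def inner_diff_right inner_diff_left)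
  qed
  have norm1: "norm v = 1" "v \<in> W" using v by (auto simp: S_def)
  have vD: "v \<bullet> D v = 0"
    using norm1 by (simp add: D_def inner_diff_right l_def dot_square_norm)
  have DW: "D u \<in> W" if "u \<in> W" for u
    using that sub inv by (simp add: D_def subspace_diff subspace_scale)
  have nonneg: "u \<bullet> D u \<ge> 0" if "u \<in> W" for u
  proof (cases "u = 0")
    case False
    then have "sgn u \<in> S" using that sub by (auto simp: S_def sgn_div_norm subspace_def)
    then have "sgn u \<bullet> (B *v sgn u) \<le> l" using v by (simp add: l_def)
    then have "sgn u \<bullet> D (sgn u) \<ge> 0"
      using False by (simp add: D_def inner_diff_right dot_square_norm norm_sgn)
    then have "(inverse (norm u))\<^sup>2 * (u \<bullet> D u) \<ge> 0"
      by (simp add: sgn_div_norm D_lin power2_eq_square)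
    then show ?thesis using False by (simp add: zero_le_mult_iff)
  qed simp
  have "D v = 0"
  proof (rule ccontr)
    assume ne: "D v \<noteq> 0"
    define a where "a = D v \<bullet> D v"
    define b where "b = D v \<bullet> D (D v)"
    have a: "a > 0" using ne by (simp add: a_def)
    \<comment> \<open>This is the form of D at \<open>v - s D v\<close>. For small s > 0 the linear
      term would dominate and make it negative.\<close>
    have quad: "- 2 * s * a + s\<^sup>2 * b \<ge> 0" for s :: real
    proof -
      have "(v + (- s) *\<^sub>R D v) \<bullet> D (v + (- s) *\<^sub>R D v) \<ge> 0"
        by (intro nonneg subspace_add[OF sub] subspace_scale[OF sub] norm1 DW)
      then show ?thesis
        unfolding D_lin inner_add_left inner_add_right inner_scaleR_left inner_scaleR_right
        using D_sym[of v "D v"] by (simp add: vD a_def b_def power2_eq_square algebra_simps)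
    qed
    have "b \<ge> 0" unfolding b_def by (rule nonneg) (simp add: DW norm1)
    \<comment> \<open>Small enough for \<open>s b < 2 a\<close>; the summand 1 covers the case
      \<open>b = 0\<close>.\<close>
    define s where "s = a / (b + 1)"
    have s: "s > 0" using a \<open>b \<ge> 0\<close> by (simp add: s_def)
    have "s * b < a" 
      using a \<open>b \<ge> 0\<close> by (simp add: s_def field_simps)
    then have "s * (s * b) < s * (2 * a)" using s a by (intro mult_strict_left_mono) auto
    with quad[of s] show False by (simp add: power2_eq_square algebra_simps)
  qed
  then have "B *v v = complex_of_real l *s v" by (simp add: D_def scaleR_eq_scale)
  with norm1 show ?thesis by blast
qed

text \<open>Induction over the index set: the orthogonal complement W of the eigenvectors found so
  far is invariant because B is Hermitian, and it is nonzero as long as an index is left.\<close>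

theorem hermitian_spectral:
  fixes B :: "complex^'n^'n::finite"
  assumes herm: "adjoint_matrix B = B"
  obtains e and l :: "'n \<Rightarrow> real" where "onb e" "\<And>k. B *v e k = complex_of_real (l k) *s e k"
proof -
  have "\<exists>e l. (\<forall>i\<in>I. \<forall>j\<in>I. herm (e i) (e j) = (if i = j then 1 else 0)) \<and>
      (\<forall>k\<in>I. B *v e k = complex_of_real (l k) *s e k)" for I :: "'n set"
  proof (induction I rule: infinite_finite_induct)
    case (insert i0 I)
    then obtain e l where e: "\<And>i j. i \<in> I \<Longrightarrow> j \<in> I \<Longrightarrow> herm (e i) (e j) = (if i = j then 1 else 0)"
      "\<And>k. k \<in> I \<Longrightarrow> B *v e k = complex_of_real (l k) *s e k" by blast
    define W where "W = {v. \<forall>i\<in>I. herm (e i) v = 0}"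
    have "subspace W"
      by (auto simp: subspace_def W_def herm_add_right scaleR_eq_scale herm_scale_right)
    moreover have "B *v v \<in> W" if "v \<in> W" for v
      using that by (auto simp: W_def herm_mult_right herm e herm_scale_left)
    moreover obtain v0 where "v0 \<in> W" "v0 \<noteq> 0"
      using nonzero_orthogonal_vector[OF \<open>i0 \<notin> I\<close>, of e] by (auto simp: W_def)
    ultimately obtain v r where v: "v \<in> W" "norm v = 1" "B *v v = complex_of_real r *s v"
      using rayleigh_eigenvector[OF herm] by blast
    have o: "herm (e i) v = 0" "herm v (e i) = 0" if "i \<in> I" for i
      using v(1) that cnj_herm[of "e i" v] by (auto simp: W_def)
    have ne: "i \<noteq> i0" if "i \<in> I" for i using that insert.hyps by auto
    have "(\<forall>i\<in>insert i0 I. \<forall>j\<in>insert i0 I.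
        herm ((e(i0 := v)) i) ((e(i0 := v)) j) = (if i = j then 1 else 0)) \<and>
      (\<forall>k\<in>insert i0 I. B *v (e(i0 := v)) k = complex_of_real ((l(i0 := r)) k) *s (e(i0 := v)) k)"
      using e v o ne insert.hyps by (auto simp: herm_self)
    then show ?case by blast
  qed simp_all
  from this[of UNIV] show ?thesis using that unfolding onb_def by auto
qed

section \<open>Characteristic polynomials\<close>

text \<open>Linearity in row j, once the row is written as a combination of unit rows; the
  determinants with a unit row are the entries of \<open>Cof R\<close> by definition.\<close>

lemma det_row_expand:
  fixes R :: "'r::comm_ring_1^'n^'n::finite"
  shows "det (\<chi> k l. if k = j then a $ l else R $ k $ l) = (\<Sum>i\<in>UNIV. a $ i * Cof R $ i $ j)"
proof -
  have "det (\<chi> k. if k = j then \<Sum>i\<in>UNIV. a $ i *s axis i 1 else R $ k) =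
      (\<Sum>i\<in>UNIV. det (\<chi> k. if k = j then a $ i *s axis i 1 else R $ k))"
    by (rule det_linear_row_sum) simp
  also have "\<dots> = (\<Sum>i\<in>UNIV. a $ i * det (\<chi> k. if k = j then axis i 1 else R $ k))"
    by (simp add: det_row_mul)
  also have "\<dots> = (\<Sum>i\<in>UNIV. a $ i * Cof R $ i $ j)"
  proof (rule sum.cong[OF refl])
    fix i
    have "(\<chi> k. if k = j then axis i 1 else R $ k) =
        (\<chi> k l. if k = j then (if l = i then 1 else 0) else R $ k $ l)"
      by (auto simp: vec_eq_iff axis_def)
    then show "a $ i * det (\<chi> k. if k = j then axis i 1 else R $ k) = a $ i * Cof R $ i $ j"
      by (simp add: Cof_def)
  qed
  finally have *: "det (\<chi> k. if k = j then \<Sum>i\<in>UNIV. a $ i *s axis i 1 else R $ k) =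
    (\<Sum>i\<in>UNIV. a $ i * Cof R $ i $ j)" .
  have "(\<chi> k. if k = j then \<Sum>i\<in>UNIV. a $ i *s axis i 1 else R $ k) =
      (\<chi> k l. if k = j then a $ l else R $ k $ l)"
    by (auto simp: vec_eq_iff axis_def if_distrib[of "\<lambda>x. _ * x"] cong: if_cong)
  with * show ?thesis by simp
qed

text \<open>Off the diagonal the expansion yields a determinant with two equal rows.\<close>

lemma mult_Cof: "R ** Cof R = mat (det (R::'r::comm_ring_1^'n^'n::finite))"
proof -
  have "(R ** Cof R) $ k $ j = (if k = j then det R else 0)" for k j
  proof -
    have "(R ** Cof R) $ k $ j = det (\<chi> i l. if i = j then R $ k $ l else R $ i $ l)"
      by (simp add: matrix_matrix_mult_def det_row_expand)
    also have "\<dots> = (if k = j then det R else 0)"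
    proof (cases "k = j")
      case True
      then have "(\<chi> i l. if i = j then R $ k $ l else R $ i $ l) = R"
        by (auto simp: vec_eq_iff)
      then show ?thesis using True by simp
    next
      case False
      then show ?thesis
        by (simp add: det_identical_rows[OF False] row_def vec_eq_iff)
    qed
    finally show ?thesis .
  qed
  then show ?thesis by (simp add: vec_eq_iff mat_def)
qed

text \<open>\<open>mult_Cof\<close> provides a right inverse of R, and for square matrices over a
  field a right inverse is a left inverse.\<close>

lemma Cof_mult:
  fixes R :: "complex^'n^'n::finite"
  assumes "det R \<noteq> 0"
  shows "Cof R ** R = mat (det R)"
proof -
  have "R ** mscale (1 / det R) (Cof R) = mat 1"
    unfolding mult_mscale mult_Cof by (simp add: mscale_def mat_def vec_eq_iff assms)
  then have "mscale (1 / det R) (Cof R) ** R = mat 1"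
    by (simp add: matrix_left_right_inverse)
  then show ?thesis
    unfolding mscale_mult using assms by (simp add: mscale_def mat_def vec_eq_iff field_simps)
qed

lemma Cof_eigenvector:
  fixes R :: "complex^'n^'n::finite"
  assumes "det R \<noteq> 0" "R *v e = l *s e" "l \<noteq> 0"
  shows "Cof R *v e = (det R / l) *s e"
proof -
  have "l *s (Cof R *v e) = (Cof R ** R) *v e"
    by (simp add: matrix_vector_mul_assoc[symmetric] assms(2) mult_vec_scale)
  also have "\<dots> = det R *s e" using Cof_mult[OF assms(1)] by simp
  finally show ?thesis using assms(3) by (simp add: vec_eq_iff field_simps)
qed

section \<open>Polynomial identities from values, and the embedding of real into complex
  polynomials\<close>

lemma poly_eq_infinite:
  fixes p q :: "'r::idom poly"
  assumes "infinite S" "\<And>t. t \<in> S \<Longrightarrow> poly p t = poly q t"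
  shows "p = q"
proof (rule ccontr)
  assume "p \<noteq> q"
  then have "finite {t. poly (p - q) t = 0}" by (intro poly_roots_finite) simp
  moreover have "S \<subseteq> {t. poly (p - q) t = 0}" using assms(2) by auto
  ultimately show False using assms(1) finite_subset by blast
qed

text \<open>Identities in t then have to be checked only off the spectrum, where
  \<open>t - B\<close> is invertible.\<close>

lemma poly_eq_cofinite:
  fixes p q :: "'r::field_char_0 poly"
  assumes "finite F" "\<And>t. t \<notin> F \<Longrightarrow> poly p t = poly q t"
  shows "p = q"
proof (rule poly_eq_infinite)
  show "infinite (- F)"
    using assms(1) infinite_UNIV_char_0[where 'a='r] by (metis Compl_partition finite_UnI)
qed (use assms(2) in auto)

abbreviation rc :: "real poly \<Rightarrow> complex poly" where "rc \<equiv> map_poly complex_of_real"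

lemma rc_add: "rc (p + q) = rc p + rc q"
  by (rule poly_eqI) (simp add: coeff_map_poly)

lemma rc_mult: "rc (p * q) = rc p * rc q"
  by (rule poly_eqI) (simp add: coeff_map_poly coeff_mult)

lemma rc_sum: "rc (\<Sum>i\<in>I. f i) = (\<Sum>i\<in>I. rc (f i))"
  by (induction I rule: infinite_finite_induct) (simp_all add: rc_add)

lemma rc_prod: "rc (\<Prod>i\<in>I. f i) = (\<Prod>i\<in>I. rc (f i))"
  by (induction I rule: infinite_finite_induct) (simp_all add: rc_mult map_poly_1)

lemma rc_pCons: "rc (pCons a p) = pCons (complex_of_real a) (rc p)"
  by (rule map_poly_pCons) simp

lemma rc_smult: "rc (smult a p) = smult (complex_of_real a) (rc p)"
  by (rule poly_eqI) (simp add: coeff_map_poly)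

lemma map_poly_Re_rc [simp]: "map_poly Re (rc p) = p"
  by (rule poly_eqI) (simp add: coeff_map_poly)

lemma poly_det: "poly (det P) t = det (\<chi> i j. poly (P $ i $ j) t)"
  by (simp add: det_def poly_sum poly_prod)

lemma poly_char_matrix: "(\<chi> i j. poly (char_matrix B $ i $ j) t) = mat t - B"
  by (auto simp: char_matrix_def mat_def vec_eq_iff)

lemma poly_det_char_matrix: "poly (det (char_matrix B)) t = det (mat t - B)"
  by (simp only: poly_det poly_char_matrix)

lemma poly_Cof: "poly (Cof P $ i $ j) t = Cof (\<chi> i j. poly (P $ i $ j) t) $ i $ j"
  unfolding Cof_def by (simp add: poly_det) (rule arg_cong[where f=det], auto simp: vec_eq_iff)

text \<open>The polynomial p_C before real parts are taken, with \<open>trace B\<close> in the place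
  of \<open>h_1\<close>; \<open>elem_sym_1_eigenvalues\<close> identifies the two.\<close>

definition C_complex :: "complex^'n^'n \<Rightarrow> complex^'n \<Rightarrow> real \<Rightarrow> complex poly" where
  "C_complex B \<tau> v = det (char_matrix B) * [:complex_of_real v, trace B, 1:]
     + (\<Sum>i\<in>UNIV. \<Sum>j\<in>UNIV. [:cnj (\<tau> $ i):] * Cof (char_matrix B) $ i $ j * [:\<tau> $ j:])"

lemma poly_C_complex:
  "poly (C_complex B \<tau> v) t =
     det (mat t - B) * (t\<^sup>2 + trace B * t + complex_of_real v) + herm \<tau> (Cof (mat t - B) *v \<tau>)"
  by (simp add: C_complex_def poly_det_char_matrix poly_sum poly_Cof poly_char_matrix herm_def
      matrix_vector_mult_def sum_distrib_left power2_eq_square algebra_simps)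

definition root_poly :: "('n::finite \<Rightarrow> real) \<Rightarrow> real poly" where
  "root_poly l = (\<Prod>k\<in>UNIV. [:- l k, 1:])"

text \<open>The form that p_C takes in an eigenbasis, where \<open>c k\<close> is the squared
  modulus of the k-th component of T. It is left arbitrary here, so that the later estimates are
  about real polynomials alone.\<close>

definition C_real :: "('n::finite \<Rightarrow> real) \<Rightarrow> ('n \<Rightarrow> real) \<Rightarrow> real \<Rightarrow> real poly" where
  "C_real l c v = root_poly l * [:v, \<Sum>k\<in>UNIV. l k, 1:]
     + (\<Sum>k\<in>UNIV. smult (c k) (\<Prod>j\<in>UNIV-{k}. [:- l j, 1:]))"

lemma rc_root_poly: "rc (root_poly l) = (\<Prod>k\<in>UNIV. [:- complex_of_real (l k), 1:])"
  by (simp add: root_poly_def rc_prod rc_pCons)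

lemma poly_root_poly: "poly (root_poly l) t = (\<Prod>k\<in>UNIV. t - l k)"
  by (simp add: root_poly_def poly_prod)

lemma char_poly_onb:
  assumes "onb e" "\<And>k. B *v e k = complex_of_real (l k) *s e k"
  shows "det (char_matrix B) = rc (root_poly l)"
proof (rule poly_eq_cofinite[OF finite.emptyI])
  fix t
  show "poly (det (char_matrix B)) t = poly (rc (root_poly l)) t"
    by (simp add: poly_det_char_matrix onb_diag(1)[OF assms] rc_root_poly poly_prod)
qed

text \<open>For t off the spectrum, \<open>e k\<close> is an eigenvector of the cofactor matrix with
  eigenvalue \<open>prod_{j <> k} (t - l j)\<close>; the finitely many other t do not matter for a
  polynomial identity.\<close>

lemma C_complex_onb:
  assumes "onb e" "\<And>k. B *v e k = complex_of_real (l k) *s e k"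
  shows "C_complex B \<tau> v = rc (C_real l (\<lambda>k. (cmod (herm (e k) \<tau>))\<^sup>2) v)"
proof (rule poly_eq_cofinite)
  show "finite (range (\<lambda>k. complex_of_real (l k)))" by simp
  fix t :: complex assume t: "t \<notin> range (\<lambda>k. complex_of_real (l k))"
  let ?N = "mat t - B"
  have det: "det ?N = (\<Prod>k\<in>UNIV. t - complex_of_real (l k))" by (rule onb_diag(1)[OF assms])
  have nz: "det ?N \<noteq> 0" "t - complex_of_real (l k) \<noteq> 0" for k
    unfolding det using t by auto
  have eig: "?N *v e k = (t - complex_of_real (l k)) *s e k" for k
    by (simp add: matrix_vector_mult_diff_rdistrib assms(2) vector_sub_rdistrib)
  have quot: "det ?N / (t - complex_of_real (l k)) = (\<Prod>j\<in>UNIV-{k}. t - complex_of_real (l j))" for k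
    unfolding det using nz(2)[of k] by (subst prod.remove[of UNIV k]) auto
  have "Cof ?N *v \<tau> = Cof ?N *v (\<Sum>k\<in>UNIV. herm (e k) \<tau> *s e k)"
    using onb_expand[OF assms(1), of \<tau>] by simp
  also have "\<dots> = (\<Sum>k\<in>UNIV. (herm (e k) \<tau> * (\<Prod>j\<in>UNIV-{k}. t - complex_of_real (l j))) *s e k)"
    by (simp add: mult_vec_sum mult_vec_scale Cof_eigenvector[OF nz(1) eig nz(2)] quot)
  finally have "herm \<tau> (Cof ?N *v \<tau>) =
      (\<Sum>k\<in>UNIV. complex_of_real ((cmod (herm (e k) \<tau>))\<^sup>2) * (\<Prod>j\<in>UNIV-{k}. t - complex_of_real (l j)))"
    by (simp add: herm_sum_right herm_scale_right complex_norm_square cnj_herm mult_ac del: of_real_power)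
  then show "poly (C_complex B \<tau> v) t = poly (rc (C_real l (\<lambda>k. (cmod (herm (e k) \<tau>))\<^sup>2) v)) t"
    by (simp add: poly_C_complex C_real_def rc_add rc_mult rc_sum rc_smult rc_root_poly rc_prod
        rc_pCons poly_sum poly_prod det onb_diag(2)[OF assms] power2_eq_square algebra_simps map_poly_1)
qed

text \<open>Vieta's formula: the product is expanded over the sets X of factors that contribute
  their constant term, and the degree of a summand singles out \<open>card X = k\<close>.\<close>

lemma coeff_prod_linear:
  fixes l :: "'n::finite \<Rightarrow> 'r::comm_ring_1"
  assumes "k \<le> CARD('n)"
  shows "coeff (\<Prod>i\<in>UNIV. [:- l i, 1:]) (CARD('n) - k) = (-1) ^ k * elem_sym k l"
proof -
  have c: "coeff ((\<Prod>i\<in>X. [:- l i:]) * monom 1 j) d =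
      (if d = j then (\<Prod>i\<in>X. - l i) else 0)" for X :: "'n set" and j d
  proof -
    have "(\<Prod>i\<in>X. [:- l i:]) = [:\<Prod>i\<in>X. - l i:]"
      by (induction X rule: infinite_finite_induct) (simp_all add: one_pCons)
    then show ?thesis by simp
  qed
  have "(\<Prod>i\<in>UNIV. [:- l i, 1:]) = (\<Prod>i\<in>UNIV. [:- l i:] + monom 1 1)"
    by (simp add: monom_altdef)
  also have "\<dots> = (\<Sum>X\<in>Pow UNIV. (\<Prod>i\<in>X. [:- l i:]) * monom 1 (CARD('n) - card X))"
    by (subst prod_add) (simp_all add: monom_power card_Diff_subset)
  finally have "coeff (\<Prod>i\<in>UNIV. [:- l i, 1:]) (CARD('n) - k) =
      (\<Sum>X\<in>Pow UNIV. if CARD('n) - k = CARD('n) - card X then (\<Prod>i\<in>X. - l i) else 0)"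
    by (simp add: coeff_sum c)
  also have "\<dots> = (\<Sum>X\<in>Pow UNIV. if card X = k then (\<Prod>i\<in>X. - l i) else 0)"
  proof (rule sum.cong[OF refl])
    fix X :: "'n set"
    have "card X \<le> CARD('n)" by (rule card_mono) auto
    then show "(if CARD('n) - k = CARD('n) - card X then (\<Prod>i\<in>X. - l i) else 0)
        = (if card X = k then (\<Prod>i\<in>X. - l i) else 0)"
      using assms by auto
  qed
  also have "\<dots> = (\<Sum>X | card X = k. \<Prod>i\<in>X. - l i)"
    by (subst sum.inter_filter[symmetric]) auto
  also have "\<dots> = (-1) ^ k * elem_sym k l"
    unfolding elem_sym_def sum_distrib_left
    by (rule sum.cong[OF refl]) (simp add: prod_uminus)
  finally show ?thesis .
qed

text \<open>The spectral theorem supplies a factorization, which justifies the choice made in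
  \<open>eigenvalues\<close>.\<close>

lemma eigenvalues_prod:
  assumes "adjoint_matrix B = B"
  shows "det (char_matrix B) = (\<Prod>i\<in>UNIV. [:- eigenvalues B i, 1:])"
proof -
  obtain e l where e: "onb e" "\<And>k. B *v e k = complex_of_real (l k) *s e k"
    using hermitian_spectral[OF assms] by blast
  have "det (char_matrix B) = (\<Prod>k\<in>UNIV. [:- complex_of_real (l k), 1:])"
    by (simp add: char_poly_onb[OF e] rc_root_poly)
  then show ?thesis unfolding eigenvalues_def
    by (rule someI[where P = "\<lambda>l. det (char_matrix B) = (\<Prod>i\<in>UNIV. [:- l i, 1:])"])
qed

lemma elem_sym_eigenvalues:
  fixes B :: "complex^'n^'n::finite"
  assumes "adjoint_matrix B = B" "k \<le> CARD('n)"
  shows "Re (elem_sym k (eigenvalues B)) =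
    (-1) ^ k * coeff (map_poly Re (det (char_matrix B))) (CARD('n) - k)"
proof -
  have "coeff (det (char_matrix B)) (CARD('n) - k) = (-1) ^ k * elem_sym k (eigenvalues B)"
    using assms by (simp add: eigenvalues_prod coeff_prod_linear)
  then have "elem_sym k (eigenvalues B) = (-1) ^ k * coeff (det (char_matrix B)) (CARD('n) - k)"
    by simp
  then show ?thesis by (cases "even k") (simp_all add: coeff_map_poly)
qed

lemma elem_sym_1_eigenvalues:
  assumes "adjoint_matrix B = B"
  shows "complex_of_real (Re (elem_sym 1 (eigenvalues B))) = trace B"
proof -
  obtain e l where e: "onb e" "\<And>k. B *v e k = complex_of_real (l k) *s e k"
    using hermitian_spectral[OF assms] by blast
  have "Re (elem_sym 1 (eigenvalues B)) = - coeff (root_poly l) (CARD('a) - 1)"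
    using elem_sym_eigenvalues[OF assms, of 1] by (simp add: char_poly_onb[OF e])
  also have "\<dots> = elem_sym 1 l"
    using coeff_prod_linear[of 1 l] by (simp add: root_poly_def)
  also have "\<dots> = (\<Sum>k\<in>UNIV. l k)"
  proof -
    have "{I::'a set. card I = 1} = (\<lambda>k. {k}) ` UNIV" by (auto simp: card_1_singleton_iff)
    then show ?thesis by (simp add: elem_sym_def sum.reindex)
  qed
  finally show ?thesis by (simp add: onb_diag(2)[OF e])
qed

section \<open>Consequences of the structure equations\<close>

lemma has_derivative_vec_componentwise:
  fixes f :: "'e::real_normed_vector \<Rightarrow> 'b::euclidean_space^'n"
  assumes "\<And>i. ((\<lambda>x. f x $ i) has_derivative (\<lambda>h. f' h $ i)) (at x within S)"
  shows "(f has_derivative f') (at x within S)"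
proof (subst has_derivative_componentwise_within, rule ballI)
  fix b :: "'b^'n" assume "b \<in> Basis"
  then obtain i u where b: "b = axis i u" by (auto simp: Basis_vec_def)
  show "((\<lambda>x. f x \<bullet> b) has_derivative (\<lambda>x. f' x \<bullet> b)) (at x within S)"
    unfolding b inner_axis by (intro has_derivative_inner_left assms)
qed

lemma has_derivative_entry:
  fixes A :: "'e::real_normed_vector \<Rightarrow> 'b::real_normed_vector^'n^'m"
  assumes "(A has_derivative A') F"
  shows "((\<lambda>u. A u $ i $ j) has_derivative (\<lambda>h. A' h $ i $ j)) F"
  by (intro bounded_linear.has_derivative[OF bounded_linear_vec_nth] assms)

lemma bounded_bilinear_matrix_mult:
  "bounded_bilinear ((**) :: complex^'n^'m \<Rightarrow> complex^'p^'n \<Rightarrow> complex^'p^'m)"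
  unfolding bilinear_conv_bounded_bilinear[symmetric] bilinear_def linear_iff
  by (auto simp: vec_eq_iff matrix_matrix_mult_def algebra_simps sum.distrib scaleR_sum_right)

lemma bounded_bilinear_matrix_vector_mult:
  "bounded_bilinear ((*v) :: complex^'n^'m \<Rightarrow> complex^'n \<Rightarrow> complex^'m)"
  unfolding bilinear_conv_bounded_bilinear[symmetric] bilinear_def linear_iff
  by (auto simp: vec_eq_iff matrix_vector_mult_def algebra_simps sum.distrib scaleR_sum_right)

lemma bounded_bilinear_herm: "bounded_bilinear herm"
  unfolding bilinear_conv_bounded_bilinear[symmetric] bilinear_def linear_iff
  by (auto simp: herm_linear scaleR_eq_scale scaleR_conv_of_real)

lemma bounded_linear_trace: "bounded_linear (trace :: complex^'n^'n \<Rightarrow> complex)"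
  by (rule linear_conv_bounded_linear[THEN iffD1])
    (auto simp: linear_iff trace_def sum.distrib scaleR_sum_right)

lemma trace_Cof_mult:
  "trace (Cof R ** X) = (\<Sum>j\<in>UNIV. det (\<chi> k l. if k = j then X $ k $ l else R $ k $ l))"
  for R :: "complex^'n^'n::finite"
proof -
  have "trace (Cof R ** X) = (\<Sum>i\<in>UNIV. \<Sum>j\<in>UNIV. X $ j $ i * Cof R $ i $ j)"
    by (simp add: trace_def matrix_matrix_mult_def mult.commute)
  also have "\<dots> = (\<Sum>j\<in>UNIV. \<Sum>i\<in>UNIV. X $ j $ i * Cof R $ i $ j)" by (rule sum.swap)
  also have "\<dots> = (\<Sum>j\<in>UNIV. det (\<chi> k l. if k = j then X $ j $ l else R $ k $ l))"
    by (simp add: det_row_expand)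
  also have "\<dots> = (\<Sum>j\<in>UNIV. det (\<chi> k l. if k = j then X $ k $ l else R $ k $ l))"
    by (intro sum.cong refl arg_cong[where f = det]) (auto simp: vec_eq_iff)
  finally show ?thesis .
qed

text \<open>Jacobi's formula. The product rule in the Leibniz sum replaces one row at a time by its
  derivative, and \<open>trace_Cof_mult\<close> collects the resulting determinants.\<close>

lemma has_derivative_det:
  fixes A :: "'e::real_normed_vector \<Rightarrow> complex^'n^'n::finite"
  assumes "(A has_derivative A') (at z within S)"
  shows "((\<lambda>u. det (A u)) has_derivative (\<lambda>h. trace (Cof (A z) ** A' h))) (at z within S)"
proof -
  have "((\<lambda>u. det (A u)) has_derivative
      (\<lambda>h. \<Sum>p | p permutes UNIV. of_int (sign p) *
        (\<Sum>i\<in>UNIV. A' h $ i $ p i * (\<Prod>j\<in>UNIV-{i}. A z $ j $ p j)))) (at z within S)"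
    unfolding det_def
    by (intro has_derivative_sum has_derivative_mult_right has_derivative_prod
        has_derivative_entry assms)
  also have "(\<lambda>h. \<Sum>p | p permutes UNIV. of_int (sign p) *
        (\<Sum>i\<in>UNIV. A' h $ i $ p i * (\<Prod>j\<in>UNIV-{i}. A z $ j $ p j))) =
      (\<lambda>h. trace (Cof (A z) ** A' h))"
  proof
    fix h
    have *: "(\<Prod>k\<in>UNIV. (if k = i then A' h $ k $ p k else A z $ k $ p k)) =
        A' h $ i $ p i * (\<Prod>j\<in>UNIV-{i}. A z $ j $ p j)" for i and p :: "'n \<Rightarrow> 'n"
      by (subst prod.remove[of UNIV i]) auto
    have "trace (Cof (A z) ** A' h) = (\<Sum>i\<in>UNIV. \<Sum>p | p permutes UNIV. of_int (sign p) *
        (A' h $ i $ p i * (\<Prod>j\<in>UNIV-{i}. A z $ j $ p j)))"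
      unfolding trace_Cof_mult det_def by (simp add: *)
    also have "\<dots> = (\<Sum>p | p permutes UNIV. \<Sum>i\<in>UNIV. of_int (sign p) *
        (A' h $ i $ p i * (\<Prod>j\<in>UNIV-{i}. A z $ j $ p j)))"
      by (rule sum.swap)
    finally show "(\<Sum>p | p permutes UNIV. of_int (sign p) *
        (\<Sum>i\<in>UNIV. A' h $ i $ p i * (\<Prod>j\<in>UNIV-{i}. A z $ j $ p j))) =
      trace (Cof (A z) ** A' h)" by (simp add: sum_distrib_left)
  qed
  finally show ?thesis .
qed

text \<open>Cramer's rule, so that differentiability can be read off from determinants entry by
  entry.\<close>

definition Inv :: "complex^'n^'n \<Rightarrow> complex^'n^'n::finite" where
  "Inv R = mscale (1 / det R) (Cof R)"

lemma mscale_mat: "mscale c (mat d) = mat (c * d)"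
  by (simp add: mscale_def mat_def vec_eq_iff)

lemma Inv_mult:
  assumes "det R \<noteq> 0"
  shows "R ** Inv R = mat 1" "Inv R ** R = mat 1"
  using assms by (simp_all add: Inv_def mult_mscale mscale_mult mult_Cof Cof_mult mscale_mat)

lemma Inv_mult_vec:
  assumes "det R \<noteq> 0"
  shows "R *v (Inv R *v v) = v" "Inv R *v (R *v v) = v"
  using assms by (simp_all add: matrix_vector_mul_assoc Inv_mult)

lemma differentiable_Inv:
  fixes A :: "'e::real_normed_vector \<Rightarrow> complex^'n^'n::finite"
  assumes "A differentiable (at z)" "det (A z) \<noteq> 0"
  shows "(\<lambda>u. Inv (A u)) differentiable (at z)"
proof -
  obtain A' where A': "(A has_derivative A') (at z)"
    using assms(1) by (auto simp: differentiable_def)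
  have row: "((\<lambda>u. (\<chi> k l. if k = j then (if l = i then 1 else 0) else A u $ k $ l)) has_derivative
      (\<lambda>h. (\<chi> k l. if k = j then 0 else A' h $ k $ l))) (at z)" for i j
  proof (intro has_derivative_vec_componentwise)
    fix k l
    show "((\<lambda>u. (\<chi> k l. if k = j then (if l = i then 1 else 0) else A u $ k $ l) $ k $ l)
      has_derivative (\<lambda>h. (\<chi> k l. if k = j then 0 else A' h $ k $ l) $ k $ l)) (at z)"
      by (cases "k = j") (auto intro!: has_derivative_entry A')
  qed
  have entry: "(\<lambda>u. Inv (A u) $ i $ j) differentiable (at z)" for i j
    unfolding Inv_def mscale_def Cof_def vec_lambda_beta
    using assms(2) has_derivative_det[OF A', THEN differentiableI]
      has_derivative_det[OF row[of j i], THEN differentiableI]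
    by (intro differentiable_mult differentiable_divide differentiable_const)
  then obtain D where D: "\<And>i j. ((\<lambda>u. Inv (A u) $ i $ j) has_derivative D i j) (at z)"
    unfolding differentiable_def by metis
  have "((\<lambda>u. Inv (A u)) has_derivative (\<lambda>h. \<chi> i j. D i j h)) (at z)"
    by (intro has_derivative_vec_componentwise) (simp add: D)
  then show ?thesis by (rule differentiableI)
qed

text \<open>Once the inverse is known to be differentiable, its derivative is found by
  differentiating \<open>A u ** Inv (A u) = mat 1\<close>, which holds near z because the
  determinant stays nonzero there.\<close>

lemma has_derivative_Inv:
  fixes A :: "'e::real_normed_vector \<Rightarrow> complex^'n^'n::finite"
  assumes A: "(A has_derivative A') (at z)" and nz: "det (A z) \<noteq> 0"
  shows "((\<lambda>u. Inv (A u)) has_derivative (\<lambda>h. - (Inv (A z) ** A' h ** Inv (A z)))) (at z)"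
proof -
  obtain W where W: "((\<lambda>u. Inv (A u)) has_derivative W) (at z)"
    using differentiable_Inv[OF differentiableI[OF A] nz] by (auto simp: differentiable_def)
  have D1: "((\<lambda>u. A u ** Inv (A u)) has_derivative (\<lambda>h. A z ** W h + A' h ** Inv (A z))) (at z)"
    by (rule bounded_bilinear.FDERIV[OF bounded_bilinear_matrix_mult A W])
  have D2: "((\<lambda>u. A u ** Inv (A u)) has_derivative (\<lambda>h. 0)) (at z)"
  proof (rule has_derivative_transform_eventually[of "\<lambda>u. mat 1"])
    have "isCont (\<lambda>u. det (A u)) z"
      using has_derivative_det[OF A] by (rule has_derivative_continuous)
    then have "\<forall>\<^sub>F u in at z. det (A u) \<noteq> 0"
      using nz by (simp add: isCont_def tendsto_imp_eventually_ne)
    then show "\<forall>\<^sub>F u in at z. mat 1 = A u ** Inv (A u)"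
      by eventually_elim (simp add: Inv_mult)
  qed (simp_all add: Inv_mult nz)
  have "A z ** W h + A' h ** Inv (A z) = 0" for h
    using fun_cong[OF has_derivative_unique[OF D1 D2]] .
  then have "Inv (A z) ** (A z ** W h + A' h ** Inv (A z)) = Inv (A z) ** 0" for h by simp
  then have "W h + Inv (A z) ** A' h ** Inv (A z) = 0" for h
    by (simp add: matrix_add_ldistrib matrix_mul_assoc Inv_mult nz)
  then have "W = (\<lambda>h. - (Inv (A z) ** A' h ** Inv (A z)))"
    by (simp add: fun_eq_iff eq_neg_iff_add_eq_0)
  with W show ?thesis by simp
qed

section \<open>The structure equations at one point\<close>

lemma matrix_mult_minus: "B ** (- C) = - (B ** C)" "(- B) ** C = - (B ** C)" "(- B) *v x = - (B *v x)"
    "B *v (- x) = - (B *v x)"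
  for B :: "complex^'n^'m" and C :: "complex^'p^'n"
  by (simp_all add: vec_eq_iff matrix_matrix_mult_def matrix_vector_mult_def sum_negf)

lemma trace_minus: "trace (- B) = - trace (B :: complex^'n^'n)"
  by (simp add: trace_def sum_negf)

lemma trace_mscale: "trace (mscale c B) = c * trace B"
  by (simp add: trace_def mscale_def sum_distrib_left)

lemma cnj_trace: "cnj (trace B) = trace (adjoint_matrix B)"
  by (simp add: trace_def adjoint_matrix_def)

lemma Cof_eq_Inv: "det R \<noteq> 0 \<Longrightarrow> Cof R = mscale (det R) (Inv R)"
  by (simp add: Inv_def mscale_def vec_eq_iff)

text \<open>Here and in the next two definitions the arguments \<open>\<phi>\<close> and
  \<open>\<omega>\<close> are the values of the forms on one vector, so that the same expressions
  serve on the bundle and for every pullback.\<close>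

definition structure_deriv_H where
  "structure_deriv_H H T \<phi> \<omega> = - (\<phi> ** H) + H ** \<phi> + outer T \<omega> + outer \<omega> T"

definition structure_deriv_T where
  "structure_deriv_T H T V \<phi> \<omega> = - (\<phi> *v T) + (H ** H + mscale (trace H) H + mat V) *v \<omega>"

definition structure_deriv_V where
  "structure_deriv_V H T \<omega> = trace H * (herm T \<omega> + herm \<omega> T) + (herm T (H *v \<omega>) + herm \<omega> (H *v T))"

text \<open>The equations at a point z of a normed space that is mapped into the bundle. The space
  is a chart domain when derivatives on M are computed, and the real line for a path inside a
  fiber.\<close>

locale structure_eqs =
  fixes H :: "'e::real_normed_vector \<Rightarrow> complex^'n^'n::finite" and T :: "'e \<Rightarrow> complex^'n"
    and V :: "'e \<Rightarrow> complex" and \<phi> :: "'e \<Rightarrow> complex^'n^'n" and \<omega> :: "'e \<Rightarrow> complex^'n" and z :: 'e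
  assumes dH: "(H has_derivative (\<lambda>h. structure_deriv_H (H z) (T z) (\<phi> h) (\<omega> h))) (at z)"
    and dT: "(T has_derivative (\<lambda>h. structure_deriv_T (H z) (T z) (V z) (\<phi> h) (\<omega> h))) (at z)"
    and dV: "(V has_derivative (\<lambda>h. structure_deriv_V (H z) (T z) (\<omega> h))) (at z)"
    and H_adjoint: "adjoint_matrix (H z) = H z" and V_real: "cnj (V z) = V z"
    and \<phi>_skew: "\<And>h. adjoint_matrix (\<phi> h) = - \<phi> h"
begin

context
  fixes t :: complex
  assumes nz: "det (mat t - H z) \<noteq> 0" and nz': "det (mat (cnj t) - H z) \<noteq> 0"
begin

text \<open>For non-real t the adjoint of N is N' and not N. The vectors w and y satisfy
  \<open>N w = T = N' y\<close>, which removes the inverses from all pairings with T.\<close>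

definition "N = mat t - H z"
definition "N' = mat (cnj t) - H z"
definition "w = Inv N *v T z"
definition "y = Inv N' *v T z"

lemma detN: "det N \<noteq> 0" and detN': "det N' \<noteq> 0"
  using nz nz' by (simp_all add: N_def N'_def)

lemma N_vec: "N *v x = t *s x - H z *v x"
  by (simp add: N_def matrix_vector_mult_diff_rdistrib)

lemma herm_N': "herm (N' *v x) x' = herm x (N *v x')"
  by (simp add: herm_mult_left N_def N'_def adjoint_matrix_diff H_adjoint)

lemma herm_H: "herm (H z *v x) x' = herm x (H z *v x')"
  by (simp add: herm_mult_left H_adjoint)

lemma herm_\<phi>: "herm (\<phi> h *v x) x' = - herm x (\<phi> h *v x')"
  by (simp add: herm_mult_left \<phi>_skew matrix_mult_minus herm_minus_right)

lemma T_eq: "T z = N *v w" "T z = N' *v y"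
  by (simp_all add: w_def y_def Inv_mult_vec detN detN')

lemma herm_T: "herm (T z) x = herm y (N *v x)"
  using herm_N'[of y x] T_eq(2) by simp

lemma herm_T_Inv: "herm (T z) (Inv N *v x) = herm y x"
  by (simp add: herm_T Inv_mult_vec detN)

lemma H_Inv: "H z ** Inv N = Inv N ** H z"
proof -
  have c: "N ** H z = H z ** N"
    by (simp add: N_def matrix_diff_ldistrib matrix_diff_rdistrib mat_mult_left mat_mult_right)
  have "H z ** Inv N = (Inv N ** N) ** H z ** Inv N" by (simp add: Inv_mult detN)
  also have "\<dots> = Inv N ** (N ** H z) ** Inv N" by (simp only: matrix_mul_assoc)
  also have "\<dots> = Inv N ** H z ** (N ** Inv N)" unfolding c by (simp only: matrix_mul_assoc)
  finally show ?thesis by (simp add: Inv_mult detN)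
qed

lemma trace_dH: "trace (structure_deriv_H (H z) (T z) (\<phi> h) (\<omega> h)) = herm (\<omega> h) (T z) + herm (T z) (\<omega> h)"
  by (simp add: structure_deriv_H_def trace_add trace_minus trace_outer trace_sub trace_mul_sym[of "\<phi> h"])

text \<open>The connection terms form a commutator with H; it drops out of the trace because the
  inverse of N commutes with H.\<close>

lemma trace_Inv_dH:
  "trace (Inv N ** structure_deriv_H (H z) (T z) (\<phi> h) (\<omega> h)) = herm (\<omega> h) w + herm y (\<omega> h)"
proof -
  have "trace (Inv N ** (\<phi> h ** H z)) = trace (H z ** (Inv N ** \<phi> h))"
    by (metis matrix_mul_assoc trace_mul_sym)
  also have "\<dots> = trace (Inv N ** (H z ** \<phi> h))"
    by (simp add: matrix_mul_assoc H_Inv)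
  finally show ?thesis
    by (simp add: structure_deriv_H_def matrix_add_ldistrib trace_add trace_minus trace_outer matrix_mult_minus matrix_diff_ldistrib trace_sub
        mult_outer herm_T_Inv) (simp add: w_def)
qed

lemma dN: "((\<lambda>u. mat t - H u) has_derivative
    (\<lambda>h. - structure_deriv_H (H z) (T z) (\<phi> h) (\<omega> h))) (at z)"
  using has_derivative_diff[OF has_derivative_const dH] by simp

text \<open>Jacobi's formula combined with \<open>trace_Inv_dH\<close>. For real t one has
  \<open>y = w\<close>, and the bracket is twice a real part.\<close>

lemma has_derivative_det_structure:
  "((\<lambda>u. det (mat t - H u)) has_derivative
      (\<lambda>h. - det (mat t - H z) * (herm (\<omega> h) w + herm y (\<omega> h)))) (at z)"
  using has_derivative_det[OF dN]
  by (simp add: N_def[symmetric] Cof_eq_Inv[OF detN] mscale_mult trace_mscale matrix_mult_minus trace_minus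
      trace_Inv_dH)

text \<open>Off the spectrum p_C(t) is the product of \<open>det N\<close> and \<open>?Q\<close>.
  Their derivatives are \<open>- det N\<close> times \<open>?\<sigma>\<close> and \<open>?Q\<close>
  times \<open>?\<sigma>\<close>, and so the product rule gives 0.\<close>

lemma has_derivative_C_structure:
  "((\<lambda>u. det (mat t - H u) * (t\<^sup>2 + trace (H u) * t + V u) + herm (T u) (Cof (mat t - H u) *v T u))
      has_derivative (\<lambda>h. 0)) (at z)"
proof -
  let ?Q = "\<lambda>u. t\<^sup>2 + trace (H u) * t + V u + herm (T u) (Inv (mat t - H u) *v T u)"
  let ?dH = "\<lambda>h. structure_deriv_H (H z) (T z) (\<phi> h) (\<omega> h)"
  let ?dT = "\<lambda>h. structure_deriv_T (H z) (T z) (V z) (\<phi> h) (\<omega> h)"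
  let ?dV = "\<lambda>h. structure_deriv_V (H z) (T z) (\<omega> h)"
  let ?\<sigma> = "\<lambda>h. herm (\<omega> h) w + herm y (\<omega> h)"
  have dInv: "((\<lambda>u. Inv (mat t - H u)) has_derivative (\<lambda>h. - (Inv N ** (- ?dH h) ** Inv N))) (at z)"
    using has_derivative_Inv[OF dN nz] by (simp add: N_def)
  have "(?Q has_derivative (\<lambda>h. 0 + trace (?dH h) * t + ?dV h +
      (herm (T z) (Inv (mat t - H z) *v ?dT h + (- (Inv N ** (- ?dH h) ** Inv N)) *v T z)
        + herm (?dT h) (Inv (mat t - H z) *v T z)))) (at z)"
    by (intro has_derivative_add has_derivative_const has_derivative_mult_left dV
        bounded_linear.has_derivative[OF bounded_linear_trace] dH
        bounded_bilinear.FDERIV[OF bounded_bilinear_herm] dT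
        bounded_bilinear.FDERIV[OF bounded_bilinear_matrix_vector_mult] dInv)
  moreover have "0 + trace (?dH h) * t + ?dV h +
      (herm (T z) (Inv (mat t - H z) *v ?dT h + (- (Inv N ** (- ?dH h) ** Inv N)) *v T z)
        + herm (?dT h) (Inv (mat t - H z) *v T z)) = ?Q z * ?\<sigma> h" (is "?L = _") for h
  proof -
    define \<tau> where "\<tau> = herm y (T z)"
    have \<tau>: "herm (T z) w = \<tau>" by (simp add: w_def herm_T_Inv \<tau>_def)
    \<comment> \<open>Moving N onto y or w reduces all pairings to a few scalars, after which the
      claim is an identity in a commutative ring. The b-terms come from the connection form and
      cancel.\<close>
    define p0 p1 p2 where "p0 = herm y (\<omega> h)" and "p1 = herm y (H z *v \<omega> h)"
      and "p2 = herm y (H z *v (H z *v \<omega> h))"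
    define q0 q1 q2 where "q0 = herm (\<omega> h) w" and "q1 = herm (\<omega> h) (H z *v w)"
      and "q2 = herm (\<omega> h) (H z *v (H z *v w))"
    define b1 b2 b3 where "b1 = herm y (\<phi> h *v w)" and "b2 = herm y (\<phi> h *v (H z *v w))"
      and "b3 = herm y (H z *v (\<phi> h *v w))"
    note defs = p0_def p1_def p2_def q0_def q1_def q2_def b1_def b2_def b3_def
    have s1: "herm (T z) (\<omega> h) = t * p0 - p1" and a1: "herm (T z) (H z *v \<omega> h) = t * p1 - p2"
      by (simp_all add: herm_T N_vec herm_diff_right herm_scale_right defs)
    have s2: "herm (\<omega> h) (T z) = t * q0 - q1" and a2: "herm (\<omega> h) (H z *v T z) = t * q1 - q2"
      by (simp_all add: T_eq(1) N_vec herm_diff_right herm_scale_right matrix_vector_mult_diff_distrib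
          mult_vec_scale defs)
    have tr: "cnj (trace (H z)) = trace (H z)" by (simp add: cnj_trace H_adjoint)
    have y\<phi>T: "herm y (\<phi> h *v T z) = t * b1 - b2"
      by (simp add: T_eq(1) N_vec herm_diff_right herm_scale_right matrix_vector_mult_diff_distrib
          mult_vec_scale defs)
    have \<phi>Tw: "herm (\<phi> h *v T z) w = - (t * b1 - b3)"
      by (simp add: herm_\<phi> herm_T N_vec herm_diff_right herm_scale_right defs)
    have ydT: "herm y (?dT h) = - (t * b1 - b2) + p2 + trace (H z) * p1 + V z * p0"
      by (simp add: structure_deriv_T_def herm_add_right herm_minus_right herm_diff_right y\<phi>T matrix_vector_mult_add_rdistrib
          matrix_vector_mul_assoc[symmetric] mscale_mult_vec herm_scale_right defs)
    have dTw: "herm (?dT h) w = (t * b1 - b3) + q2 + trace (H z) * q1 + V z * q0"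
      by (simp add: structure_deriv_T_def herm_add_left herm_minus_left herm_diff_left \<phi>Tw matrix_vector_mult_add_rdistrib
          matrix_vector_mul_assoc[symmetric] mscale_mult_vec herm_scale_left herm_H tr V_real defs)
    have ydHw: "herm y (?dH h *v w) = - b2 + b3 + q0 * \<tau> + \<tau> * p0"
      by (simp add: structure_deriv_H_def matrix_vector_mult_add_rdistrib matrix_vector_mult_diff_rdistrib herm_linear outer_mult_vec
          matrix_mult_minus matrix_vector_mul_assoc[symmetric] defs \<tau> \<tau>_def[symmetric])
    have "?L = (t * q0 - q1 + (t * p0 - p1)) * t + ?dV h + (herm y (?dT h) + herm y (?dH h *v w) + herm (?dT h) w)"
      by (simp add: trace_dH s1 s2 N_def[symmetric] w_def[symmetric] matrix_mult_minus herm_add_right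
          matrix_vector_mul_assoc[symmetric] herm_T_Inv)
    also have "\<dots> = (t\<^sup>2 + trace (H z) * t + V z + \<tau>) * (q0 + p0)"
      unfolding ydT dTw ydHw structure_deriv_V_def s1 s2 a1 a2 by (simp add: algebra_simps power2_eq_square)
    finally show ?thesis
      by (simp add: q0_def p0_def N_def[symmetric] w_def[symmetric] \<tau>)
  qed
  ultimately have dQ: "(?Q has_derivative (\<lambda>h. ?Q z * ?\<sigma> h)) (at z)" by simp
  have "((\<lambda>u. det (mat t - H u) * ?Q u) has_derivative
      (\<lambda>h. det (mat t - H z) * (?Q z * ?\<sigma> h) + (- det (mat t - H z) * ?\<sigma> h) * ?Q z)) (at z)"
    by (rule has_derivative_mult[OF has_derivative_det_structure dQ])
  then have D: "((\<lambda>u. det (mat t - H u) * ?Q u) has_derivative (\<lambda>h. 0)) (at z)"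
    by (simp add: algebra_simps)
  have eq: "det R * (a + herm x (Inv R *v x)) = det R * a + herm x (Cof R *v x)"
    if "det R \<noteq> 0" for R :: "complex^'n^'n" and a x
    using that by (simp add: Cof_eq_Inv mscale_mult_vec herm_scale_right algebra_simps)
  have "isCont (\<lambda>u. det (mat t - H u)) z"
    using has_derivative_det_structure by (rule has_derivative_continuous)
  then have "\<forall>\<^sub>F u in at z. det (mat t - H u) \<noteq> 0"
    using nz by (simp add: isCont_def tendsto_imp_eventually_ne)
  then have "\<forall>\<^sub>F u in at z. det (mat t - H u) * ?Q u =
     det (mat t - H u) * (t\<^sup>2 + trace (H u) * t + V u) + herm (T u) (Cof (mat t - H u) *v T u)"
    by eventually_elim (simp add: eq)
  then show ?thesis
    by (rule has_derivative_transform_eventually[OF D]) (simp_all add: eq nz)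
qed

end

end

lemma det_shift_nonzero:
  assumes "adjoint_matrix B = B" "t \<notin> \<real>"
  shows "det (mat t - B) \<noteq> 0"
proof -
  obtain e l where e: "onb e" "\<And>k. B *v e k = complex_of_real (l k) *s e k"
    using hermitian_spectral[OF assms(1)] by blast
  show ?thesis using assms(2) by (auto simp: onb_diag(1)[OF e])
qed

section \<open>Hermitian forms and square roots\<close>

lemma differentiable_prod:
  fixes f :: "'i \<Rightarrow> 'e::real_normed_vector \<Rightarrow> 'b::real_normed_field"
  assumes "\<And>i. i \<in> I \<Longrightarrow> f i differentiable (at a within S)"
  shows "(\<lambda>x. \<Prod>i\<in>I. f i x) differentiable (at a within S)"
  using assms by (induction I rule: infinite_finite_induct) (simp_all add: differentiable_mult)

text \<open>The power series splits into its finitely many terms of degree at most 1, which are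
  differentiable, and a remainder of quadratic order.\<close>

lemma real_analytic_on_differentiable:
  fixes f :: "'e::euclidean_space \<Rightarrow> real"
  assumes "real_analytic_on f S" "a \<in> S"
  shows "f differentiable (at a)"
proof -
  obtain r c where r: "r > 0" and c: "\<And>z. z \<in> ball a r \<Longrightarrow>
      ((\<lambda>\<alpha>. c \<alpha> * (\<Prod>b\<in>Basis. ((z - a) \<bullet> b) ^ \<alpha> b)) has_sum f z) (Basis \<rightarrow>\<^sub>E UNIV)"
    using assms unfolding real_analytic_on_def by meson
  define J where "J = (Basis \<rightarrow>\<^sub>E UNIV :: ('e \<Rightarrow> nat) set)"
  define deg where "deg \<alpha> = (\<Sum>b\<in>Basis. \<alpha> b)" for \<alpha> :: "'e \<Rightarrow> nat"
  define J1 where "J1 = {\<alpha> \<in> J. deg \<alpha> \<le> 1}"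
  define m where "m z \<alpha> = (\<Prod>b\<in>Basis. ((z - a) \<bullet> b) ^ \<alpha> b)" for z \<alpha>
  have "finite J1"
  proof (rule finite_subset)
    show "J1 \<subseteq> (Basis \<rightarrow>\<^sub>E {..1})"
    proof
      fix \<alpha> assume \<alpha>: "\<alpha> \<in> J1"
      have "\<alpha> b \<le> 1" if "b \<in> Basis" for b
        using \<alpha> member_le_sum[of b Basis \<alpha>] that by (auto simp: J1_def deg_def)
      then show "\<alpha> \<in> (Basis \<rightarrow>\<^sub>E {..1})" using \<alpha> by (auto simp: J1_def J_def PiE_iff)
    qed
    show "finite ((Basis :: 'e set) \<rightarrow>\<^sub>E {..1::nat})" by (intro finite_PiE) auto
  qed
  \<comment> \<open>At the point \<open>z1\<close> all coordinates of \<open>z1 - a\<close> equal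
    \<open>\<rho>\<close>, so convergence there controls every monomial of degree d by
    \<open>\<rho> ^ d\<close>. The summand 1 keeps the denominator positive.\<close>
  obtain \<rho> where \<rho>: "\<rho> > 0" "\<rho> *\<^sub>R (\<Sum>b\<in>Basis. b::'e) \<in> ball 0 r"
  proof
    define s where "s = norm (\<Sum>b\<in>Basis. b::'e)"
    have "s \<ge> 0" by (simp add: s_def)
    show "r / (s + 1) > 0" using r \<open>s \<ge> 0\<close> by simp
    have "r / (s + 1) * s < r" using r \<open>s \<ge> 0\<close> by (simp add: field_simps)
    then show "(r / (s + 1)) *\<^sub>R (\<Sum>b\<in>Basis. b::'e) \<in> ball 0 r"
      using r \<open>s \<ge> 0\<close> by (simp add: s_def[symmetric])
  qed
  define z1 where "z1 = a + \<rho> *\<^sub>R (\<Sum>b\<in>Basis. b)"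
  have z1: "z1 \<in> ball a r" using \<rho>(2) by (simp add: z1_def dist_norm)
  have m1: "m z1 \<alpha> = \<rho> ^ deg \<alpha>" for \<alpha>
  proof -
    have "(z1 - a) \<bullet> b = \<rho>" if "b \<in> Basis" for b
      using that by (simp add: z1_def inner_sum_left inner_Basis)
    then show ?thesis by (simp add: m_def deg_def power_sum)
  qed
  have summ1: "(\<lambda>\<alpha>. c \<alpha> * \<rho> ^ deg \<alpha>) summable_on J"
    using c[OF z1] m1 unfolding J_def m_def summable_on_def by auto
  then have abs1: "(\<lambda>\<alpha>. \<bar>c \<alpha>\<bar> * \<rho> ^ deg \<alpha>) summable_on J"
    using \<rho>(1) by (subst (asm) summable_on_iff_abs_summable_on_real) (simp add: abs_mult)
  define K where "K = infsum (\<lambda>\<alpha>. \<bar>c \<alpha>\<bar> * \<rho> ^ deg \<alpha>) J"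
  have K0: "K \<ge> 0" unfolding K_def by (intro infsum_nonneg) (use \<rho> in auto)
  define p where "p z = (\<Sum>\<alpha>\<in>J1. c \<alpha> * m z \<alpha>)" for z
  define R where "R z = f z - p z" for z
  have p_diff: "p differentiable (at a)"
    unfolding p_def m_def
    by (intro differentiable_sum \<open>finite J1\<close> ballI differentiable_mult differentiable_const
        differentiable_prod differentiable_power differentiable_inner differentiable_diff differentiable_ident)
  have R_bound: "\<bar>R z\<bar> \<le> K * (norm (z - a) / \<rho>)\<^sup>2" if z: "z \<in> ball a (min r \<rho>)" for z
  proof -
    define q where "q = norm (z - a) / \<rho>"
    have q: "0 \<le> q" "q \<le> 1" using z \<rho> by (auto simp: q_def dist_norm norm_minus_commute)
    have hs: "((\<lambda>\<alpha>. c \<alpha> * m z \<alpha>) has_sum f z) J" using c[of z] z by (simp add: J_def m_def)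
    have "((\<lambda>\<alpha>. c \<alpha> * m z \<alpha>) has_sum p z) J1"
      unfolding p_def by (intro has_sum_finite \<open>finite J1\<close>)
    from has_sum_Diff[OF hs this] have hR: "((\<lambda>\<alpha>. c \<alpha> * m z \<alpha>) has_sum R z) (J - J1)"
      by (auto simp: R_def J1_def)
    have mb: "\<bar>m z \<alpha>\<bar> \<le> \<rho> ^ deg \<alpha> * q ^ deg \<alpha>" for \<alpha>
    proof -
      have "\<bar>m z \<alpha>\<bar> = (\<Prod>b\<in>Basis. \<bar>(z - a) \<bullet> b\<bar> ^ \<alpha> b)" by (simp add: m_def abs_prod power_abs)
      also have "\<dots> \<le> (\<Prod>b\<in>Basis. (\<rho> * q) ^ \<alpha> b)"
        using \<rho>(1) by (intro prod_mono conjI power_mono) (auto simp: q_def Basis_le_norm)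
      finally show ?thesis by (simp add: deg_def power_sum power_mult_distrib prod.distrib)
    qed
    have abs2: "(\<lambda>\<alpha>. q\<^sup>2 * (\<bar>c \<alpha>\<bar> * \<rho> ^ deg \<alpha>)) summable_on (J - J1)"
      by (intro summable_on_cmult_right summable_on_subset_banach[OF abs1]) auto
    have trm: "\<bar>c \<alpha> * m z \<alpha>\<bar> \<le> q\<^sup>2 * (\<bar>c \<alpha>\<bar> * \<rho> ^ deg \<alpha>)" if "\<alpha> \<in> J - J1" for \<alpha>
    proof -
      have "deg \<alpha> \<ge> 2" using that by (auto simp: J1_def)
      then have "q ^ deg \<alpha> \<le> q\<^sup>2" using q by (intro power_decreasing)
      then have "\<rho> ^ deg \<alpha> * q ^ deg \<alpha> \<le> \<rho> ^ deg \<alpha> * q\<^sup>2" using \<rho> by (intro mult_left_mono) auto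
      with mb[of \<alpha>] have "\<bar>m z \<alpha>\<bar> \<le> \<rho> ^ deg \<alpha> * q\<^sup>2" by linarith
      then have "\<bar>c \<alpha>\<bar> * \<bar>m z \<alpha>\<bar> \<le> \<bar>c \<alpha>\<bar> * (\<rho> ^ deg \<alpha> * q\<^sup>2)" by (intro mult_left_mono) auto
      then show ?thesis by (simp add: abs_mult mult_ac)
    qed
    have "\<bar>R z\<bar> = norm (infsum (\<lambda>\<alpha>. c \<alpha> * m z \<alpha>) (J - J1))" using hR by (simp add: infsumI)
    also have "\<dots> \<le> infsum (\<lambda>\<alpha>. q\<^sup>2 * (\<bar>c \<alpha>\<bar> * \<rho> ^ deg \<alpha>)) (J - J1)"
      by (rule norm_infsum_le[OF has_sum_infsum has_sum_infsum]) 
        (use hR abs2 trm in \<open>auto simp: summable_on_def\<close>)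
    also have "\<dots> \<le> infsum (\<lambda>\<alpha>. q\<^sup>2 * (\<bar>c \<alpha>\<bar> * \<rho> ^ deg \<alpha>)) J"
      using \<rho>(1) by (intro infsum_mono_neutral abs2 summable_on_cmult_right abs1) auto
    also have "\<dots> = q\<^sup>2 * K" unfolding K_def by (rule infsum_cmult_right') 
    finally show ?thesis by (simp add: q_def mult.commute)
  qed
  have "(R has_derivative (\<lambda>h. 0)) (at a)"
  proof (rule has_derivativeI_sandwich[where e = "min r \<rho>" and H = "\<lambda>z. K / \<rho>\<^sup>2 * norm (z - a)"])
    have "R a = 0" using R_bound[of a] r \<rho> by simp
    fix z assume z: "z \<in> UNIV" "z \<noteq> a" "dist z a < min r \<rho>"
    then have "\<bar>R z\<bar> \<le> K * (norm (z - a) / \<rho>)\<^sup>2" by (intro R_bound) (simp add: dist_commute)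
    then show "norm (R z - R a - 0) / norm (z - a) \<le> K / \<rho>\<^sup>2 * norm (z - a)"
      using z \<open>R a = 0\<close> \<rho>(1) by (simp add: field_simps power2_eq_square)
  next
    have "((\<lambda>z. K / \<rho>\<^sup>2 * norm (z - a)) \<longlongrightarrow> K / \<rho>\<^sup>2 * norm (a - a)) (at a within UNIV)"
      by (intro tendsto_intros)
    then show "((\<lambda>z. K / \<rho>\<^sup>2 * norm (z - a)) \<longlongrightarrow> 0) (at a within UNIV)" by simp
  qed (use r \<rho> in auto)
  then have "R differentiable (at a)" by (rule differentiableI)
  then have "(\<lambda>z. p z + R z) differentiable (at a)" using p_diff by (rule differentiable_add[rotated])
  then show ?thesis by (simp add: R_def)
qed

text \<open>\<open>hh\<close> is the sesquilinear form with real part b, and M is its Gram matrix;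
  invariance of b under multiplication by i makes \<open>hh\<close> complex linear in its second
  argument.\<close>

lemma hermitian_form_matrix:
  fixes b :: "complex^'n \<Rightarrow> complex^'n \<Rightarrow> real"
  assumes add: "\<And>v w z. b (v + w) z = b v z + b w z" and scale: "\<And>r v w. b (r *\<^sub>R v) w = r * b v w"
    and sym: "\<And>v w. b v w = b w v" and J: "\<And>v w. b (\<i> *s v) (\<i> *s w) = b v w"
  defines "M \<equiv> (\<chi> i j. Complex (b (axis i 1) (axis j 1)) (b (\<i> *s axis i 1) (axis j 1)))"
  shows "Re (herm v (M *v w)) = b v w" "adjoint_matrix M = M"
proof -
  define hh where "hh v w = Complex (b v w) (b (\<i> *s v) w)" for v w
  have JJ: "b (\<i> *s v) w = - b v (\<i> *s w)" for v w
  proof -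
    have "\<i> *s (\<i> *s w) = (-1) *\<^sub>R w" by (simp add: vec_eq_iff)
    then have "b u (\<i> *s (\<i> *s w)) = - b u w" for u
      using scale[of "-1" w u] by (simp add: sym[of u])
    then show ?thesis using J[of v "\<i> *s w"] by simp
  qed
  have add2: "b z (v + w) = b z v + b z w" and scale2: "b w (r *\<^sub>R v) = r * b w v" for v w z r
    using add scale sym by metis+
  have hh_sym: "cnj (hh v w) = hh w v" for v w
    using JJ[of v w] sym by (simp add: hh_def complex_eq_iff)
  have hh_add: "hh v (w + w') = hh v w + hh v w'" for v w w'
    by (simp add: hh_def complex_eq_iff add2)
  have hh_scale: "hh v (a *s w) = a * hh v w" for v w a
  proof -
    have "a *s w = Re a *\<^sub>R w + Im a *\<^sub>R (\<i> *s w)"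
      by (simp add: vec_eq_iff complex_eq_iff)
    moreover have "b v (\<i> *s w) = - b (\<i> *s v) w" by (simp add: JJ)
    ultimately show ?thesis by (simp add: hh_def complex_eq_iff add2 scale2 J)
  qed
  have hh_sum: "hh v (\<Sum>i\<in>I. f i) = (\<Sum>i\<in>I. hh v (f i))" for v I and f :: "'n \<Rightarrow> complex^'n"
  proof (induction I rule: infinite_finite_induct)
    case empty show ?case using hh_add[of v 0 0] by simp
  next
    case (infinite I) show ?case using infinite hh_add[of v 0 0] by simp
  qed (simp_all add: hh_add)
  have "herm v (M *v w) = hh v w" for v w
  proof -
    have hhM: "hh (axis i 1) (axis j 1) = M $ i $ j" for i j by (simp add: M_def hh_def)
    have *: "hh (axis i 1) w = (M *v w) $ i" for i
    proof -
      have "hh (axis i 1) w = hh (axis i 1) (\<Sum>j\<in>UNIV. w $ j *s axis j 1)"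
        by (simp add: basis_expansion)
      also have "\<dots> = (M *v w) $ i"
        by (simp add: hh_sum hh_scale hhM matrix_vector_mult_def mult.commute)
      finally show ?thesis .
    qed
    have "hh v w = cnj (hh w (\<Sum>i\<in>UNIV. v $ i *s axis i 1))"
      by (simp add: basis_expansion hh_sym)
    also have "\<dots> = herm v (M *v w)"
      by (simp add: hh_sum hh_scale hh_sym * herm_def)
    finally show ?thesis ..
  qed
  then show "Re (herm v (M *v w)) = b v w" by (simp add: hh_def)
  have "cnj (M $ i $ j) = M $ j $ i" for i j
    using hh_sym[of "axis i 1" "axis j 1"] by (simp add: M_def hh_def)
  then show "adjoint_matrix M = M"
    by (simp add: adjoint_matrix_def vec_eq_iff)
qed

lemma matrix_add_rdistrib: "(C + D) ** B = C ** B + (D::'r::comm_ring_1^'n^'m) ** B"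
  by (simp add: vec_eq_iff matrix_matrix_mult_def algebra_simps sum.distrib)

lemma herm_Re_unique:
  assumes "\<And>v w. Re (herm v (X *v w)) = Re (herm v (Y *v w))"
  shows "X = Y"
proof -
  have "X *v w = Y *v w" for w
  proof -
    define u where "u = X *v w - Y *v w"
    have "u \<bullet> u = 0"
      using assms[of u w] by (simp add: Re_herm u_def inner_diff_right)
    then show ?thesis by (simp add: u_def)
  qed
  then show ?thesis by (simp add: matrix_eq)
qed

definition psd :: "complex^'n^'n::finite \<Rightarrow> bool" where
  "psd B \<longleftrightarrow> adjoint_matrix B = B \<and> (\<forall>v. v \<bullet> (B *v v) \<ge> 0)"

text \<open>Any choice serves: \<open>psqrt_near_id\<close> controls every positive semidefinite
  root, and yields both the value and the derivative at the identity.\<close>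

definition psqrt :: "complex^'n^'n \<Rightarrow> complex^'n^'n::finite" where
  "psqrt B = (SOME S. psd S \<and> S ** S = B)"

lemma psqrt:
  assumes "psd B"
  shows "psd (psqrt B)" "psqrt B ** psqrt B = B"
proof -
  obtain e l where e: "onb e" "\<And>k. B *v e k = complex_of_real (l k) *s e k"
    using hermitian_spectral assms by (metis psd_def)
  have ee: "herm (e k) (e k) = 1" for k using e(1) by (simp add: onb_def)
  have l0: "l k \<ge> 0" for k
  proof -
    have "Re (herm (e k) (B *v e k)) = l k" by (simp add: e(2) herm_scale_right ee)
    then show ?thesis using assms by (metis psd_def Re_herm)
  qed
  define S where "S = (\<Sum>k\<in>UNIV. mscale (complex_of_real (sqrt (l k))) (outer (e k) (e k)))"
  have sum_mult: "(\<Sum>i\<in>I. f i) *v v = (\<Sum>i\<in>I. f i *v v)" for f :: "'a \<Rightarrow> complex^'a^'a" and I v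
    by (induction I rule: infinite_finite_induct) (simp_all add: matrix_vector_mult_add_rdistrib)
  have S_vec: "S *v v = (\<Sum>k\<in>UNIV. (complex_of_real (sqrt (l k)) * herm (e k) v) *s e k)" for v
    by (simp add: S_def sum_mult mscale_mult_vec outer_mult_vec)
  have adj: "adjoint_matrix S = S"
    by (simp add: S_def adjoint_matrix_def vec_eq_iff mscale_def outer_def mult_ac)
  have eS: "herm (e k) (S *v v) = complex_of_real (sqrt (l k)) * herm (e k) v" for k v
    using e(1) by (simp add: S_vec herm_sum_right herm_scale_right onb_def if_distrib[of "\<lambda>x. _ * x"] cong: if_cong)
  have eB: "herm (e k) (B *v v) = complex_of_real (l k) * herm (e k) v" for k v
    using assms by (simp add: psd_def herm_mult_right e(2) herm_scale_left)
  have "S *v (S *v v) = B *v v" for v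
    using onb_expand[OF e(1), of "S *v (S *v v)"] onb_expand[OF e(1), of "B *v v"] l0
    by (simp add: eS eB mult.assoc[symmetric] of_real_mult[symmetric] del: of_real_mult)
  then have "S ** S = B" by (simp add: matrix_eq matrix_vector_mul_assoc[symmetric])
  moreover have "psd S"
    unfolding psd_def
  proof (intro conjI allI adj)
    fix v
    have "v \<bullet> (S *v v) = (\<Sum>k\<in>UNIV. sqrt (l k) * (cmod (herm (e k) v))\<^sup>2)"
      unfolding Re_herm[symmetric] onb_parseval[OF e(1), of v "S *v v"] eS
      by (simp add: cmod_power2) (simp add: power2_eq_square algebra_simps)
    then show "v \<bullet> (S *v v) \<ge> 0" using l0 by (simp add: sum_nonneg)
  qed
  ultimately have "psd (psqrt B) \<and> psqrt B ** psqrt B = B"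
    unfolding psqrt_def by (metis (mono_tags, lifting) someI_ex)
  then show "psd (psqrt B)" "psqrt B ** psqrt B = B" by auto
qed

text \<open>For the root S one has \<open>B - 1 = (S + 1) (S - 1)\<close>, and \<open>S + 1\<close>
  does not shrink vectors because S is positive semidefinite.\<close>

lemma psqrt_near_id:
  assumes "psd B"
  shows "norm ((psqrt B - mat 1) *v v) \<le> norm ((B - mat 1) *v v)"
proof -
  let ?S = "psqrt B"
  define u where "u = (?S - mat 1) *v v"
  have B1: "B - mat 1 = (?S + mat 1) ** (?S - mat 1)"
    by (simp add: matrix_diff_ldistrib matrix_add_rdistrib psqrt[OF assms])
  have "(B - mat 1) *v v = ?S *v u + u"
    by (simp add: B1 matrix_vector_mul_assoc[symmetric] u_def matrix_vector_mult_add_rdistrib)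
  moreover have "norm u \<le> norm (?S *v u + u)"
  proof -
    have "u \<bullet> (?S *v u) \<ge> 0" using psqrt(1)[OF assms] by (simp add: psd_def)
    then have "u \<bullet> u \<le> u \<bullet> (?S *v u + u)" by (simp add: inner_add_right)
    also have "\<dots> \<le> norm u * norm (?S *v u + u)" by (rule norm_cauchy_schwarz)
    finally show ?thesis
      by (cases "u = 0") (simp_all add: dot_square_norm power2_eq_square)
  qed
  ultimately show ?thesis by (simp add: u_def)
qed

lemma psqrt_id: "psqrt (mat 1) = (mat 1 :: complex^'n^'n::finite)"
proof -
  have "psd (mat 1 :: complex^'n^'n)" by (simp add: psd_def)
  from psqrt_near_id[OF this] have "(psqrt (mat 1) - mat 1) *v v = 0" for v :: "complex^'n" by simp
  then show ?thesis by (simp add: matrix_eq matrix_vector_mult_diff_rdistrib)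
qed

lemma has_derivative_quadratic:
  fixes R :: "'e::real_normed_vector \<Rightarrow> 'b::real_normed_vector" and K :: "'e \<Rightarrow> 'c::real_normed_vector"
  assumes K: "(K has_derivative K') (at z)"
    and bound: "\<forall>\<^sub>F u in at z. norm (R u) \<le> C * (norm (K u - K z))\<^sup>2" and "R z = 0"
  shows "(R has_derivative (\<lambda>h. 0)) (at z)"
proof -
  obtain e where e: "((\<lambda>u. K u - K z) \<longlongrightarrow> 0) (at z)"
    using has_derivative_continuous[OF K] by (simp add: isCont_def LIM_zero_iff)
  have bl: "bounded_linear K'" using K by (rule has_derivative_bounded_linear)
  then obtain k where k: "\<And>h. norm (K' h) \<le> norm h * k" "k > 0" using bounded_linear.pos_bounded by blast
  have quot: "((\<lambda>u. (K u - K z - K' (u - z)) /\<^sub>R norm (u - z)) \<longlongrightarrow> 0) (at z)"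
    using K by (simp add: has_derivative_at_within)
  have lim: "((\<lambda>u. \<bar>C\<bar> * (norm (K u - K z) * (norm ((K u - K z - K' (u - z)) /\<^sub>R norm (u - z)) + k))) \<longlongrightarrow> 
      \<bar>C\<bar> * (norm (0::'c) * (norm (0::'c) + k))) (at z)"
    by (intro tendsto_intros e quot)
  have "((\<lambda>u. (R u - R z - 0) /\<^sub>R norm (u - z)) \<longlongrightarrow> 0) (at z)"
  proof (rule Lim_null_comparison)
    show "((\<lambda>u. \<bar>C\<bar> * (norm (K u - K z) * (norm ((K u - K z - K' (u - z)) /\<^sub>R norm (u - z)) + k))) \<longlongrightarrow> 0) (at z)"
      using lim by simp
    have "\<forall>\<^sub>F u in at z. u \<noteq> z" by (simp add: eventually_at_filter)
    with bound show "\<forall>\<^sub>F u in at z. norm ((R u - R z - 0) /\<^sub>R norm (u - z)) \<le>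
       \<bar>C\<bar> * (norm (K u - K z) * (norm ((K u - K z - K' (u - z)) /\<^sub>R norm (u - z)) + k))"
    proof eventually_elim
      case (elim u)
      define n where "n = norm (u - z)"
      have n: "n > 0" using elim by (simp add: n_def)
      have "norm (K u - K z) \<le> norm (K u - K z - K' (u - z)) + n * k"
        using norm_triangle_ineq[of "K u - K z - K' (u - z)" "K' (u - z)"] k(1)[of "u - z"]
        by (simp add: n_def)
      then have q: "norm (K u - K z) / n \<le> norm (K u - K z - K' (u - z)) / n + k"
        using n by (simp add: field_simps)
      have "norm (R u) \<le> \<bar>C\<bar> * (norm (K u - K z))\<^sup>2"
        using elim(1) by (smt (verit) mult_right_mono zero_le_power2)
      then have "norm (R u) / n \<le> \<bar>C\<bar> * (norm (K u - K z) * (norm (K u - K z) / n))"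
        using n by (simp add: divide_right_mono power2_eq_square mult.assoc)
      also have "\<dots> \<le> \<bar>C\<bar> * (norm (K u - K z) * (norm (K u - K z - K' (u - z)) / n + k))"
        using q by (intro mult_left_mono) auto
      finally show ?case using n assms(3) by (simp add: n_def[symmetric] divide_inverse mult.commute)
    qed
  qed
  then show ?thesis
    by (simp add: has_derivative_at_within)
qed

text \<open>From \<open>S^2 = K\<close> follows \<open>S = 1 + (K - 1) / 2 - (S - 1)^2 / 2\<close>,
  and the last term is of second order in \<open>K - 1\<close> by
  \<open>psqrt_near_id\<close>.\<close>

lemma has_derivative_psqrt_id:
  fixes K :: "'e::real_normed_vector \<Rightarrow> complex^'n^'n::finite"
  assumes K: "(K has_derivative K') (at z)" and Kz: "K z = mat 1" and psd: "\<forall>\<^sub>F u in at z. psd (K u)"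
  shows "((\<lambda>u. psqrt (K u)) has_derivative (\<lambda>h. (1/2) *\<^sub>R K' h)) (at z)"
proof -
  define R where "R u = (psqrt (K u) - mat 1) ** (psqrt (K u) - mat 1)" for u
  obtain C where C: "\<And>(X::complex^'n^'n) v. norm (X *v v) \<le> norm X * norm v * C" and C0: "C \<ge> 0"
    using bounded_bilinear.nonneg_bounded[OF bounded_bilinear_matrix_vector_mult] by blast
  have psdz: "psd (mat 1 :: complex^'n^'n)" by (simp add: psd_def)
  have Rz: "R z = 0" by (simp add: R_def Kz psqrt_id matrix_matrix_mult_def vec_eq_iff)
  have entry: "\<forall>\<^sub>F u in at z. norm (R u $ i $ j) \<le> C\<^sup>2 * (norm (K u - K z))\<^sup>2" for i j
    using psd
  proof eventually_elim
    case (elim u)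
    let ?D = "psqrt (K u) - mat 1"
    have R_eq: "R u *v v = ?D *v (?D *v v)" for v
      by (simp add: R_def matrix_vector_mul_assoc)
    \<comment> \<open>\<open>S - 1\<close> commutes with \<open>K - 1\<close>, so the norm bound can
      be applied to the two factors of \<open>(S - 1)^2\<close> in turn.\<close>
    have comm: "(K u - mat 1) *v (?D *v v) = ?D *v ((K u - mat 1) *v v)" for v
    proof -
      have "K u - mat 1 = (psqrt (K u) + mat 1) ** ?D"
        by (simp add: matrix_diff_ldistrib matrix_add_rdistrib psqrt[OF elim])
      moreover have "(psqrt (K u) + mat 1) ** ?D = ?D ** (psqrt (K u) + mat 1)"
        by (simp add: matrix_diff_ldistrib matrix_add_rdistrib matrix_diff_rdistrib matrix_add_ldistrib)
      ultimately show ?thesis by (metis matrix_vector_mul_assoc)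
    qed
    have "norm (R u $ i $ j) = norm ((R u *v axis j 1) $ i)"
      by (simp add: matrix_vector_mult_def axis_def if_distrib[of "\<lambda>x. _ * x"] cong: if_cong)
    also have "\<dots> \<le> norm (R u *v axis j 1)" by (rule Finite_Cartesian_Product.norm_nth_le)
    also have "\<dots> \<le> norm ((K u - mat 1) *v (?D *v axis j 1))"
      unfolding R_eq by (rule psqrt_near_id[OF elim])
    also have "\<dots> \<le> norm ((K u - mat 1) *v ((K u - mat 1) *v axis j 1))"
      unfolding comm by (rule psqrt_near_id[OF elim])
    also have "\<dots> \<le> norm (K u - mat 1) * norm ((K u - mat 1) *v axis j 1) * C" by (rule C)
    also have "\<dots> \<le> norm (K u - mat 1) * (norm (K u - mat 1) * norm (axis j 1 :: complex^'n) * C) * C"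
      using C0 by (intro mult_right_mono mult_left_mono C) auto
    also have "\<dots> = C\<^sup>2 * (norm (K u - mat 1))\<^sup>2"
      by (simp add: norm_axis_1 power2_eq_square mult_ac)
    finally show ?case by (simp add: Kz)
  qed
  have "(R has_derivative (\<lambda>h. 0)) (at z)"
    by (intro has_derivative_vec_componentwise) 
      (simp, rule has_derivative_quadratic[OF K entry], simp add: Rz)
  then have "((\<lambda>u. mat 1 + (1/2) *\<^sub>R (K u - mat 1) - (1/2) *\<^sub>R R u) has_derivative
      (\<lambda>h. 0 + (1/2) *\<^sub>R (K' h - 0) - (1/2) *\<^sub>R 0)) (at z)"
    by (intro has_derivative_add has_derivative_diff has_derivative_scaleR_right has_derivative_const K)
  then have D: "((\<lambda>u. mat 1 + (1/2) *\<^sub>R (K u - mat 1) - (1/2) *\<^sub>R R u) has_derivative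
      (\<lambda>h. (1/2) *\<^sub>R K' h)) (at z)" by simp
  have eq: "mat 1 + (1/2) *\<^sub>R (K u - mat 1) - (1/2) *\<^sub>R R u = psqrt (K u)" if "psd (K u)" for u
  proof -
    have "R u = K u - psqrt (K u) - psqrt (K u) + mat 1"
      by (simp add: R_def matrix_diff_ldistrib matrix_diff_rdistrib psqrt[OF that])
    then show ?thesis by (simp add: vec_eq_iff) (simp add: scaleR_conv_of_real field_simps)
  qed
  show ?thesis
    by (rule has_derivative_transform_eventually[OF D])
      (use eq psd eq[of z] psdz Kz in \<open>auto elim: eventually_mono\<close>)
qed

section \<open>Charts and coframes\<close>

locale kaehler =
  fixes A :: "('a::{t2_space,second_countable_topology}, 'n::finite) chart set" and g :: "('a, 'n) metric"
  assumes kaehler: "kaehler_manifold A g"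
begin

lemma charts_at_iff: "c \<in> charts_at A x \<longleftrightarrow> c \<in> A \<and> x \<in> fst c"
  by (simp add: charts_at_def)

lemma atlas: "complex_atlas A" and metric: "hermitian_metric A g" and analytic: "analytic_metric A g"
  using kaehler by (simp_all add: kaehler_manifold_def)

lemma charts_at_nonempty: "\<exists>c. c \<in> charts_at A x"
proof -
  have "charts_at A x \<noteq> {}" using atlas unfolding complex_atlas_def by blast
  then show ?thesis by blast
qed

lemma some_chart: "some_chart A x \<in> charts_at A x"
  unfolding some_chart_def using charts_at_nonempty by (rule someI_ex)

lemma chart:
  assumes "c \<in> A"
  shows open_chart: "open (fst c)" and open_chart_image: "open (chart_image c)"
    and continuous_chart: "continuous_on (fst c) (snd c)"
    and continuous_chart_inv: "continuous_on (chart_image c) (chart_inv c)"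
    and chart_inv_in: "z \<in> chart_image c \<Longrightarrow> chart_inv c z \<in> fst c"
    and chart_chart_inv: "z \<in> chart_image c \<Longrightarrow> snd c (chart_inv c z) = z"
    and chart_in: "x \<in> fst c \<Longrightarrow> snd c x \<in> chart_image c"
    and chart_inv_chart: "x \<in> fst c \<Longrightarrow> chart_inv c (snd c x) = x"
proof -
  have h: "open (fst c)" "open (chart_image c)"
      "homeomorphism (fst c) (chart_image c) (snd c) (chart_inv c)"
    using atlas assms by (auto simp: complex_atlas_def)
  then show "open (fst c)" "open (chart_image c)" "continuous_on (fst c) (snd c)"
    "continuous_on (chart_image c) (chart_inv c)"
    "z \<in> chart_image c \<Longrightarrow> chart_inv c z \<in> fst c"
    "z \<in> chart_image c \<Longrightarrow> snd c (chart_inv c z) = z"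
    "x \<in> fst c \<Longrightarrow> snd c x \<in> chart_image c"
    "x \<in> fst c \<Longrightarrow> chart_inv c (snd c x) = x"
    by (auto simp: homeomorphism_def)
qed

lemma chart_inv_vimage_open:
  assumes "c \<in> A" "open U"
  shows "open {z \<in> chart_image c. chart_inv c z \<in> U}"
  using continuous_open_preimage[OF continuous_chart_inv[OF assms(1)] open_chart_image[OF assms(1)] assms(2)]
  by (simp add: vimage_def Int_def)

definition J :: "('a, 'n) chart \<Rightarrow> ('a, 'n) chart \<Rightarrow> 'a \<Rightarrow> complex^'n \<Rightarrow> complex^'n" where
  "J c c' x = frechet_derivative (snd c' \<circ> chart_inv c) (at (snd c x))"

lemma transition_derivative:
  assumes c: "c \<in> charts_at A x" and c': "c' \<in> charts_at A x"
  shows "((snd c' \<circ> chart_inv c) has_derivative J c c' x) (at (snd c x))" "J c c' x (k *s v) = k *s J c c' x v"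
proof -
  have cA: "c \<in> A" "c' \<in> A" "x \<in> fst c" "x \<in> fst c'" using c c' by (auto simp: charts_at_iff)
  then have "holomorphic_map_on (snd c' \<circ> chart_inv c) (snd c ` (fst c \<inter> fst c'))"
    using atlas by (auto simp: complex_atlas_def)
  moreover have "snd c x \<in> snd c ` (fst c \<inter> fst c')" using cA by auto
  ultimately obtain D where D: "((snd c' \<circ> chart_inv c) has_derivative D) (at (snd c x))"
    "\<And>k v. D (k *s v) = k *s D v"
    unfolding holomorphic_map_on_def by blast
  then have "J c c' x = D" unfolding J_def by (metis frechet_derivative_at)
  with D show "((snd c' \<circ> chart_inv c) has_derivative J c c' x) (at (snd c x))"
    "J c c' x (k *s v) = k *s J c c' x v" by simp_all
qed

lemma J_linear: "c \<in> charts_at A x \<Longrightarrow> c' \<in> charts_at A x \<Longrightarrow> linear (J c c' x)"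
  using transition_derivative(1) has_derivative_linear by blast

lemma eventually_chart:
  assumes "c \<in> charts_at A x" "open U" "x \<in> U"
  shows "\<forall>\<^sub>F z in at (snd c x). z \<in> chart_image c \<and> chart_inv c z \<in> U"
proof -
  have c: "c \<in> A" "x \<in> fst c" using assms by (auto simp: charts_at_iff)
  have "open {z \<in> chart_image c. chart_inv c z \<in> U}" by (rule chart_inv_vimage_open[OF c(1) assms(2)])
  moreover have "snd c x \<in> {z \<in> chart_image c. chart_inv c z \<in> U}"
    using chart[OF c(1)] c assms by auto
  ultimately show ?thesis
    using eventually_at_in_open'[of "{z \<in> chart_image c. chart_inv c z \<in> U}" "snd c x"] by simp
qed

lemma J_chain:
  assumes "c \<in> charts_at A x" "c' \<in> charts_at A x" "c'' \<in> charts_at A x"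
  shows "J c' c'' x (J c c' x v) = J c c'' x v"
proof -
  have c: "c \<in> A" "x \<in> fst c" "c' \<in> A" "x \<in> fst c'" using assms by (auto simp: charts_at_iff)
  have cx: "(snd c' \<circ> chart_inv c) (snd c x) = snd c' x"
    using chart(8)[OF c(1) c(2)] by simp
  have "((snd c'' \<circ> chart_inv c' \<circ> (snd c' \<circ> chart_inv c)) has_derivative (J c' c'' x \<circ> J c c' x)) (at (snd c x))"
    by (intro diff_chain_at transition_derivative(1) assms) (simp only: cx transition_derivative(1) assms)
  moreover have "((snd c'' \<circ> chart_inv c' \<circ> (snd c' \<circ> chart_inv c)) has_derivative J c c'' x) (at (snd c x))"
  proof (rule has_derivative_transform_eventually[OF transition_derivative(1)[OF assms(1,3)]])
    show "\<forall>\<^sub>F z in at (snd c x). (snd c'' \<circ> chart_inv c) z = (snd c'' \<circ> chart_inv c' \<circ> (snd c' \<circ> chart_inv c)) z"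
      using eventually_chart[OF assms(1) chart(1)[OF c(3)] c(4)]
      by eventually_elim (simp add: chart(8)[OF c(3)])
  qed (use chart(8)[OF c(1,2)] chart(8)[OF c(3,4)] in auto)
  ultimately show ?thesis by (metis comp_apply has_derivative_unique)
qed

lemma J_same:
  assumes "c \<in> charts_at A x"
  shows "J c c x v = v"
proof -
  have c: "c \<in> A" "x \<in> fst c" using assms by (auto simp: charts_at_iff)
  have "((snd c \<circ> chart_inv c) has_derivative (\<lambda>v. v)) (at (snd c x))"
  proof (rule has_derivative_transform_eventually[OF has_derivative_ident])
    show "\<forall>\<^sub>F z in at (snd c x). z = (snd c \<circ> chart_inv c) z"
      using eventually_chart[OF assms open_UNIV UNIV_I]
      by eventually_elim (simp add: chart(6)[OF c(1)])
  qed (use chart(8)[OF c] in auto)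
  from has_derivative_unique[OF this transition_derivative(1)[OF assms assms]] show ?thesis by metis
qed

lemma coord_vector_apply:
  "coord_vector A c x w c' = (if c' \<in> charts_at A x then J c c' x w else 0)"
  by (simp add: coord_vector_def J_def)

lemma coord_vector_same: "c \<in> charts_at A x \<Longrightarrow> coord_vector A c x w c = w"
  by (simp add: coord_vector_apply J_same)

lemma coord_vector_in: "c \<in> charts_at A x \<Longrightarrow> coord_vector A c x w \<in> tangent_space A x"
  by (auto simp: tangent_space_def coord_vector_apply J_chain fun_eq_iff)

lemma tangent_eq_coord: "c \<in> charts_at A x \<Longrightarrow> v \<in> tangent_space A x \<Longrightarrow> coord_vector A c x (v c) = v"
  by (simp add: tangent_space_def)

lemma coord_vector_add: "c \<in> charts_at A x \<Longrightarrow>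
    coord_vector A c x (v + w) = coord_vector A c x v + coord_vector A c x w"
  by (auto simp: fun_eq_iff coord_vector_apply plus_fun_def linear_add[OF J_linear])

lemma coord_vector_scale: "c \<in> charts_at A x \<Longrightarrow>
    coord_vector A c x (k *s v) = cscale k (coord_vector A c x v)"
  by (auto simp: fun_eq_iff coord_vector_apply cscale_def transition_derivative(2))

lemma coord_vector_scaleR: "c \<in> charts_at A x \<Longrightarrow>
    coord_vector A c x (r *\<^sub>R v) = r *\<^sub>R coord_vector A c x v"
  by (auto simp: fun_eq_iff coord_vector_apply scaleR_fun_def linear_scale[OF J_linear])

section \<open>The metric and the coframes in the coordinates of a chart\<close>

definition gc :: "('a, 'n) chart \<Rightarrow> complex^'n \<Rightarrow> complex^'n \<Rightarrow> complex^'n \<Rightarrow> real" where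
  "gc c z v w = g (chart_inv c z) (coord_vector A c (chart_inv c z) v) (coord_vector A c (chart_inv c z) w)"

text \<open>The Gram matrix of the Hermitian form whose real part is the metric.\<close>

definition Gm :: "('a, 'n) chart \<Rightarrow> complex^'n \<Rightarrow> complex^'n^'n" where
  "Gm c z = (\<chi> i j. Complex (gc c z (axis i 1) (axis j 1)) (gc c z (\<i> *s axis i 1) (axis j 1)))"

context
  fixes c z
  assumes c: "c \<in> A" and z: "z \<in> chart_image c"
begin

lemma chart_at_inv: "c \<in> charts_at A (chart_inv c z)"
  using chart(5)[OF c z] c by (simp add: charts_at_iff)

lemma gc_bilinear:
  "gc c z (v + w) u = gc c z v u + gc c z w u" "gc c z (r *\<^sub>R v) w = r * gc c z v w"
  "gc c z v w = gc c z w v" "gc c z (\<i> *s v) (\<i> *s w) = gc c z v w" "v \<noteq> 0 \<Longrightarrow> gc c z v v > 0"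
proof -
  note in_ts = coord_vector_in[OF chart_at_inv]
  note m = metric[unfolded hermitian_metric_def, rule_format, OF in_ts in_ts]
  show "gc c z (v + w) u = gc c z v u + gc c z w u"
    using m in_ts by (simp add: gc_def coord_vector_add[OF chart_at_inv])
  show "gc c z (r *\<^sub>R v) w = r * gc c z v w"
    using m by (simp add: gc_def coord_vector_scaleR[OF chart_at_inv])
  show "gc c z v w = gc c z w v" using m unfolding gc_def by blast
  show "gc c z (\<i> *s v) (\<i> *s w) = gc c z v w"
    using m by (simp add: gc_def coord_vector_scale[OF chart_at_inv])
  show "gc c z v v > 0" if "v \<noteq> 0"
  proof -
    have "coord_vector A c (chart_inv c z) v \<noteq> 0"
      using that coord_vector_same[OF chart_at_inv, of v] by (auto simp: zero_fun_def)
    then show ?thesis using m unfolding gc_def by blast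
  qed
qed

lemma Gm: "Re (herm v (Gm c z *v w)) = gc c z v w" "adjoint_matrix (Gm c z) = Gm c z"
  using hermitian_form_matrix[of "gc c z"] gc_bilinear unfolding Gm_def by blast+

text \<open>The isometry condition implies the rest of the definition of a coframe: positivity makes
  B injective, and equality of dimensions makes it surjective.\<close>

lemma bundle_chart_iff: "(z, B) \<in> bundle_chart A g c \<longleftrightarrow> adjoint_matrix B ** B = Gm c z"
proof -
  let ?x = "chart_inv c z"
  have adj: "adjoint_matrix B ** B = Gm c z \<longleftrightarrow> (\<forall>v w. (B *v v) \<bullet> (B *v w) = gc c z v w)"
  proof
    assume eq: "adjoint_matrix B ** B = Gm c z"
    show "\<forall>v w. (B *v v) \<bullet> (B *v w) = gc c z v w"
      by (simp add: Gm(1)[symmetric] eq[symmetric] Re_herm[symmetric] herm_mult_left matrix_vector_mul_assoc[symmetric])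
  next
    assume "\<forall>v w. (B *v v) \<bullet> (B *v w) = gc c z v w"
    moreover have "(B *v v) \<bullet> (B *v w) = Re (herm v ((adjoint_matrix B ** B) *v w))" for v w
      by (simp add: Re_herm[symmetric] herm_mult_left matrix_vector_mul_assoc[symmetric])
    ultimately show "adjoint_matrix B ** B = Gm c z"
      by (intro herm_Re_unique) (simp add: Gm(1))
  qed
  let ?u = "\<lambda>v\<in>tangent_space A ?x. B *v v c"
  have "(z, B) \<in> bundle_chart A g c \<longleftrightarrow> (?x, ?u) \<in> coframe_bundle A g"
    using z by (simp add: bundle_chart_def coframe_of_def)
  also have "\<dots> \<longleftrightarrow> (\<forall>v w. (B *v v) \<bullet> (B *v w) = gc c z v w)"
  proof
    assume L: "(?x, ?u) \<in> coframe_bundle A g"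
    show "\<forall>v w. (B *v v) \<bullet> (B *v w) = gc c z v w"
    proof (intro allI)
      fix v w
      have "?u (coord_vector A c ?x v) \<bullet> ?u (coord_vector A c ?x w) = gc c z v w"
        using L coord_vector_in[OF chart_at_inv] unfolding coframe_bundle_def gc_def by blast
      then show "(B *v v) \<bullet> (B *v w) = gc c z v w"
        by (simp add: coord_vector_in[OF chart_at_inv] coord_vector_same[OF chart_at_inv])
    qed
  next
    assume R: "\<forall>v w. (B *v v) \<bullet> (B *v w) = gc c z v w"
    have ts_add: "v + w \<in> tangent_space A ?x" if "v \<in> tangent_space A ?x" "w \<in> tangent_space A ?x" for v w
    proof -
      have "v + w = coord_vector A c ?x (v c + w c)"
        using that by (simp add: coord_vector_add[OF chart_at_inv] tangent_eq_coord[OF chart_at_inv])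
      then show ?thesis by (simp add: coord_vector_in[OF chart_at_inv])
    qed
    have ts_scale: "cscale a v \<in> tangent_space A ?x" if "v \<in> tangent_space A ?x" for v a
    proof -
      have "cscale a v = coord_vector A c ?x (a *s v c)"
        using that by (simp add: coord_vector_scale[OF chart_at_inv] tangent_eq_coord[OF chart_at_inv])
      then show ?thesis by (simp add: coord_vector_in[OF chart_at_inv])
    qed
    have lin: "linear ((*v) B)" by (rule linearI) (simp_all add: matrix_vector_right_distrib scaleR_eq_scale mult_vec_scale)
    have "inj ((*v) B)"
      unfolding linear_injective_0[OF lin]
    proof (intro allI impI)
      fix v assume "B *v v = 0"
      then have "gc c z v v = 0" using R by (metis inner_zero_left)
      then show "v = 0" using gc_bilinear(5)[of v] by force
    qed
    then have "surj ((*v) B)" using linear_injective_imp_surjective[OF lin] by simp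
    have "?u ` tangent_space A ?x = UNIV"
    proof -
      have "y \<in> ?u ` tangent_space A ?x" for y
      proof -
        obtain v where v: "y = B *v v" using \<open>surj ((*v) B)\<close> by (metis surjD)
        then have "y = ?u (coord_vector A c ?x v)"
          by (simp add: coord_vector_in[OF chart_at_inv] coord_vector_same[OF chart_at_inv])
        then show ?thesis using coord_vector_in[OF chart_at_inv] by blast
      qed
      then show ?thesis by blast
    qed
    moreover have "?u v \<bullet> ?u w = g ?x v w" if "v \<in> tangent_space A ?x" "w \<in> tangent_space A ?x" for v w
      using R[rule_format, of "v c" "w c"] that by (simp add: gc_def tangent_eq_coord[OF chart_at_inv])
    moreover have "?u (v + w) = ?u v + ?u w" if "v \<in> tangent_space A ?x" "w \<in> tangent_space A ?x" for v w
    proof -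
      have "?u (v + w) = B *v (v + w) c" using ts_add[OF that] by simp
      then show ?thesis using that by (simp add: plus_fun_def matrix_vector_right_distrib)
    qed
    moreover have "?u (cscale a v) = a *s ?u v" if "v \<in> tangent_space A ?x" for v a
    proof -
      have "?u (cscale a v) = B *v (cscale a v) c" using ts_scale[OF that] by simp
      then show ?thesis using that by (simp add: cscale_def mult_vec_scale)
    qed
    moreover have "?u \<in> extensional (tangent_space A ?x)" by simp
    ultimately show "(?x, ?u) \<in> coframe_bundle A g"
      unfolding coframe_bundle_def mem_Collect_eq prod.case by blast
  qed
  finally show ?thesis using adj by simp
qed

lemma Gm_psd: "psd (Gm c z)"
  unfolding psd_def
proof (intro conjI allI Gm(2))
  fix v show "0 \<le> v \<bullet> (Gm c z *v v)"
    using gc_bilinear(5)[of v] by (cases "v = 0") (auto simp: Re_herm[symmetric] Gm(1))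
qed

lemma bundle_chart_nonempty: "\<exists>B. (z, B) \<in> bundle_chart A g c"
  by (intro exI[of _ "psqrt (Gm c z)"]) (use psqrt[OF Gm_psd] in \<open>simp add: bundle_chart_iff psd_def\<close>)

lemma bundle_chart_invertible:
  assumes "(z, B) \<in> bundle_chart A g c"
  shows "det B \<noteq> 0"
proof
  assume "det B = 0"
  then have "\<not> (\<forall>v. B *v v = 0 \<longrightarrow> v = 0)"
    by (metis invertible_det_nz invertible_left_inverse matrix_left_invertible_ker)
  then obtain v where "v \<noteq> 0" "B *v v = 0" by blast
  moreover have "gc c z v v = Re (herm v (adjoint_matrix B *v (B *v v)))"
    using assms by (simp only: bundle_chart_iff Gm(1)[symmetric] matrix_vector_mul_assoc)
  ultimately show False using gc_bilinear(5)[of "v"] by simp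
qed

end

end

section \<open>Invariance along the fibers\<close>

text \<open>Polynomials are compared at non-real t: such a t is an eigenvalue of no Hermitian
  matrix, so one t serves along a whole path or chart.\<close>

lemma infinite_nonreal: "infinite {t::complex. t \<notin> \<real>}"
proof -
  have "inj (\<lambda>n::nat. \<i> * of_nat (Suc n))" by (auto simp: inj_def)
  then have "infinite (range (\<lambda>n::nat. \<i> * of_nat (Suc n)))" by (rule range_inj_infinite)
  moreover have "range (\<lambda>n::nat. \<i> * of_nat (Suc n)) \<subseteq> {t::complex. t \<notin> \<real>}"
    by (auto simp: complex_is_Real_iff)
  ultimately show ?thesis using finite_subset by blast
qed

lemma complex_linear_eq_matrix:
  fixes f :: "complex^'n \<Rightarrow> complex^'m"
  assumes add: "\<And>v w. f (v + w) = f v + f w" and scale: "\<And>k v. f (k *s v) = k *s f v"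
  shows "f v = (\<chi> i j. f (axis j 1) $ i) *v v"
proof -
  have f0: "f 0 = 0" using scale[of 0 0] by simp
  have sum: "f (\<Sum>j\<in>I. F j) = (\<Sum>j\<in>I. f (F j))" for I and F :: "'n \<Rightarrow> complex^'n"
    by (induction I rule: infinite_finite_induct) (simp_all add: f0 add)
  have "f v = f (\<Sum>j\<in>UNIV. v $ j *s axis j 1)" by (simp add: basis_expansion)
  also have "\<dots> = (\<Sum>j\<in>UNIV. v $ j *s f (axis j 1))" by (simp only: sum scale)
  also have "\<dots> = (\<chi> i j. f (axis j 1) $ i) *v v"
    by (simp add: vec_eq_iff matrix_vector_mult_def mult.commute)
  finally show ?thesis .
qed

lemma unitary_norm:
  assumes "adjoint_matrix a ** a = mat 1"
  shows "herm (a *v v) (a *v w) = herm v w"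
  using assms by (simp add: herm_mult_left matrix_vector_mul_assoc)

text \<open>After multiplication by a scalar of modulus \<open>1\<close>, the Cayley transform of a unitary matrix is
  defined and Hermitian.\<close>

lemma unitary_spectral:
  fixes a :: "complex^'n^'n::finite"
  assumes a: "adjoint_matrix a ** a = mat 1"
  obtains e and \<theta> :: "'n \<Rightarrow> real" where "onb e" "\<And>k. a *v e k = cis (\<theta> k) *s e k"
proof -
  have "det (char_matrix a) \<noteq> 0"
  proof
    assume "det (char_matrix a) = 0"
    then have z: "det (mat t - a) = 0" for t by (metis poly_0 poly_det_char_matrix)
    \<comment> \<open>A unitary matrix preserves norms, so 2 is not an eigenvalue. Hence the
      characteristic polynomial is nonzero and excludes only finitely many points of the unit
      circle.\<close>
    have "det (mat 2 - a) \<noteq> 0"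
    proof
      assume "det (mat 2 - a) = 0"
      then have "\<not> (\<forall>v. (mat 2 - a) *v v = 0 \<longrightarrow> v = 0)"
        by (metis invertible_det_nz invertible_left_inverse matrix_left_invertible_ker)
      then obtain v where v: "v \<noteq> 0" "(mat 2 - a) *v v = 0" by blast
      then have "a *v v = 2 *s v" by (simp add: matrix_vector_mult_diff_rdistrib)
      then have "herm (2 *s v) (2 *s v) = herm v v" using unitary_norm[OF a, of v v] by simp
      then show False using v(1) by (simp add: herm_self norm_scale_vec power_mult_distrib)
    qed
    with z show False by blast
  qed
  then have fin: "finite {t. poly (det (char_matrix a)) t = 0}" by (rule poly_roots_finite)
  have "infinite (cis ` {0..1})"
  proof
    assume "finite (cis ` {0..1})"
    moreover have "inj_on cis {0..1}"
    proof (rule inj_onI)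
      fix x y :: real assume xy: "x \<in> {0..1}" "y \<in> {0..1}" "cis x = cis y"
      have "cos x = cos y" using arg_cong[OF xy(3), of Re] by simp
      moreover have "0 \<le> x" "x \<le> pi" "0 \<le> y" "y \<le> pi" using xy pi_gt3 by auto
      ultimately show "x = y" using cos_inj_pi[of x y] by blast
    qed
    ultimately have "finite {0..1::real}" by (rule finite_imageD)
    then show False by (simp add: infinite_Icc)
  qed
  then have "\<not> cis ` {0..1} \<subseteq> {t. poly (det (char_matrix a)) t = 0}"
    using fin finite_subset by blast
  then obtain r where r: "poly (det (char_matrix a)) (cis r) \<noteq> 0" by blast
  define s where "s = cis r"
  have s: "det (mat s - a) \<noteq> 0" "cmod s = 1"
    using r by (simp_all add: s_def poly_det_char_matrix)
  define P where "P = mat s - a"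
  define Q where "Q = mat s + a"
  define K where "K = mscale \<i> (Q ** Inv P)"
  have ss: "cnj s * s = 1" using s(2) by (simp add: complex_norm_square[symmetric] mult.commute)
  have Pv: "P *v v = s *s v - a *v v" and Qv: "Q *v v = s *s v + a *v v" for v
    by (simp_all add: P_def Q_def matrix_vector_mult_diff_rdistrib matrix_vector_mult_add_rdistrib)
  have K: "K *v (P *v v) = \<i> *s (Q *v v)" for v
    using s(1) by (simp add: K_def mscale_mult_vec matrix_vector_mul_assoc[symmetric] Inv_mult_vec P_def)
  have "herm (P *v p) (K *v (P *v q)) = herm (K *v (P *v p)) (P *v q)" for p q
  proof -
    have "cnj s * (s * x) = x" for x by (simp add: mult.assoc[symmetric] ss)
    then show ?thesis
      unfolding K unfolding Pv Qv by (simp add: herm_linear unitary_norm[OF a] algebra_simps)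
  qed
  moreover have "P *v (Inv P *v v) = v" for v using s(1) by (simp add: Inv_mult_vec P_def)
  ultimately have "herm v (K *v w) = herm (K *v v) w" for v w
    by (metis (no_types))
  then have "adjoint_matrix K = K"
    by (intro herm_Re_unique) (simp add: herm_mult_left[symmetric])
  then obtain e l where e: "onb e" "\<And>k. K *v e k = complex_of_real (l k) *s e k"
    using hermitian_spectral by blast
  have "\<exists>\<theta>. a *v e k = cis \<theta> *s e k" for k
  proof -
    define y where "y = Inv P *v e k"
    have ey: "e k = P *v y" using s(1) by (simp add: y_def Inv_mult_vec P_def)
    have "\<i> *s (Q *v y) = complex_of_real (l k) *s (P *v y)" using e(2)[of k] K[of y] ey by simp
    then have 1: "(\<i> + complex_of_real (l k)) *s (a *v y) = (complex_of_real (l k) * s - \<i> * s) *s y"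
      unfolding Pv Qv by (simp add: vec_eq_iff algebra_simps)
    have nz: "\<i> + complex_of_real (l k) \<noteq> 0" by (simp add: complex_eq_iff)
    define \<beta> where "\<beta> = (complex_of_real (l k) * s - \<i> * s) / (\<i> + complex_of_real (l k))"
    have ay: "a *v y = \<beta> *s y"
    proof -
      have "(\<i> + complex_of_real (l k)) * (a *v y) $ i = (\<i> + complex_of_real (l k)) * (\<beta> * y $ i)" for i
      proof -
        have "(\<i> + complex_of_real (l k)) * \<beta> = complex_of_real (l k) * s - \<i> * s"
          using nz by (simp add: \<beta>_def)
        then show ?thesis
          using arg_cong[OF 1, of "\<lambda>x. x $ i"] by (simp only: mult.assoc[symmetric] vector_smult_component)
      qed
      then show ?thesis using nz by (simp add: vec_eq_iff)
    qed
    have ae: "a *v e k = \<beta> *s e k"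
      unfolding ey Pv by (simp add: matrix_vector_mult_diff_distrib mult_vec_scale ay)
    have "herm (a *v e k) (a *v e k) = herm (e k) (e k)" by (rule unitary_norm[OF a])
    then have "\<beta> * cnj \<beta> = 1"
      using e(1) by (simp add: ae herm_scale_left herm_scale_right onb_def)
    then have "(cmod \<beta>)\<^sup>2 = 1"
      using complex_norm_square[of \<beta>] by (simp add: mult.commute flip: of_real_power)
    then have "cmod \<beta> = 1" by (simp add: power2_eq_1_iff) (use norm_ge_zero[of \<beta>] in linarith)
    then have "\<beta> = cis (Arg \<beta>)" using rcis_cmod_Arg[of \<beta>] by (simp add: rcis_def)
    with ae show ?thesis by auto
  qed
  then have "\<forall>k. \<exists>\<theta>. a *v e k = cis \<theta> *s e k" by blast
  then obtain \<theta> where "\<And>k. a *v e k = cis (\<theta> k) *s e k" using choice[of "\<lambda>k \<theta>. a *v e k = cis \<theta> *s e k"] by blast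
  with e(1) show ?thesis by (rule that)
qed

text \<open>In a fixed eigenbasis the eigenvalues \<open>cis (\<theta> k)\<close> are moved along
  the circle from 1. This joins any two coframes over the same point.\<close>

lemma unitary_path:
  fixes a :: "complex^'n^'n::finite"
  assumes a: "adjoint_matrix a ** a = mat 1"
  obtains p :: "real \<Rightarrow> complex^'n^'n" where "p 0 = mat 1" "p 1 = a"
    "\<And>s. adjoint_matrix (p s) ** p s = mat 1" "\<And>s. p differentiable (at s)"
proof -
  obtain e and \<theta> :: "'n \<Rightarrow> real" where e: "onb e" "\<And>k. a *v e k = cis (\<theta> k) *s e k"
    using unitary_spectral[OF a] by blast
  define p where "p s = (\<Sum>k\<in>UNIV. mscale (cis (s * \<theta> k)) (outer (e k) (e k)))" for s
  have sum_mult: "(\<Sum>i\<in>I. f i) *v v = (\<Sum>i\<in>I. f i *v v)" for f :: "'n \<Rightarrow> complex^'n^'n" and I v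
    by (induction I rule: infinite_finite_induct) (simp_all add: matrix_vector_mult_add_rdistrib)
  have pv: "p s *v v = (\<Sum>k\<in>UNIV. (cis (s * \<theta> k) * herm (e k) v) *s e k)" for s v
    by (simp add: p_def sum_mult mscale_mult_vec outer_mult_vec)
  have ep: "herm (e k) (p s *v v) = cis (s * \<theta> k) * herm (e k) v" for k s v
    using e(1) by (simp add: pv herm_sum_right herm_scale_right onb_def if_distrib[of "\<lambda>x. _ * x"] cong: if_cong)
  have "p 0 *v v = mat 1 *v v" for v
    using onb_expand[OF e(1), of v] by (simp add: pv)
  then have "p 0 = mat 1" by (simp add: matrix_eq)
  moreover have "p 1 *v v = a *v v" for v
  proof -
    have "a *v v = a *v (\<Sum>k\<in>UNIV. herm (e k) v *s e k)" using onb_expand[OF e(1), of v] by simp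
    also have "\<dots> = p 1 *v v"
      by (simp add: pv mult_vec_sum mult_vec_scale e(2) mult.commute)
    finally show ?thesis by simp
  qed
  then have "p 1 = a" by (simp add: matrix_eq)
  moreover have "adjoint_matrix (p s) ** p s = mat 1" for s
  proof (rule herm_Re_unique)
    fix v w
    have c: "cnj (cis x) * cis x = 1" for x by (simp add: cis_cnj cis_mult)
    have "herm v ((adjoint_matrix (p s) ** p s) *v w) = herm (p s *v v) (p s *v w)"
      by (simp add: herm_mult_left matrix_vector_mul_assoc)
    also have "\<dots> = (\<Sum>k\<in>UNIV. (cnj (cis (s * \<theta> k)) * cis (s * \<theta> k)) * (cnj (herm (e k) v) * herm (e k) w))"
      unfolding onb_parseval[OF e(1), of "p s *v v"] ep by (simp add: mult_ac)
    also have "\<dots> = herm v w" unfolding c by (simp add: onb_parseval[OF e(1), of v])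
    finally show "Re (herm v ((adjoint_matrix (p s) ** p s) *v w)) = Re (herm v (mat 1 *v w))" by simp
  qed
  moreover have "p differentiable (at s)" for s
  proof -
    have "((\<lambda>s. exp (\<i> * complex_of_real (s * x))) has_vector_derivative (\<i> * x * exp (\<i> * complex_of_real (s * x)))) (at s)" for x
      by (auto intro!: derivative_eq_intros has_vector_derivative_real_field)
    then have d: "\<exists>D. ((\<lambda>s. cis (s * x)) has_derivative D) (at s)" for x
      unfolding has_vector_derivative_def cis_conv_exp by blast
    then obtain D where D: "\<And>x. ((\<lambda>s. cis (s * x)) has_derivative D x) (at s)" by metis
    have "(p has_derivative (\<lambda>h. \<Sum>k\<in>UNIV. \<chi> i j. D (\<theta> k) h * outer (e k) (e k) $ i $ j)) (at s)"
      unfolding p_def mscale_def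
      by (intro has_derivative_sum has_derivative_vec_componentwise, unfold vec_lambda_beta)
        (intro has_derivative_mult_left D)
    then show ?thesis by (rule differentiableI)
  qed
  ultimately show ?thesis by (rule that)
qed

text \<open>\<open>tangent_vectors\<close> asks for a curve that stays in P at all times, so
  \<open>\<sigma> (z + t v)\<close> is replaced by a constant wherever the argument leaves
  U.\<close>

lemma tangent_vector_curve:
  fixes \<sigma> :: "'e::real_normed_vector \<Rightarrow> 'b::real_normed_vector"
  assumes U: "open U" "z \<in> U" "\<sigma> ` U \<subseteq> P" and D: "(\<sigma> has_derivative D) (at z)"
  shows "D v \<in> tangent_vectors P (\<sigma> z)"
proof -
  define \<gamma> where "\<gamma> t = (if z + t *\<^sub>R v \<in> U then \<sigma> (z + t *\<^sub>R v) else \<sigma> z)" for t :: real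
  have lin: "((\<lambda>t. z + t *\<^sub>R v) has_derivative (\<lambda>t. t *\<^sub>R v)) (at 0)"
    by (auto intro!: derivative_eq_intros)
  have "((\<lambda>t. \<sigma> (z + t *\<^sub>R v)) has_derivative (\<lambda>t. D (t *\<^sub>R v))) (at 0)"
    by (rule has_derivative_compose[OF lin]) (simp add: D)
  then have 1: "((\<lambda>t. \<sigma> (z + t *\<^sub>R v)) has_vector_derivative D v) (at 0)"
    using has_derivative_linear[OF D] by (simp add: has_vector_derivative_def linear_scale)
  have "isCont (\<lambda>t. z + t *\<^sub>R v) 0" by (intro continuous_intros)
  then have "\<forall>\<^sub>F t in at 0. z + t *\<^sub>R v \<in> U"
    using U by (intro topological_tendstoD[of _ z]) (auto simp: isCont_def)
  then have "\<forall>\<^sub>F t in at 0. \<sigma> (z + t *\<^sub>R v) = \<gamma> t"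
    by eventually_elim (simp add: \<gamma>_def)
  then have "(\<gamma> has_vector_derivative D v) (at 0)"
    using has_derivative_transform_eventually[OF 1[unfolded has_vector_derivative_def]] U(2)
    by (simp add: has_vector_derivative_def \<gamma>_def)
  moreover have "\<gamma> 0 = \<sigma> z" "\<forall>t. \<gamma> t \<in> P" using U by (auto simp: \<gamma>_def)
  ultimately show ?thesis by (auto simp: tangent_vectors_def)
qed

text \<open>The differential within P is prescribed on tangent vectors only, and the derivative of
  \<open>\<sigma>\<close> takes its values there.\<close>

lemma has_differential_on_pullback:
  fixes \<sigma> :: "'e::real_normed_vector \<Rightarrow> 'b::real_normed_vector"
  assumes f: "has_differential_on f \<alpha> P"
    and U: "open U" "z \<in> U" "\<sigma> ` U \<subseteq> P" and D: "(\<sigma> has_derivative D) (at z)"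
  shows "((\<lambda>u. f (\<sigma> u)) has_derivative (\<lambda>v. \<alpha> (\<sigma> z) (D v))) (at z)"
proof -
  have "\<sigma> z \<in> P" using U by auto
  with f obtain Df where Df: "(f has_derivative Df) (at (\<sigma> z) within P)"
    "\<And>v. v \<in> tangent_vectors P (\<sigma> z) \<Longrightarrow> Df v = \<alpha> (\<sigma> z) v"
    unfolding has_differential_on_def by blast
  have "(f has_derivative Df) (at (\<sigma> z) within (\<sigma> ` U))"
    using Df(1) U(3) by (rule has_derivative_subset)
  with has_derivative_at_withinI[OF D, of U]
  have "((\<lambda>u. f (\<sigma> u)) has_derivative (\<lambda>v. Df (D v))) (at z within U)"
    by (rule has_derivative_in_compose)
  then have "((\<lambda>u. f (\<sigma> u)) has_derivative (\<lambda>v. Df (D v))) (at z)"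
    unfolding at_within_open[OF U(2,1)] .
  moreover have "(\<lambda>v. Df (D v)) = (\<lambda>v. \<alpha> (\<sigma> z) (D v))"
    by (intro ext Df(2) tangent_vector_curve[OF U D])
  ultimately show ?thesis by (simp only:)
qed

section \<open>Local sections of the coframe bundle\<close>

context kaehler
begin

text \<open>The components of the coframe on the coordinate vectors form B; coframes are
  extensional, so agreement on the tangent space is equality.\<close>

lemma coframe_in_chart:
  assumes "(x, u) \<in> coframe_bundle A g" "c \<in> charts_at A x"
  shows "\<exists>B. (snd c x, B) \<in> bundle_chart A g c \<and> coframe_of A c (snd c x, B) = (x, u)"
proof -
  have c: "c \<in> A" "x \<in> fst c" using assms(2) by (auto simp: charts_at_iff)
  define f where "f w = u (coord_vector A c x w)" for w
  have u: "u \<in> extensional (tangent_space A x)"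
    "\<And>v w. v \<in> tangent_space A x \<Longrightarrow> w \<in> tangent_space A x \<Longrightarrow> u (v + w) = u v + u w"
    "\<And>v a. v \<in> tangent_space A x \<Longrightarrow> u (cscale a v) = a *s u v"
    using assms(1) unfolding coframe_bundle_def by blast+
  have f_add: "f (v + w) = f v + f w" for v w
    by (simp add: f_def coord_vector_add[OF assms(2)] u(2) coord_vector_in[OF assms(2)])
  have f_scale: "f (k *s v) = k *s f v" for k v
    by (simp add: f_def coord_vector_scale[OF assms(2)] u(3) coord_vector_in[OF assms(2)])
  define B where "B = (\<chi> i j. f (axis j 1) $ i)"
  have fB: "f v = B *v v" for v
    unfolding B_def by (rule complex_linear_eq_matrix[OF f_add f_scale])
  have "u v = B *v v c" if "v \<in> tangent_space A x" for v
    using tangent_eq_coord[OF assms(2) that] by (simp add: fB[symmetric] f_def)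
  then have "(\<lambda>v\<in>tangent_space A x. B *v v c) = u"
    using u(1) by (intro ext) (auto simp: restrict_def extensional_def)
  then have eq: "coframe_of A c (snd c x, B) = (x, u)"
    by (simp add: coframe_of_def chart(8)[OF c])
  moreover have "(snd c x, B) \<in> bundle_chart A g c"
    using assms(1) by (simp add: bundle_chart_def eq chart(7)[OF c])
  ultimately show ?thesis by blast
qed

lemma some_coframe: "some_coframe A g x \<in> coframe_bundle A g" "fst (some_coframe A g x) = x"
proof -
  obtain c where c: "c \<in> A" "x \<in> fst c" using charts_at_nonempty[of x] by (auto simp: charts_at_iff)
  obtain B where "(snd c x, B) \<in> bundle_chart A g c"
    using bundle_chart_nonempty[OF c(1) chart(7)[OF c]] by blast
  then have "coframe_of A c (snd c x, B) \<in> coframe_bundle A g \<and> fst (coframe_of A c (snd c x, B)) = x"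
    by (simp add: bundle_chart_def coframe_of_def chart(8)[OF c])
  then have "some_coframe A g x \<in> coframe_bundle A g \<and> fst (some_coframe A g x) = x"
    unfolding some_coframe_def by (rule someI)
  then show "some_coframe A g x \<in> coframe_bundle A g" "fst (some_coframe A g x) = x" by auto
qed

lemma Gm_differentiable:
  assumes "c \<in> A" "z \<in> chart_image c"
  shows "Gm c differentiable (at z)"
proof -
  have "real_analytic_on (\<lambda>z. gc c z a b) (chart_image c)" for a b
    using analytic assms(1) unfolding analytic_metric_def gc_def Let_def by blast
  then have "(\<lambda>z. gc c z a b) differentiable (at z)" for a b
    using assms(2) by (rule real_analytic_on_differentiable)
  then obtain D where D: "\<And>a b. ((\<lambda>z. gc c z a b) has_derivative D a b) (at z)"
    unfolding differentiable_def by metis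
  have "((\<lambda>z. Gm c z) has_derivative
    (\<lambda>h. \<chi> i j. complex_of_real (D (axis i 1) (axis j 1) h) + \<i> * complex_of_real (D (\<i> *s axis i 1) (axis j 1) h))) (at z)"
    unfolding Gm_def Complex_eq
    by (intro has_derivative_vec_componentwise, unfold vec_lambda_beta)
      (intro has_derivative_add has_derivative_mult_right has_derivative_of_real D)
  then show ?thesis by (rule differentiableI)
qed

text \<open>A section through \<open>(z0, B0)\<close>: the condition on the Gram matrix is solved by
  \<open>S ** B0\<close>, with S the positive root of the metric expressed in the coframe B0. That
  matrix is the identity at z0, where the derivative of the root is known.\<close>

definition local_frame :: "('a, 'n) chart \<Rightarrow> complex^'n^'n \<Rightarrow> complex^'n \<Rightarrow> (complex^'n) \<times> (complex^'n^'n)" where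
  "local_frame c B0 z = (z, psqrt (adjoint_matrix (Inv B0) ** Gm c z ** Inv B0) ** B0)"

context
  fixes c z0 B0
  assumes c: "c \<in> A" and z0: "z0 \<in> chart_image c" and B0: "(z0, B0) \<in> bundle_chart A g c"
begin

lemma det_B0: "det B0 \<noteq> 0"
  using bundle_chart_invertible[OF c z0 B0] .

lemma local_frame_psd:
  assumes "z \<in> chart_image c"
  shows "psd (adjoint_matrix (Inv B0) ** Gm c z ** Inv B0)"
  unfolding psd_def
proof (intro conjI allI)
  show "adjoint_matrix (adjoint_matrix (Inv B0) ** Gm c z ** Inv B0) = adjoint_matrix (Inv B0) ** Gm c z ** Inv B0"
    by (simp add: adjoint_matrix_mult Gm(2)[OF c assms] matrix_mul_assoc)
  fix v
  have "v \<bullet> ((adjoint_matrix (Inv B0) ** Gm c z ** Inv B0) *v v) = (Inv B0 *v v) \<bullet> (Gm c z *v (Inv B0 *v v))"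
    by (simp add: Re_herm[symmetric] herm_mult_left matrix_vector_mul_assoc matrix_mul_assoc)
  then show "0 \<le> v \<bullet> ((adjoint_matrix (Inv B0) ** Gm c z ** Inv B0) *v v)"
    using Gm_psd[OF c assms] by (simp add: psd_def)
qed

lemma local_frame_in:
  assumes "z \<in> chart_image c"
  shows "local_frame c B0 z \<in> bundle_chart A g c"
proof -
  let ?K = "adjoint_matrix (Inv B0) ** Gm c z ** Inv B0"
  have adj: "adjoint_matrix B0 ** adjoint_matrix (Inv B0) = mat 1"
    by (simp add: adjoint_matrix_mult[symmetric] Inv_mult det_B0)
  have "adjoint_matrix (psqrt ?K ** B0) ** (psqrt ?K ** B0)
      = adjoint_matrix B0 ** (psqrt ?K ** psqrt ?K) ** B0"
    using psqrt(1)[OF local_frame_psd[OF assms]] by (simp add: psd_def adjoint_matrix_mult matrix_mul_assoc)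
  also have "\<dots> = (adjoint_matrix B0 ** adjoint_matrix (Inv B0)) ** Gm c z ** (Inv B0 ** B0)"
    unfolding psqrt(2)[OF local_frame_psd[OF assms]] by (simp only: matrix_mul_assoc)
  finally show ?thesis
    by (simp add: local_frame_def bundle_chart_iff[OF c assms] adj Inv_mult det_B0)
qed

lemma local_frame_K0: "adjoint_matrix (Inv B0) ** Gm c z0 ** Inv B0 = mat 1"
proof -
  have "Gm c z0 = adjoint_matrix B0 ** B0" using B0 by (simp add: bundle_chart_iff[OF c z0])
  then have "adjoint_matrix (Inv B0) ** Gm c z0 ** Inv B0
      = adjoint_matrix (B0 ** Inv B0) ** (B0 ** Inv B0)"
    by (simp add: adjoint_matrix_mult matrix_mul_assoc)
  then show ?thesis by (simp add: Inv_mult det_B0)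
qed

lemma local_frame_at: "local_frame c B0 z0 = (z0, B0)"
  unfolding local_frame_def local_frame_K0 by (simp add: psqrt_id)

text \<open>Of the derivative D only the base component is recorded, because the tautological form
  depends on nothing else.\<close>

lemma local_frame_derivative: "\<exists>D. (local_frame c B0 has_derivative D) (at z0) \<and> (\<forall>h. fst (D h) = h)"
proof -
  obtain G' where G': "(Gm c has_derivative G') (at z0)"
    using Gm_differentiable[OF c z0] by (auto simp: differentiable_def)
  have "((\<lambda>z. adjoint_matrix (Inv B0) ** Gm c z ** Inv B0) has_derivative
     (\<lambda>h. adjoint_matrix (Inv B0) ** G' h ** Inv B0)) (at z0)"
    by (intro bounded_linear.has_derivative[OF bounded_bilinear.bounded_linear_left[OF bounded_bilinear_matrix_mult]]
        bounded_linear.has_derivative[OF bounded_bilinear.bounded_linear_right[OF bounded_bilinear_matrix_mult]] G')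
  moreover have "\<forall>\<^sub>F z in at z0. psd (adjoint_matrix (Inv B0) ** Gm c z ** Inv B0)"
    using eventually_at_in_open'[OF chart(2)[OF c] z0] by eventually_elim (rule local_frame_psd)
  ultimately have "((\<lambda>z. psqrt (adjoint_matrix (Inv B0) ** Gm c z ** Inv B0)) has_derivative
     (\<lambda>h. (1/2) *\<^sub>R (adjoint_matrix (Inv B0) ** G' h ** Inv B0))) (at z0)"
    using local_frame_K0 by (intro has_derivative_psqrt_id) auto
  then have "(local_frame c B0 has_derivative
     (\<lambda>h. (h, ((1/2) *\<^sub>R (adjoint_matrix (Inv B0) ** G' h ** Inv B0)) ** B0))) (at z0)"
    unfolding local_frame_def
    by (intro has_derivative_Pair has_derivative_ident
        bounded_linear.has_derivative[OF bounded_bilinear.bounded_linear_left[OF bounded_bilinear_matrix_mult]])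
  then show ?thesis by (intro exI conjI) auto
qed

end

end

section \<open>The structure functions along sections and along fibers\<close>

locale bochner_kaehler_manifold = kaehler A g
  for A :: "('a::{t2_space,second_countable_topology}, 'n::finite) chart set" and g :: "('a, 'n) metric" +
  fixes H :: "('a, 'n) coframe \<Rightarrow> complex^'n^'n" and T :: "('a, 'n) coframe \<Rightarrow> complex^'n"
    and V :: "('a, 'n) coframe \<Rightarrow> real"
  assumes bk: "bochner_kaehler A g H T V"
begin

lemma H_adjoint: "u \<in> coframe_bundle A g \<Longrightarrow> adjoint_matrix (H u) = H u"
  using bk by (simp add: bochner_kaehler_def)

text \<open>The last form is the pullback of the tautological form: it is \<open>B h\<close> for a
  section through B, and 0 for a path inside a fiber.\<close>

lemma structure_pullback:
  fixes \<sigma> :: "'e::real_normed_vector \<Rightarrow> _"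
  assumes c: "c \<in> A" and U: "open U" "z \<in> U" "\<sigma> ` U \<subseteq> bundle_chart A g c"
    and D: "(\<sigma> has_derivative D) (at z)"
  obtains \<phi> where "structure_eqs (\<lambda>u. H (coframe_of A c (\<sigma> u))) (\<lambda>u. T (coframe_of A c (\<sigma> u)))
    (\<lambda>u. complex_of_real (V (coframe_of A c (\<sigma> u)))) \<phi> (\<lambda>h. snd (\<sigma> z) *v fst (D h)) z"
proof -
  obtain \<phi> where \<phi>: "connection_form A g c \<phi>"
    and dH: "has_differential_on (\<lambda>p. H (coframe_of A c p))
          (\<lambda>p v. structure_deriv_H (H (coframe_of A c p)) (T (coframe_of A c p)) (\<phi> p v) (taut_form p v))
          (bundle_chart A g c)"
    and dT: "has_differential_on (\<lambda>p. T (coframe_of A c p))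
          (\<lambda>p v. structure_deriv_T (H (coframe_of A c p)) (T (coframe_of A c p))
             (complex_of_real (V (coframe_of A c p))) (\<phi> p v) (taut_form p v)) (bundle_chart A g c)"
    and dV: "has_differential_on (\<lambda>p. complex_of_real (V (coframe_of A c p)))
          (\<lambda>p v. structure_deriv_V (H (coframe_of A c p)) (T (coframe_of A c p)) (taut_form p v))
          (bundle_chart A g c)"
    using bk[unfolded bochner_kaehler_def Let_def comp_def, THEN conjunct2, THEN bspec, OF c]
    by (elim exE conjE)
      (rule that, assumption, (unfold structure_deriv_H_def structure_deriv_T_def structure_deriv_V_def, assumption)+)
  have in_P: "\<sigma> z \<in> bundle_chart A g c" using U by auto
  have "adjoint_matrix (\<phi> (\<sigma> z) (D h)) = - \<phi> (\<sigma> z) (D h)" for h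
    using \<phi> in_P tangent_vector_curve[OF U D] unfolding connection_form_def by blast
  moreover have "coframe_of A c (\<sigma> z) \<in> coframe_bundle A g" using in_P by (simp add: bundle_chart_def)
  ultimately have "structure_eqs (\<lambda>u. H (coframe_of A c (\<sigma> u))) (\<lambda>u. T (coframe_of A c (\<sigma> u)))
    (\<lambda>u. complex_of_real (V (coframe_of A c (\<sigma> u)))) (\<lambda>h. \<phi> (\<sigma> z) (D h)) (\<lambda>h. snd (\<sigma> z) *v fst (D h)) z"
    using has_differential_on_pullback[OF dH U D] has_differential_on_pullback[OF dT U D]
      has_differential_on_pullback[OF dV U D] H_adjoint
    by unfold_locales (simp_all add: taut_form_def)
  then show ?thesis by (rule that)
qed

definition char_p :: "('a, 'n) coframe \<Rightarrow> complex poly" where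
  "char_p u = det (char_matrix (H u))"

definition C_p :: "('a, 'n) coframe \<Rightarrow> complex poly" where
  "C_p u = C_complex (H u) (T u) (V u)"

lemma nonreal_shift:
  assumes "u \<in> coframe_bundle A g" "t \<notin> \<real>"
  shows "det (mat t - H u) \<noteq> 0" "det (mat (cnj t) - H u) \<noteq> 0"
  using det_shift_nonzero[OF H_adjoint[OF assms(1)]] assms(2) by (auto simp: Reals_cnj_iff)

lemma has_derivative_C_p:
  fixes \<sigma> :: "'e::real_normed_vector \<Rightarrow> _"
  assumes c: "c \<in> A" and U: "open U" "z \<in> U" "\<sigma> ` U \<subseteq> bundle_chart A g c"
    and D: "(\<sigma> has_derivative D) (at z)" and t: "t \<notin> \<real>"
  shows "((\<lambda>u. poly (C_p (coframe_of A c (\<sigma> u))) t) has_derivative (\<lambda>h. 0)) (at z)"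
proof -
  obtain \<phi> where \<phi>: "structure_eqs (\<lambda>u. H (coframe_of A c (\<sigma> u))) (\<lambda>u. T (coframe_of A c (\<sigma> u)))
    (\<lambda>u. complex_of_real (V (coframe_of A c (\<sigma> u)))) \<phi> (\<lambda>h. snd (\<sigma> z) *v fst (D h)) z"
    by (rule structure_pullback[OF c U D])
  have "coframe_of A c (\<sigma> z) \<in> coframe_bundle A g"
    using U by (auto simp: bundle_chart_def)
  from structure_eqs.has_derivative_C_structure[OF \<phi> nonreal_shift[OF this t]] show ?thesis
    unfolding C_p_def poly_C_complex .
qed

text \<open>\<open>H\<close>, \<open>T\<close> and \<open>V\<close> are not assumed to be equivariant: invariance along the fibers comes from
  integrating the structure equations along paths in the unitary group.\<close>

lemma fiber_path_invariance:
  assumes c: "c \<in> A" and z: "z \<in> chart_image c"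
    and B: "(z, B) \<in> bundle_chart A g c" "(z, B') \<in> bundle_chart A g c"
  shows "char_p (coframe_of A c (z, B)) = char_p (coframe_of A c (z, B'))"
    "C_p (coframe_of A c (z, B)) = C_p (coframe_of A c (z, B'))"
proof -
  have det: "det B \<noteq> 0" using bundle_chart_invertible[OF c z B(1)] .
  have BB: "adjoint_matrix B ** B = Gm c z" "adjoint_matrix B' ** B' = Gm c z"
    using B by (simp_all add: bundle_chart_iff[OF c z])
  \<comment> \<open>Both frames have the Gram matrix \<open>Gm c z\<close>, so the factor
    \<open>B' ** Inv B\<close> is unitary and can be joined to the identity.\<close>
  have B': "B' = (B' ** Inv B) ** B" by (simp add: matrix_mul_assoc[symmetric] Inv_mult det)
  have "adjoint_matrix (B' ** Inv B) ** (B' ** Inv B) = adjoint_matrix (Inv B) ** (adjoint_matrix B' ** B') ** Inv B"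
    by (simp add: adjoint_matrix_mult matrix_mul_assoc)
  also have "\<dots> = adjoint_matrix (B ** Inv B) ** (B ** Inv B)"
    by (simp add: BB(2) BB(1)[symmetric] adjoint_matrix_mult matrix_mul_assoc)
  finally have "adjoint_matrix (B' ** Inv B) ** (B' ** Inv B) = mat 1" by (simp add: Inv_mult det)
  then obtain p where p: "p 0 = mat 1" "p 1 = B' ** Inv B"
    "\<And>s. adjoint_matrix (p s) ** p s = mat 1" "\<And>s::real. p differentiable (at s)"
    using unitary_path by blast
  define \<sigma> where "\<sigma> s = (z, p s ** B)" for s
  have \<sigma>_in: "\<sigma> s \<in> bundle_chart A g c" for s
  proof -
    have "adjoint_matrix (p s ** B) ** (p s ** B) = adjoint_matrix B ** (adjoint_matrix (p s) ** p s) ** B"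
      by (simp add: adjoint_matrix_mult matrix_mul_assoc)
    then show ?thesis by (simp add: \<sigma>_def bundle_chart_iff[OF c z] p(3) BB)
  qed
  then have img: "\<sigma> ` UNIV \<subseteq> bundle_chart A g c" by blast
  have ends: "\<sigma> 0 = (z, B)" "\<sigma> 1 = (z, B')" using B' by (simp_all add: \<sigma>_def p)
  \<comment> \<open>The path leaves the base point fixed, so \<open>\<omega>\<close> pulls back to
    0, and with it the derivative of the determinant vanishes.\<close>
  have \<sigma>_D: "\<exists>D. (\<sigma> has_derivative D) (at s) \<and> (\<forall>h. fst (D h) = 0)" for s
  proof -
    obtain p' where "(p has_derivative p') (at s)" using p(4)[of s] by (auto simp: differentiable_def)
    then have "(\<sigma> has_derivative (\<lambda>h. (0, p' h ** B))) (at s)"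
      unfolding \<sigma>_def
      by (intro has_derivative_Pair has_derivative_const
        bounded_linear.has_derivative[OF bounded_bilinear.bounded_linear_left[OF bounded_bilinear_matrix_mult]])
    then show ?thesis by (intro exI conjI) auto
  qed
  have cb: "coframe_of A c (\<sigma> s) \<in> coframe_bundle A g" for s
    using \<sigma>_in[of s] by (simp add: bundle_chart_def)
  have const: "f 0 = f 1" if d: "\<And>s. (f has_derivative (\<lambda>h. 0)) (at s)" for f :: "real \<Rightarrow> complex"
  proof -
    have "\<exists>k. \<forall>s\<in>UNIV. f s = k"
      using convex_UNIV d by (rule has_derivative_zero_constant)
    then show ?thesis by auto
  qed
  show "char_p (coframe_of A c (z, B)) = char_p (coframe_of A c (z, B'))"
  proof (rule poly_eq_infinite[OF infinite_nonreal])
    fix t :: complex assume "t \<in> {t. t \<notin> \<real>}"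
    then have t: "t \<notin> \<real>" by simp
    have "((\<lambda>s. poly (char_p (coframe_of A c (\<sigma> s))) t) has_derivative (\<lambda>h. 0)) (at s)" for s
    proof -
      obtain D where D: "(\<sigma> has_derivative D) (at s)" "\<And>h. fst (D h) = 0" using \<sigma>_D by blast
      obtain \<phi> where \<phi>: "structure_eqs (\<lambda>u. H (coframe_of A c (\<sigma> u))) (\<lambda>u. T (coframe_of A c (\<sigma> u)))
        (\<lambda>u. complex_of_real (V (coframe_of A c (\<sigma> u)))) \<phi> (\<lambda>h. snd (\<sigma> s) *v fst (D h)) s"
        by (rule structure_pullback[OF c open_UNIV UNIV_I img D(1)])
      show ?thesis
        using structure_eqs.has_derivative_det_structure[OF \<phi> nonreal_shift[OF cb t]]
        by (simp add: char_p_def poly_det_char_matrix D(2))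
    qed
    then show "poly (char_p (coframe_of A c (z, B))) t = poly (char_p (coframe_of A c (z, B'))) t"
      using const[of "\<lambda>s. poly (char_p (coframe_of A c (\<sigma> s))) t"] by (simp add: ends)
  qed
  show "C_p (coframe_of A c (z, B)) = C_p (coframe_of A c (z, B'))"
  proof (rule poly_eq_infinite[OF infinite_nonreal])
    fix t :: complex assume "t \<in> {t. t \<notin> \<real>}"
    then have t: "t \<notin> \<real>" by simp
    have "((\<lambda>s. poly (C_p (coframe_of A c (\<sigma> s))) t) has_derivative (\<lambda>h. 0)) (at s)" for s
    proof -
      obtain D where D: "(\<sigma> has_derivative D) (at s)" using \<sigma>_D by blast
      show ?thesis by (rule has_derivative_C_p[OF c open_UNIV UNIV_I img D t])
    qed
    then show "poly (C_p (coframe_of A c (z, B))) t = poly (C_p (coframe_of A c (z, B'))) t"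
      using const[of "\<lambda>s. poly (C_p (coframe_of A c (\<sigma> s))) t"] by (simp add: ends)
  qed
qed

lemma fiber_invariance:
  assumes "u \<in> coframe_bundle A g" "u' \<in> coframe_bundle A g" "fst u = fst u'"
  shows "char_p u = char_p u'" "C_p u = C_p u'"
proof -
  define x where "x = fst u"
  obtain c where c: "c \<in> charts_at A x" using charts_at_nonempty by blast
  then have cA: "c \<in> A" "x \<in> fst c" by (auto simp: charts_at_iff)
  have u: "(x, snd u) \<in> coframe_bundle A g" "(x, snd u') \<in> coframe_bundle A g"
      "u = (x, snd u)" "u' = (x, snd u')"
    using assms(1,2) by (simp_all add: x_def) (simp_all add: assms(3))
  obtain B where B: "(snd c x, B) \<in> bundle_chart A g c" "coframe_of A c (snd c x, B) = u"
    using coframe_in_chart[OF u(1) c] u(3) by auto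
  obtain B' where B': "(snd c x, B') \<in> bundle_chart A g c" "coframe_of A c (snd c x, B') = u'"
    using coframe_in_chart[OF u(2) c] u(4) by auto
  show "char_p u = char_p u'" "C_p u = C_p u'"
    using fiber_path_invariance[OF cA(1) chart(7)[OF cA] B(1) B'(1)] unfolding B B' by simp_all
qed

end

section \<open>Spectral frames\<close>

text \<open>Without the usual denominators, which reappear in \<open>weight\<close>.\<close>

definition lagrange_basis :: "'r::field set \<Rightarrow> 'r \<Rightarrow> 'r poly" where
  "lagrange_basis X x = (\<Prod>y\<in>X-{x}. [:- y, 1:])"

lemma poly_lagrange_basis: "poly (lagrange_basis X x) t = (\<Prod>y\<in>X-{x}. t - y)"
  by (simp add: lagrange_basis_def poly_prod)

lemma degree_prod_linear: "degree (\<Prod>y\<in>Y. [:- f y, 1:] :: 'r::field poly) = card Y"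
proof (induction Y rule: infinite_finite_induct)
  case (insert x F)
  have "(\<Prod>y\<in>F. [:- f y, 1:]) \<noteq> 0" using insert by (auto simp: prod_zero_iff)
  then show ?case using insert by (simp add: degree_mult_eq del: mult_pCons_left)
qed simp_all

lemma monic_prod_linear: "lead_coeff (\<Prod>y\<in>Y. [:- f y, 1:] :: 'r::field poly) = 1"
  by (simp add: lead_coeff_prod)

lemma degree_lagrange_basis:
  assumes "finite X" "x \<in> X"
  shows "degree (lagrange_basis X x) < card X"
proof -
  have "card X > 0" using assms by (auto simp: card_gt_0_iff)
  then show ?thesis
    unfolding lagrange_basis_def degree_prod_linear[of "\<lambda>y. y"] using assms by simp
qed

lemma lagrange_interpolation:
  fixes p :: "'r::field poly"
  assumes X: "finite X" and deg: "degree p < card X"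
  shows "p = (\<Sum>x\<in>X. smult (poly p x / (\<Prod>y\<in>X-{x}. x - y)) (lagrange_basis X x))"
proof (rule poly_eqI_degree[OF _ deg])
  have "X \<noteq> {}" using deg by auto
  then have "card X > 0" using X by (simp add: card_gt_0_iff)
  then show "degree (\<Sum>x\<in>X. smult (poly p x / (\<Prod>y\<in>X-{x}. x - y)) (lagrange_basis X x)) < card X"
    using X degree_lagrange_basis[OF X]
    by (intro degree_sum_less) (auto intro: le_less_trans[OF degree_smult_le])
  fix z assume z: "z \<in> X"
  have "poly (\<Sum>x\<in>X. smult (poly p x / (\<Prod>y\<in>X-{x}. x - y)) (lagrange_basis X x)) z
      = (\<Sum>x\<in>X. if x = z then poly p z else 0)"
    unfolding poly_sum
  proof (rule sum.cong[OF refl])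
    fix x assume "x \<in> X"
    then show "poly (smult (poly p x / (\<Prod>y\<in>X-{x}. x - y)) (lagrange_basis X x)) z =
        (if x = z then poly p z else 0)"
      using X z by (auto simp: poly_lagrange_basis prod_zero_iff)
  qed
  also have "\<dots> = poly p z" using X z by simp
  finally show "poly p z = poly (\<Sum>x\<in>X. smult (poly p x / (\<Prod>y\<in>X-{x}. x - y)) (lagrange_basis X x)) z" ..
qed

text \<open>By interpolation the coefficients are fixed linear combinations of the values at
  X.\<close>

lemma has_derivative_coeff:
  fixes p :: "'e::real_normed_vector \<Rightarrow> real poly"
  assumes X: "finite X" and deg: "\<And>z. degree (p z) < card X" and deg': "\<And>h. degree (p' h) < card X"
    and D: "\<And>t. t \<in> X \<Longrightarrow> ((\<lambda>z. poly (p z) t) has_derivative (\<lambda>h. poly (p' h) t)) (at z)"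
  shows "((\<lambda>z. coeff (p z) k) has_derivative (\<lambda>h. coeff (p' h) k)) (at z)"
proof -
  have c: "coeff r k = (\<Sum>x\<in>X. poly r x * (coeff (lagrange_basis X x) k / (\<Prod>y\<in>X-{x}. x - y)))"
    if "degree r < card X" for r
    using arg_cong[OF lagrange_interpolation[OF X that], of "\<lambda>r. coeff r k"]
    by (simp add: coeff_sum)
  show ?thesis
    unfolding c[OF deg] c[OF deg'] by (intro has_derivative_sum has_derivative_mult_left D)
qed

lemma poly_rc_of_real: "poly (rc p) (complex_of_real t) = complex_of_real (poly p t)"
  by (induction p) (simp_all add: map_poly_pCons)

lemma degree_root_poly: "degree (root_poly l) = CARD('n)" for l :: "'n::finite \<Rightarrow> real"
  by (simp add: root_poly_def degree_prod_linear)

lemma Inv_eigen_component: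
  assumes B: "adjoint_matrix B = B" and e: "B *v e = complex_of_real l *s e"
    and nz: "det (mat (complex_of_real t) - B) \<noteq> 0" and tl: "t \<noteq> l"
  shows "herm e (Inv (mat (complex_of_real t) - B) *v v) = herm e v / complex_of_real (t - l)"
proof -
  let ?N = "mat (complex_of_real t) - B"
  have "?N *v e = complex_of_real (t - l) *s e"
    by (simp add: matrix_vector_mult_diff_rdistrib e vector_sub_rdistrib)
  then have "complex_of_real (t - l) * herm e (Inv ?N *v v) = herm (?N *v e) (Inv ?N *v v)"
    by (simp only: herm_scale_left complex_cnj_complex_of_real)
  also have "\<dots> = herm e (?N *v (Inv ?N *v v))"
    by (simp add: herm_mult_left adjoint_matrix_diff B)
  finally show ?thesis using tl by (simp add: Inv_mult_vec[OF nz] field_simps)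
qed

section \<open>The differential of the characteristic polynomial, and constancy of p_C\<close>

context bochner_kaehler_manifold
begin

text \<open>Lets the coframe chosen in \<open>h_poly\<close> be replaced by whichever one is
  convenient, by fiber invariance.\<close>

lemma h_poly_eq:
  assumes "u \<in> coframe_bundle A g"
  shows "h_poly A g H (fst u) = map_poly Re (char_p u)"
  using fiber_invariance(1)[OF assms some_coframe(1)[of "fst u"]]
  by (simp add: h_poly_def char_p_def some_coframe(2))

lemma C_poly_eq:
  assumes "u \<in> coframe_bundle A g"
  shows "C_poly A g H T V (fst u) = map_poly Re (C_p u)"
proof -
  have "complex_of_real (h_fun A g H 1 (fst u)) = trace (H (some_coframe A g (fst u)))"
    unfolding h_fun_def by (rule elem_sym_1_eigenvalues[OF H_adjoint[OF some_coframe(1)]])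
  then have "C_poly A g H T V (fst u) = map_poly Re (C_p (some_coframe A g (fst u)))"
    unfolding C_poly_def Let_def C_p_def C_complex_def by simp
  then show ?thesis
    using fiber_invariance(2)[OF assms some_coframe(1)[of "fst u"]] by (simp add: some_coframe(2))
qed

lemma degree_h_poly: "degree (h_poly A g H x) = CARD('n)"
proof -
  obtain e l where "onb e" "\<And>k. H (some_coframe A g x) *v e k = complex_of_real (l k) *s e k"
    using hermitian_spectral[OF H_adjoint[OF some_coframe(1)]] by blast
  from char_poly_onb[OF this] show ?thesis by (simp add: h_poly_def degree_root_poly)
qed

lemma h_fun_eq:
  assumes "k \<le> CARD('n)"
  shows "h_fun A g H k x = (-1) ^ k * coeff (h_poly A g H x) (CARD('n) - k)"
  unfolding h_fun_def h_poly_def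
  by (rule elem_sym_eigenvalues[OF H_adjoint[OF some_coframe(1)] assms])

definition spectral_frame ::
    "('a, 'n) chart \<Rightarrow> 'a \<Rightarrow> complex^'n^'n \<Rightarrow> ('n \<Rightarrow> complex^'n) \<Rightarrow> ('n \<Rightarrow> real) \<Rightarrow> bool" where
  "spectral_frame c x B e l \<longleftrightarrow> c \<in> charts_at A x \<and> (snd c x, B) \<in> bundle_chart A g c \<and> onb e \<and>
    (\<forall>k. H (coframe_of A c (snd c x, B)) *v e k = complex_of_real (l k) *s e k)"

definition T_comp :: "('a, 'n) chart \<Rightarrow> 'a \<Rightarrow> complex^'n^'n \<Rightarrow> ('n \<Rightarrow> complex^'n) \<Rightarrow> 'n \<Rightarrow> complex" where
  "T_comp c x B e k = herm (e k) (T (coframe_of A c (snd c x, B)))"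

lemma coframe_of_in:
  "p \<in> bundle_chart A g c \<Longrightarrow> coframe_of A c p \<in> coframe_bundle A g"
  by (simp add: bundle_chart_def)

lemma fst_coframe_of: "fst (coframe_of A c (z, B)) = chart_inv c z"
  by (simp add: coframe_of_def)

lemma spectral_frame_exists:
  assumes c: "c \<in> charts_at A x"
  shows "\<exists>B e l. spectral_frame c x B e l"
proof -
  have cA: "c \<in> A" "x \<in> fst c" using c by (auto simp: charts_at_iff)
  obtain B where B: "(snd c x, B) \<in> bundle_chart A g c"
    using bundle_chart_nonempty[OF cA(1) chart(7)[OF cA]] by blast
  obtain e l where "onb e" "\<And>k. H (coframe_of A c (snd c x, B)) *v e k = complex_of_real (l k) *s e k"
    using hermitian_spectral[OF H_adjoint[OF coframe_of_in[OF B]]] by blast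
  then show ?thesis using B c unfolding spectral_frame_def by blast
qed

context
  fixes c x B e l
  assumes sf: "spectral_frame c x B e l"
begin

lemma sf_chart: "c \<in> A" "x \<in> fst c" "snd c x \<in> chart_image c" "chart_inv c (snd c x) = x"
  using sf chart[of c] by (auto simp: spectral_frame_def charts_at_iff)

lemma sf_frame: "(snd c x, B) \<in> bundle_chart A g c" "onb e"
    "H (coframe_of A c (snd c x, B)) *v e k = complex_of_real (l k) *s e k"
  using sf by (auto simp: spectral_frame_def)

lemma sf_coframe: "coframe_of A c (snd c x, B) \<in> coframe_bundle A g"
    "fst (coframe_of A c (snd c x, B)) = x"
  using coframe_of_in[OF sf_frame(1)] by (simp_all add: fst_coframe_of sf_chart)

lemma sf_h_poly: "h_poly A g H x = root_poly l"
  using h_poly_eq[OF sf_coframe(1)] by (simp add: sf_coframe(2) char_p_def char_poly_onb[OF sf_frame(2,3)])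

lemma sf_C_poly: "C_poly A g H T V x = C_real l (\<lambda>k. (cmod (T_comp c x B e k))\<^sup>2) (V (coframe_of A c (snd c x, B)))"
  using C_poly_eq[OF sf_coframe(1)]
  by (simp add: sf_coframe(2) C_p_def C_complex_onb[OF sf_frame(2,3)] T_comp_def)

text \<open>The differential of p_h at x in the direction h, as a polynomial in t: clearing
  denominators in \<open>-2 p_h(t) Re (herm (B h) w)\<close> with \<open>w = (t - H)^{-1} T\<close>
  leaves one product for each eigenvector.\<close>

definition dh_poly :: "complex^'n \<Rightarrow> real poly" where
  "dh_poly h = (\<Sum>k\<in>UNIV. smult (-2 * Re (cnj (herm (e k) (B *v h)) * T_comp c x B e k)) (\<Prod>j\<in>UNIV-{k}. [:- l j, 1:]))"

text \<open>In the coframe B the gradient of \<open>p_h(t)\<close> is \<open>-2 p_h(t) w\<close>,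
  because t is real and the two vectors of \<open>has_derivative_det_structure\<close> agree. The
  eigenbasis turns the squared norm of w into the sum estimated in
  \<open>escape_estimate\<close>.\<close>

lemma sf_derivative_at:
  assumes t: "t \<notin> range l"
  defines "w \<equiv> Inv (mat (complex_of_real t) - H (coframe_of A c (snd c x, B))) *v T (coframe_of A c (snd c x, B))"
  shows "((\<lambda>z. poly (h_poly A g H (chart_inv c z)) t) has_derivative
      (\<lambda>h. - 2 * poly (root_poly l) t * ((B *v h) \<bullet> w))) (at (snd c x))"
    and "(norm w)\<^sup>2 = (\<Sum>k\<in>UNIV. (cmod (T_comp c x B e k))\<^sup>2 / (t - l k)\<^sup>2)"
    and "- 2 * poly (root_poly l) t * ((B *v h) \<bullet> w) = poly (dh_poly h) t"
proof -
  let ?u = "coframe_of A c (snd c x, B)"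
  let ?t = "complex_of_real t"
  have det: "det (mat ?t - H ?u) = complex_of_real (poly (root_poly l) t)"
    by (simp add: onb_diag(1)[OF sf_frame(2,3)] poly_root_poly)
  have p_nz: "poly (root_poly l) t \<noteq> 0" and tl: "t - l k \<noteq> 0" for k
    using t by (auto simp: poly_root_poly)
  have nz: "det (mat ?t - H ?u) \<noteq> 0" using p_nz det by simp
  have tl': "t \<noteq> l k" for k using t by auto
  have ew: "herm (e k) w = T_comp c x B e k / complex_of_real (t - l k)" for k
    unfolding w_def T_comp_def
    by (rule Inv_eigen_component[OF H_adjoint[OF sf_coframe(1)] sf_frame(3) nz tl'])
  let ?\<sigma> = "local_frame c B"
  obtain D where D: "(?\<sigma> has_derivative D) (at (snd c x))" "\<And>h. fst (D h) = h"
    using local_frame_derivative[OF sf_chart(1,3) sf_frame(1)] by blast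
  have img: "?\<sigma> ` chart_image c \<subseteq> bundle_chart A g c"
    using local_frame_in[OF sf_chart(1,3) sf_frame(1)] by blast
  have \<sigma>0: "?\<sigma> (snd c x) = (snd c x, B)" by (rule local_frame_at[OF sf_chart(1,3) sf_frame(1)])
  obtain \<phi> where \<phi>: "structure_eqs (\<lambda>u. H (coframe_of A c (?\<sigma> u))) (\<lambda>u. T (coframe_of A c (?\<sigma> u)))
    (\<lambda>u. complex_of_real (V (coframe_of A c (?\<sigma> u)))) \<phi> (\<lambda>h. snd (?\<sigma> (snd c x)) *v fst (D h)) (snd c x)"
    by (rule structure_pullback[OF sf_chart(1) open_chart_image[OF sf_chart(1)] sf_chart(3) img D(1)])
  have "((\<lambda>z. det (mat ?t - H (coframe_of A c (?\<sigma> z)))) has_derivative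
      (\<lambda>h. - det (mat ?t - H ?u) * (herm (B *v h) w + herm w (B *v h)))) (at (snd c x))"
    using structure_eqs.has_derivative_det_structure[OF \<phi>, of ?t] nz
    by (simp add: \<sigma>0 D(2) structure_eqs.w_def[OF \<phi>] structure_eqs.y_def[OF \<phi>]
        structure_eqs.N_def[OF \<phi>] structure_eqs.N'_def[OF \<phi>] w_def)
  then have "((\<lambda>z. Re (det (mat ?t - H (coframe_of A c (?\<sigma> z))))) has_derivative
      (\<lambda>h. Re (- det (mat ?t - H ?u) * (herm (B *v h) w + herm w (B *v h))))) (at (snd c x))"
    by (rule bounded_linear.has_derivative[OF bounded_linear_Re])
  moreover have "Re (- det (mat ?t - H ?u) * (herm (B *v h) w + herm w (B *v h))) =
      - 2 * poly (root_poly l) t * ((B *v h) \<bullet> w)" for h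
    unfolding det by (simp add: Re_herm inner_commute)
  ultimately have "((\<lambda>z. Re (det (mat ?t - H (coframe_of A c (?\<sigma> z))))) has_derivative
      (\<lambda>h. - 2 * poly (root_poly l) t * ((B *v h) \<bullet> w))) (at (snd c x))" by simp
  then show "((\<lambda>z. poly (h_poly A g H (chart_inv c z)) t) has_derivative
      (\<lambda>h. - 2 * poly (root_poly l) t * ((B *v h) \<bullet> w))) (at (snd c x))"
  \<comment> \<open>The determinant belongs to the coframe given by the section,
    \<open>h_poly\<close> to a chosen one; by fiber invariance they agree on the whole
    chart.\<close>
  proof (rule has_derivative_transform_within_open[OF _ open_chart_image[OF sf_chart(1)] sf_chart(3)])
    fix z assume "z \<in> chart_image c"
    then have in_b: "?\<sigma> z \<in> bundle_chart A g c" using img by blast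
    let ?v = "coframe_of A c (?\<sigma> z)"
    have fst_v: "fst ?v = chart_inv c z" by (simp add: local_frame_def fst_coframe_of)
    obtain e' l' where e': "onb e'" "\<And>k. H ?v *v e' k = complex_of_real (l' k) *s e' k"
      using hermitian_spectral[OF H_adjoint[OF coframe_of_in[OF in_b]]] by blast
    have hp: "h_poly A g H (chart_inv c z) = root_poly l'"
      using h_poly_eq[OF coframe_of_in[OF in_b]] by (simp add: fst_v char_p_def char_poly_onb[OF e'])
    show "Re (det (mat ?t - H ?v)) = poly (h_poly A g H (chart_inv c z)) t"
      by (simp add: hp poly_det_char_matrix[symmetric] char_poly_onb[OF e'] poly_rc_of_real)
  qed
  have "herm w w = (\<Sum>k\<in>UNIV. complex_of_real ((cmod (T_comp c x B e k))\<^sup>2 / (t - l k)\<^sup>2))"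
    unfolding onb_parseval[OF sf_frame(2), of w w] ew
    by (intro sum.cong refl, unfold of_real_divide complex_norm_square)
      (simp add: power2_eq_square mult.commute del: of_real_diff)
  then have "complex_of_real ((norm w)\<^sup>2) = complex_of_real (\<Sum>k\<in>UNIV. (cmod (T_comp c x B e k))\<^sup>2 / (t - l k)\<^sup>2)"
    by (simp only: herm_self of_real_sum)
  then show "(norm w)\<^sup>2 = (\<Sum>k\<in>UNIV. (cmod (T_comp c x B e k))\<^sup>2 / (t - l k)\<^sup>2)"
    by (simp only: of_real_eq_iff)
  have "(B *v h) \<bullet> w = (\<Sum>k\<in>UNIV. Re (cnj (herm (e k) (B *v h)) * T_comp c x B e k) / (t - l k))"
  proof -
    have "Re (cnj a * (b / complex_of_real r)) = Re (cnj a * b) / r" for a b r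
      by (simp add: add_divide_distrib)
    then show ?thesis
      unfolding Re_herm[symmetric] onb_parseval[OF sf_frame(2), of "B *v h" w] ew Re_sum by simp
  qed
  moreover have quot: "poly (root_poly l) t / (t - l k) = (\<Prod>j\<in>UNIV-{k}. t - l j)" for k
    unfolding poly_root_poly using tl[of k] by (subst prod.remove[of UNIV k]) auto
  ultimately have "- 2 * poly (root_poly l) t * ((B *v h) \<bullet> w) =
      (\<Sum>k\<in>UNIV. (-2 * Re (cnj (herm (e k) (B *v h)) * T_comp c x B e k)) * (\<Prod>j\<in>UNIV-{k}. t - l j))"
    by (simp only: sum_distrib_left flip: quot) (rule sum.cong, simp_all only: times_divide_eq_right times_divide_eq_left mult_ac)
  then show "- 2 * poly (root_poly l) t * ((B *v h) \<bullet> w) = poly (dh_poly h) t"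
    by (simp add: dh_poly_def poly_sum poly_prod)
qed

lemma degree_dh_poly: "degree (dh_poly h) < CARD('n)"
  unfolding dh_poly_def
proof (intro degree_sum_less)
  fix k :: 'n
  have "degree (\<Prod>j\<in>UNIV-{k}. [:- l j, 1:]) < CARD('n)"
    by (simp add: degree_prod_linear card_Diff_singleton)
  then show "degree (smult (-2 * Re (cnj (herm (e k) (B *v h)) * T_comp c x B e k)) (\<Prod>j\<in>UNIV-{k}. [:- l j, 1:])) < CARD('n)"
    by (rule le_less_trans[OF degree_smult_le])
qed simp

lemma sf_coeff_derivative:
  "((\<lambda>z. coeff (h_poly A g H (chart_inv c z)) k) has_derivative (\<lambda>h. coeff (dh_poly h) k)) (at (snd c x))"
proof -
  have "infinite (- range l)"
    using infinite_UNIV_char_0[where 'a=real] finite_imageI[of UNIV l] by (simp add: Compl_eq_Diff_UNIV)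
  \<comment> \<open>One sample point more than the degree of p_h; the points avoid the spectrum,
    where \<open>sf_derivative_at\<close> says nothing.\<close>
  then obtain X where X: "X \<subseteq> - range l" "finite X" "card X = CARD('n) + 1"
    using infinite_arbitrarily_large by blast
  show ?thesis
  proof (rule has_derivative_coeff[OF X(2)])
    show "degree (h_poly A g H (chart_inv c z)) < card X" for z by (simp add: degree_h_poly X)
    show "degree (dh_poly h) < card X" for h using degree_dh_poly[of h] by (simp add: X)
    fix t assume "t \<in> X"
    then have "t \<notin> range l" using X by auto
    from sf_derivative_at(1,3)[OF this]
    show "((\<lambda>z. poly (h_poly A g H (chart_inv c z)) t) has_derivative (\<lambda>h. poly (dh_poly h) t)) (at (snd c x))"
      by simp
  qed
qed

end

text \<open>For every non-real t the derivative of p_C(t) along sections is 0, so p_C(t) is locally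
  constant on the connected manifold.\<close>

lemma C_poly_constant:
  assumes conn: "connected (UNIV :: 'a set)"
  shows "C_poly A g H T V x = C_poly A g H T V y"
proof -
  define f where "f t x = poly (C_p (some_coframe A g x)) t" for t x
  have f_eq: "f t (fst u) = poly (C_p u) t" if "u \<in> coframe_bundle A g" for t u
    using fiber_invariance(2)[OF that some_coframe(1)[of "fst u"]] by (simp add: f_def some_coframe(2))
  have "f t x = f t y" if t: "t \<notin> \<real>" for t x y
  proof (rule connected_local_const[OF conn UNIV_I UNIV_I], rule ballI)
    fix x
    obtain c where "c \<in> charts_at A x" using charts_at_nonempty by blast
    then have c: "c \<in> A" "x \<in> fst c" by (auto simp: charts_at_iff)
    obtain r where r: "r > 0" "ball (snd c x) r \<subseteq> chart_image c"
      using open_chart_image[OF c(1)] chart(7)[OF c] open_contains_ball by blast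
    have D: "((\<lambda>z. f t (chart_inv c z)) has_derivative (\<lambda>h. 0)) (at z)" if z: "z \<in> chart_image c" for z
    proof -
      \<comment> \<open>A new section for each z, because its derivative is available at its base
        point.\<close>
      obtain B where B: "(z, B) \<in> bundle_chart A g c"
        using bundle_chart_nonempty[OF c(1) z] by blast
      let ?\<sigma> = "local_frame c B"
      obtain D where D: "(?\<sigma> has_derivative D) (at z)"
        using local_frame_derivative[OF c(1) z B] by blast
      have img: "?\<sigma> ` chart_image c \<subseteq> bundle_chart A g c" using local_frame_in[OF c(1) z B] by blast
      show ?thesis
      proof (rule has_derivative_transform_within_open[OF has_derivative_C_p[OF c(1) open_chart_image[OF c(1)] z img D t]
            open_chart_image[OF c(1)] z])
        fix z' assume "z' \<in> chart_image c"
        then have "coframe_of A c (?\<sigma> z') \<in> coframe_bundle A g" using img coframe_of_in by blast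
        from f_eq[OF this] show "poly (C_p (coframe_of A c (?\<sigma> z'))) t = f t (chart_inv c z')"
          by (simp add: local_frame_def fst_coframe_of)
      qed
    qed
    have "\<exists>k. \<forall>z\<in>ball (snd c x) r. f t (chart_inv c z) = k"
      by (rule has_derivative_zero_constant[OF convex_ball]) (use D r in \<open>blast intro: has_derivative_at_withinI\<close>)
    then obtain k where k: "\<And>z. z \<in> ball (snd c x) r \<Longrightarrow> f t (chart_inv c z) = k" by blast
    have "open {y \<in> fst c. snd c y \<in> ball (snd c x) r}"
      using continuous_open_preimage[OF continuous_chart[OF c(1)] open_chart[OF c(1)] open_ball]
      by (simp add: vimage_def Int_def)
    then have "\<forall>\<^sub>F y in at x. y \<in> {y \<in> fst c. snd c y \<in> ball (snd c x) r}"
      by (rule eventually_at_in_open') (use c r in simp)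
    then show "\<forall>\<^sub>F y in at x within UNIV. f t x = f t y"
    proof eventually_elim
      case (elim y)
      then show ?case using k[of "snd c x"] k[of "snd c y"] r chart(8)[OF c(1)] c(2) by simp
    qed
  qed
  then have "C_p (some_coframe A g x) = C_p (some_coframe A g y)"
    by (intro poly_eq_infinite[OF infinite_nonreal]) (simp add: f_def)
  then show ?thesis
    using C_poly_eq[OF some_coframe(1)[of x]] C_poly_eq[OF some_coframe(1)[of y]] by (simp add: some_coframe(2))
qed

end

section \<open>Polynomials with interlacing roots\<close>

text \<open>Off the spectrum \<open>pD = p Q + sum_k c_k p / (t - l_k)\<close>. As t tends to
  \<open>\<mu>\<close>, the quotients with \<open>l_k = \<mu>\<close> tend to
  \<open>p'(\<mu>)\<close>, and everything else tends to 0.\<close>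

lemma residue_formula:
  fixes l c :: "'n::finite \<Rightarrow> real"
  assumes p: "q * p = root_poly l" and pD: "q * pD = C_real l c v" and root: "poly p \<mu> = 0"
  shows "poly pD \<mu> = poly (pderiv p) \<mu> * (\<Sum>k | l k = \<mu>. c k)"
proof -
  define Q where "Q t = t\<^sup>2 + (\<Sum>k\<in>UNIV. l k) * t + v" for t
  define r where "r k = (if l k = \<mu> then poly (pderiv p) \<mu> else 0)" for k
  have ev: "\<forall>\<^sub>F t in at \<mu>. \<forall>k. t \<noteq> l k"
    by (intro eventually_all_finite) (simp add: eventually_neq_at_within)
  have eq: "poly pD t = poly p t * Q t + (\<Sum>k\<in>UNIV. c k * (poly p t / (t - l k)))" if t: "\<forall>k. t \<noteq> l k" for t
  proof -
    have nz: "poly q t * poly p t \<noteq> 0"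
      using t p by (auto simp: poly_root_poly simp flip: poly_mult)
    have "(\<Prod>j\<in>UNIV-{k}. t - l j) = poly q t * (poly p t / (t - l k))" for k
    proof -
      have "(t - l k) * (\<Prod>j\<in>UNIV-{k}. t - l j) = poly q t * poly p t"
        unfolding poly_mult[symmetric] p poly_root_poly using prod.remove[of UNIV k "\<lambda>j. t - l j"] by simp
      then show ?thesis using t by (simp add: field_simps)
    qed
    then have "poly q t * poly pD t = poly q t * (poly p t * Q t + (\<Sum>k\<in>UNIV. c k * (poly p t / (t - l k))))"
      unfolding poly_mult[symmetric] pD C_real_def p[symmetric]
      by (simp add: poly_sum poly_prod Q_def power2_eq_square algebra_simps)
        (simp add: sum_distrib_left mult_ac)
    then show ?thesis using nz by simp
  qed
  have lim_k: "((\<lambda>t. poly p t / (t - l k)) \<longlongrightarrow> r k) (at \<mu>)" for k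
  proof (cases "l k = \<mu>")
    case True
    have "((\<lambda>t. (poly p t - poly p \<mu>) / (t - \<mu>)) \<longlongrightarrow> poly (pderiv p) \<mu>) (at \<mu>)"
      using poly_DERIV[of p \<mu>] by (simp add: has_field_derivative_iff)
    then show ?thesis using True root by (simp add: r_def)
  next
    case False
    then have "((\<lambda>t. poly p t / (t - l k)) \<longlongrightarrow> poly p \<mu> / (\<mu> - l k)) (at \<mu>)"
      by (intro tendsto_intros) auto
    then show ?thesis using False root by (simp add: r_def)
  qed
  have "((\<lambda>t. poly p t * Q t + (\<Sum>k\<in>UNIV. c k * (poly p t / (t - l k)))) \<longlongrightarrow>
      poly p \<mu> * Q \<mu> + (\<Sum>k\<in>UNIV. c k * r k)) (at \<mu>)"
    unfolding Q_def by (intro tendsto_intros lim_k)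
  moreover have "\<forall>\<^sub>F t in at \<mu>. poly pD t = poly p t * Q t + (\<Sum>k\<in>UNIV. c k * (poly p t / (t - l k)))"
    using ev by eventually_elim (rule eq)
  ultimately have "((\<lambda>t. poly pD t) \<longlongrightarrow> poly p \<mu> * Q \<mu> + (\<Sum>k\<in>UNIV. c k * r k)) (at \<mu>)"
    by (simp add: tendsto_cong)
  moreover have "((\<lambda>t. poly pD t) \<longlongrightarrow> poly pD \<mu>) (at \<mu>)" by (intro tendsto_intros)
  ultimately have "poly pD \<mu> = poly p \<mu> * Q \<mu> + (\<Sum>k\<in>UNIV. c k * r k)"
    by (rule tendsto_unique[OF trivial_limit_at, rotated])
  also have "(\<Sum>k\<in>UNIV. c k * r k) = (\<Sum>k\<in>UNIV. if l k = \<mu> then c k * poly (pderiv p) \<mu> else 0)"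
    by (rule sum.cong) (auto simp: r_def)
  also have "\<dots> = (\<Sum>k | l k = \<mu>. c k * poly (pderiv p) \<mu>)"
    by (simp add: sum.inter_filter[symmetric])
  finally show ?thesis using root by (simp add: sum_distrib_left mult.commute)
qed

lemma sign_prod_linear:
  fixes t :: real
  assumes "finite S" "t \<notin> S"
  shows "(-1) ^ card {s\<in>S. s > t} * (\<Prod>s\<in>S. t - s) > 0"
  using assms
proof (induction S rule: finite_induct)
  case (insert x S)
  show ?case
  proof (cases "x > t")
    case True
    then have "{s \<in> insert x S. s > t} = insert x {s\<in>S. s > t}" by auto
    then have "card {s \<in> insert x S. s > t} = Suc (card {s\<in>S. s > t})" using insert by simp
    then have eq: "(-1) ^ card {s\<in>insert x S. s > t} * (\<Prod>s\<in>insert x S. t - s) =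
        (x - t) * ((-1) ^ card {s\<in>S. s > t} * (\<Prod>s\<in>S. t - s))"
      using insert by (simp add: algebra_simps)
    show ?thesis unfolding eq using insert True by (intro mult_pos_pos[OF _ insert.IH]) auto
  next
    case False
    then have "{s \<in> insert x S. s > t} = {s\<in>S. s > t}" by auto
    then have eq: "(-1) ^ card {s\<in>insert x S. s > t} * (\<Prod>s\<in>insert x S. t - s) =
        (t - x) * ((-1) ^ card {s\<in>S. s > t} * (\<Prod>s\<in>S. t - s))"
      using insert by (simp add: algebra_simps)
    show ?thesis unfolding eq using insert False by (intro mult_pos_pos[OF _ insert.IH]) auto
  qed
qed simp

text \<open>Minus the residue at \<open>\<rho>\<close> of p divided by the product of all
  \<open>t - s\<close>: the numerator in
  \<open>p / prod (t - s) = 1 - sum a_s / (t - s)\<close>.\<close>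

definition weight :: "real set \<Rightarrow> real poly \<Rightarrow> real \<Rightarrow> real" where
  "weight S p \<rho> = - poly p \<rho> / (\<Prod>s\<in>S-{\<rho>}. \<rho> - s)"

text \<open>The denominator of the weight has the sign
  \<open>(-1) ^ card {s \<in> S. s > \<rho>}\<close>.\<close>

lemma weight_nonneg:
  assumes "finite S" "\<rho> \<in> S" "(-1) ^ card {s\<in>S. s > \<rho>} * poly p \<rho> \<le> 0"
  shows "weight S p \<rho> \<ge> 0"
proof -
  have "{s \<in> S - {\<rho>}. s > \<rho>} = {s\<in>S. s > \<rho>}" by auto
  then have pos: "(-1) ^ card {s\<in>S. s > \<rho>} * (\<Prod>s\<in>S-{\<rho>}. \<rho> - s) > 0"
    using sign_prod_linear[of "S - {\<rho>}" \<rho>] assms(1) by simp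
  have "weight S p \<rho> = - ((-1) ^ card {s\<in>S. s > \<rho>} * poly p \<rho>) / ((-1) ^ card {s\<in>S. s > \<rho>} * (\<Prod>s\<in>S-{\<rho>}. \<rho> - s))"
    by (simp add: weight_def)
  also have "\<dots> \<ge> 0" using pos assms(3) by (intro divide_nonneg_pos) auto
  finally show ?thesis .
qed

text \<open>p and the product are monic of the same degree, so their difference is interpolated by
  its values on S, where the product vanishes.\<close>

lemma weight_expansion:
  assumes S: "finite S" "S \<noteq> {}" and p: "lead_coeff p = 1" "degree p = card S"
  shows "p = (\<Prod>s\<in>S. [:- s, 1:]) - (\<Sum>\<rho>\<in>S. smult (weight S p \<rho>) (lagrange_basis S \<rho>))"
proof -
  let ?\<omega> = "\<Prod>s\<in>S. [:- s, 1:]"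
  have d: "degree (p - ?\<omega>) < card S"
  proof (cases "p - ?\<omega> = 0")
    case False
    have "degree (p - ?\<omega>) \<le> card S"
      using p degree_prod_linear[of "\<lambda>s. s" S] by (intro degree_diff_le) auto
    moreover have "coeff (p - ?\<omega>) (card S) = 0"
      using p monic_prod_linear[of "\<lambda>s. s" S] degree_prod_linear[of "\<lambda>s. s" S] by simp
    then have "degree (p - ?\<omega>) \<noteq> card S" using False leading_coeff_neq_0 by metis
    ultimately show ?thesis by simp
  qed (use S in \<open>simp add: card_gt_0_iff\<close>)
  have "p - ?\<omega> = (\<Sum>\<rho>\<in>S. smult (poly (p - ?\<omega>) \<rho> / (\<Prod>y\<in>S-{\<rho>}. \<rho> - y)) (lagrange_basis S \<rho>))"
    by (rule lagrange_interpolation[OF S(1) d])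
  also have "\<dots> = (\<Sum>\<rho>\<in>S. - smult (weight S p \<rho>) (lagrange_basis S \<rho>))"
  proof (rule sum.cong[OF refl])
    fix \<rho> assume "\<rho> \<in> S"
    then have "poly ?\<omega> \<rho> = 0" using S by (auto simp: poly_prod prod_zero_iff)
    then show "smult (poly (p - ?\<omega>) \<rho> / (\<Prod>y\<in>S-{\<rho>}. \<rho> - y)) (lagrange_basis S \<rho>)
        = - smult (weight S p \<rho>) (lagrange_basis S \<rho>)" by (simp add: weight_def)
  qed
  finally show ?thesis by (simp add: sum_negf algebra_simps)
qed

lemma weight_expansion_poly:
  assumes S: "finite S" "S \<noteq> {}" and p: "lead_coeff p = 1" "degree p = card S" and t: "t \<notin> S"
  shows "poly p t = (\<Prod>s\<in>S. t - s) * (1 - (\<Sum>\<rho>\<in>S. weight S p \<rho> / (t - \<rho>)))"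
proof -
  have "poly (lagrange_basis S \<rho>) t = (\<Prod>s\<in>S. t - s) / (t - \<rho>)" if "\<rho> \<in> S" for \<rho>
  proof -
    have "t - \<rho> \<noteq> 0" using that t by auto
    then show ?thesis using that S by (simp add: poly_lagrange_basis prod.remove[of S \<rho>])
  qed
  then show ?thesis
    by (subst weight_expansion[OF S p]) (simp add: poly_sum poly_prod sum_distrib_left algebra_simps)
qed

text \<open>\<open>p(R) >= 0\<close> says that the terms \<open>a_s / (R - s)\<close> add up to at
  most 1; none is negative, so each \<open>a_s\<close> is at most \<open>R - s\<close>.\<close>

lemma coeff_bound_of_weights:
  assumes S: "finite S" "S \<noteq> {}" and p: "lead_coeff p = 1" "degree p = card S"
    and nonneg: "\<And>\<rho>. \<rho> \<in> S \<Longrightarrow> weight S p \<rho> \<ge> 0"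
    and R: "\<And>\<rho>. \<rho> \<in> S \<Longrightarrow> \<rho> < R" "poly p R \<ge> 0"
  shows "\<bar>coeff p j\<bar> \<le> \<bar>coeff (\<Prod>s\<in>S. [:- s, 1:]) j\<bar> + (\<Sum>\<rho>\<in>S. (R - \<rho>) * \<bar>coeff (lagrange_basis S \<rho>) j\<bar>)"
proof -
  have RS: "R \<notin> S" using R(1) by auto
  have "(\<Prod>s\<in>S. R - s) > 0" using R(1) by (intro prod_pos) auto
  then have sum1: "(\<Sum>\<rho>\<in>S. weight S p \<rho> / (R - \<rho>)) \<le> 1"
    using R(2) weight_expansion_poly[OF S p RS] by (simp add: zero_le_mult_iff)
  have a: "weight S p \<rho> \<le> R - \<rho>" if "\<rho> \<in> S" for \<rho>
  proof -
    have "weight S p \<rho> / (R - \<rho>) \<le> (\<Sum>\<rho>\<in>S. weight S p \<rho> / (R - \<rho>))"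
      using nonneg R(1) by (intro member_le_sum that S) (auto intro!: divide_nonneg_pos)
    then have "weight S p \<rho> / (R - \<rho>) \<le> 1" using sum1 by linarith
    then show ?thesis using R(1)[OF that] by (simp add: field_simps)
  qed
  have "\<bar>coeff p j\<bar> = \<bar>coeff (\<Prod>s\<in>S. [:- s, 1:]) j - (\<Sum>\<rho>\<in>S. weight S p \<rho> * coeff (lagrange_basis S \<rho>) j)\<bar>"
    by (subst weight_expansion[OF S p]) (simp add: coeff_sum)
  also have "\<dots> \<le> \<bar>coeff (\<Prod>s\<in>S. [:- s, 1:]) j\<bar> + \<bar>\<Sum>\<rho>\<in>S. weight S p \<rho> * coeff (lagrange_basis S \<rho>) j\<bar>"
    by (rule abs_triangle_ineq4)
  also have "\<bar>\<Sum>\<rho>\<in>S. weight S p \<rho> * coeff (lagrange_basis S \<rho>) j\<bar> \<le>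
      (\<Sum>\<rho>\<in>S. \<bar>weight S p \<rho> * coeff (lagrange_basis S \<rho>) j\<bar>)" by (rule sum_abs)
  also have "\<dots> \<le> (\<Sum>\<rho>\<in>S. (R - \<rho>) * \<bar>coeff (lagrange_basis S \<rho>) j\<bar>)"
    using a nonneg by (intro sum_mono) (auto simp: abs_mult intro!: mult_right_mono)
  finally show ?thesis by simp
qed

lemma quadratic_lower_bound:
  fixes \<beta> \<epsilon> :: real
  assumes "\<And>y. y \<ge> 0 \<Longrightarrow> y\<^sup>2 + \<beta> * y + \<epsilon> > 0"
  obtains c where "c > 0" "\<And>y. y \<ge> 0 \<Longrightarrow> y\<^sup>2 + \<beta> * y + \<epsilon> \<ge> c * y\<^sup>2"
proof (cases "\<beta> \<ge> 0")
  case True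
  have "\<epsilon> > 0" using assms[of 0] by simp
  then show ?thesis using True by (intro that[of 1]) auto
next
  case False
  have e: "\<epsilon> > 0" using assms[of 0] by simp
  have "(- \<beta> / 2)\<^sup>2 + \<beta> * (- \<beta> / 2) + \<epsilon> > 0" using False by (intro assms) auto
  then have d: "\<beta>\<^sup>2 < 4 * \<epsilon>" by (simp add: power2_eq_square field_simps)
  show ?thesis
  proof (rule that)
    \<comment> \<open>This constant makes the difference of the two sides a perfect square; it is
      positive because the value at the minimum \<open>- \<beta> / 2\<close> is.\<close>
    show "1 - \<beta>\<^sup>2 / (4 * \<epsilon>) > 0" using d e by simp
    fix y :: real
    have "y\<^sup>2 + \<beta> * y + \<epsilon> - (1 - \<beta>\<^sup>2 / (4 * \<epsilon>)) * y\<^sup>2 = (\<beta> * y + 2 * \<epsilon>)\<^sup>2 / (4 * \<epsilon>)"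
      using e by (simp add: field_simps power2_eq_square)
    also have "\<dots> \<ge> 0" using e by simp
    finally show "y\<^sup>2 + \<beta> * y + \<epsilon> \<ge> (1 - \<beta>\<^sup>2 / (4 * \<epsilon>)) * y\<^sup>2" by simp
  qed
qed

lemma prod_linear_dvd:
  fixes p :: "'r::field poly"
  assumes "finite S" "\<And>s. s \<in> S \<Longrightarrow> poly p s = 0"
  shows "(\<Prod>s\<in>S. [:- s, 1:]) dvd p"
  using assms
proof (induction S arbitrary: p rule: finite_induct)
  case (insert x S)
  then obtain r where r: "p = [:- x, 1:] * r" by (metis insertI1 poly_eq_0_iff_dvd dvdE)
  have "poly r s = 0" if "s \<in> S" for s
  proof -
    have "s \<noteq> x" using that insert by auto
    moreover have "poly p s = 0" using insert that by simp
    ultimately show ?thesis by (simp add: r)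
  qed
  then have "(\<Prod>s\<in>S. [:- s, 1:]) dvd r" by (rule insert.IH)
  then show ?case using insert r by (simp add: mult_dvd_mono del: mult_pCons_left)
qed simp

text \<open>\<open>p(ts) < 0\<close> forces a root \<open>\<mu>\<close> of p beyond ts; let
  \<open>d = \<mu> - ts\<close>. The residue formula at \<open>\<mu>\<close> and the growth of
  \<open>pD / prod (t - s)\<close> bound the sum of the \<open>c k\<close> with
  \<open>l k = \<mu>\<close> below by a multiple of \<open>d^3\<close>, hence the sum in the claim
  by a multiple of d. The partial fractions bound \<open>- p(ts)\<close> above by a multiple of
  d.\<close>

lemma escape_estimate:
  fixes pD :: "real poly"
  assumes S: "finite S" "S \<noteq> {}" and St: "\<And>s. s \<in> S \<Longrightarrow> s < ts"
    and pD: "lead_coeff pD = 1" "degree pD = card S + 2" "\<And>s. s \<in> S \<Longrightarrow> poly pD s = 0"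
    and pos: "\<And>t. t \<ge> ts \<Longrightarrow> poly pD t > 0"
  obtains C where "C > 0" "\<And>(l :: 'n::finite \<Rightarrow> real) p q c v. \<lbrakk>lead_coeff p = 1; degree p = card S;
      \<And>\<rho>. \<rho> \<in> S \<Longrightarrow> weight S p \<rho> \<ge> 0; q * p = root_poly l; q * pD = C_real l c v;
      \<And>k. c k \<ge> 0; poly p ts < 0\<rbrakk> \<Longrightarrow> (\<Sum>k\<in>UNIV. c k / (ts - l k)\<^sup>2) \<ge> C * (- poly p ts)"
proof -
  let ?\<omega> = "\<Prod>s\<in>S. [:- s, 1:]"
  obtain \<kappa> where \<kappa>: "pD = ?\<omega> * \<kappa>" using prod_linear_dvd[OF S(1) pD(3)] by blast
  have \<omega>: "degree ?\<omega> = card S" "lead_coeff ?\<omega> = 1"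
    using degree_prod_linear[of "\<lambda>s. s"] monic_prod_linear[of "\<lambda>s. s"] by auto
  have "pD \<noteq> 0" using pD(1) by auto
  then have "?\<omega> \<noteq> 0" "\<kappa> \<noteq> 0" using \<kappa> by auto
  then have "degree \<kappa> = 2" using pD(2) \<omega> by (simp add: \<kappa> degree_mult_eq)
  moreover have "lead_coeff \<kappa> = 1" using pD(1) \<omega> by (simp add: \<kappa> lead_coeff_mult del: \<omega>)
  ultimately obtain b e where \<kappa>_eq: "poly \<kappa> t = t\<^sup>2 + b * t + e" for t
    by (auto simp: poly_altdef numeral_2_eq_2 that[of "coeff \<kappa> 1" "coeff \<kappa> 0"] algebra_simps)
  have \<omega>_pos: "(\<Prod>s\<in>S. t - s) > 0" if "t \<ge> ts" for t
    using St that by (intro prod_pos) force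
  have \<kappa>_pos: "poly \<kappa> t > 0" if "t \<ge> ts" for t
    using pos[OF that] \<omega>_pos[OF that] by (simp add: \<kappa> poly_prod zero_less_mult_iff)
  \<comment> \<open>The quadratic factor \<open>\<kappa>\<close> of pD, written in the variable
    \<open>y = t - ts\<close>.\<close>
  obtain c0 where c0: "c0 > 0" "\<And>y. y \<ge> 0 \<Longrightarrow> y\<^sup>2 + (2 * ts + b) * y + poly \<kappa> ts \<ge> c0 * y\<^sup>2"
  proof (rule quadratic_lower_bound[of "2 * ts + b" "poly \<kappa> ts"])
    fix y :: real assume "y \<ge> 0"
    then show "y\<^sup>2 + (2 * ts + b) * y + poly \<kappa> ts > 0"
      using \<kappa>_pos[of "ts + y"] by (simp add: \<kappa>_eq power2_eq_square algebra_simps)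
  qed (rule that)
  have \<kappa>_bound: "poly \<kappa> t \<ge> c0 * (t - ts)\<^sup>2" if "t \<ge> ts" for t
    using c0(2)[of "t - ts"] that by (simp add: \<kappa>_eq power2_eq_square algebra_simps)
  define \<delta> where "\<delta> = Min ((\<lambda>s. ts - s) ` S)"
  have \<delta>: "\<delta> > 0" "\<And>s. s \<in> S \<Longrightarrow> \<delta> \<le> ts - s"
    using S St by (auto simp: \<delta>_def)
  \<comment> \<open>The sum will be at least \<open>c0 (\<mu> - ts)\<close>, while
    \<open>- p(ts)\<close> is at most \<open>prod (ts - s)\<close> times
    \<open>(\<mu> - ts) / \<delta>\<close>; C is the quotient of these bounds.\<close>
  define C where "C = c0 * \<delta> / (\<Prod>s\<in>S. ts - s)"
  have "C > 0" using c0 \<delta> \<omega>_pos[of ts] by (simp add: C_def)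
  moreover have "(\<Sum>k\<in>UNIV. c k / (ts - l k)\<^sup>2) \<ge> C * (- poly p ts)"
    if p: "lead_coeff p = 1" "degree p = card S" and wn: "\<And>\<rho>. \<rho> \<in> S \<Longrightarrow> weight S p \<rho> \<ge> 0"
      and q: "q * p = root_poly l" "q * pD = C_real l c v" and c: "\<And>k. c k \<ge> 0" and neg: "poly p ts < 0"
    for l :: "'n \<Rightarrow> real" and p q c v
  proof -
    define a where "a = weight S p"
    have a: "a \<rho> \<ge> 0" if "\<rho> \<in> S" for \<rho> using wn that by (simp add: a_def)
    have exp: "poly p t = (\<Prod>s\<in>S. t - s) * (1 - (\<Sum>\<rho>\<in>S. a \<rho> / (t - \<rho>)))" if "t \<ge> ts" for t
    proof -
      have "t \<notin> S" using St that by force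
      then show ?thesis unfolding a_def by (rule weight_expansion_poly[OF S p])
    qed
    obtain n where n: "\<And>x. x \<ge> n \<Longrightarrow> poly p x \<ge> lead_coeff p"
      using poly_pinfty_gt_lc[of p] p by auto
    have "poly p (max n (ts + 1)) > 0" using n[of "max n (ts + 1)"] p by simp
    then obtain \<mu> where \<mu>: "ts < \<mu>" "poly p \<mu> = 0"
      using poly_IVT_pos[of ts "max n (ts + 1)" p] neg less_max_iff_disj[of ts n "ts + 1"] by auto
    have d\<rho>: "\<mu> - \<rho> > 0" "\<mu> - \<rho> \<ge> \<mu> - ts" "\<rho> \<noteq> \<mu>" if "\<rho> \<in> S" for \<rho> using St[OF that] \<mu> by auto
    \<comment> \<open>The equation \<open>p(\<mu>) = 0\<close> in partial fraction form.\<close>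
    have sum1: "(\<Sum>\<rho>\<in>S. a \<rho> / (\<mu> - \<rho>)) = 1"
      using exp[of \<mu>] \<mu> \<omega>_pos[of \<mu>] by simp
    define D where "D = (\<Sum>\<rho>\<in>S. a \<rho> / (\<mu> - \<rho>)\<^sup>2)"
    have p': "poly (pderiv p) \<mu> = (\<Prod>s\<in>S. \<mu> - s) * D"
    proof -
      have "((\<lambda>t. poly ?\<omega> t * (1 - (\<Sum>\<rho>\<in>S. a \<rho> / (t - \<rho>)))) has_field_derivative
          (poly (pderiv ?\<omega>) \<mu> * (1 - (\<Sum>\<rho>\<in>S. a \<rho> / (\<mu> - \<rho>))) + 
           (0 - (\<Sum>\<rho>\<in>S. (0 * (\<mu> - \<rho>) - a \<rho> * (1 - 0)) / ((\<mu> - \<rho>) * (\<mu> - \<rho>)))) * poly ?\<omega> \<mu>)) (at \<mu>)"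
        using d\<rho> by (intro DERIV_mult DERIV_diff DERIV_const DERIV_sum DERIV_divide DERIV_ident poly_DERIV) auto
      then have 1: "((\<lambda>t. poly ?\<omega> t * (1 - (\<Sum>\<rho>\<in>S. a \<rho> / (t - \<rho>)))) has_field_derivative
          (\<Prod>s\<in>S. \<mu> - s) * D) (at \<mu>)"
        by (simp add: sum1 D_def sum_negf poly_prod power2_eq_square mult.commute)
      have "(poly p has_field_derivative (\<Prod>s\<in>S. \<mu> - s) * D) (at \<mu>)"
        by (rule DERIV_cong_ev[THEN iffD1, OF refl _ refl 1])
          (use eventually_nhds_in_open[of "{ts<..}" \<mu>] \<mu> exp in \<open>auto elim!: eventually_mono simp: poly_prod\<close>)
      then show ?thesis using poly_DERIV DERIV_unique by blast
    qed
    define s where "s = (\<Sum>k | l k = \<mu>. c k)"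
    have s0: "s \<ge> 0" unfolding s_def by (intro sum_nonneg c)
    have "poly pD \<mu> = poly (pderiv p) \<mu> * s"
      unfolding s_def by (rule residue_formula[OF q \<mu>(2)])
    then have "(\<Prod>s\<in>S. \<mu> - s) * poly \<kappa> \<mu> = (\<Prod>s\<in>S. \<mu> - s) * (D * s)"
      by (simp add: \<kappa> poly_prod p')
    then have \<kappa>s: "poly \<kappa> \<mu> = D * s" using \<omega>_pos[of \<mu>] \<mu> by simp
    \<comment> \<open>One of the two factors \<open>1 / (\<mu> - \<rho>)\<close> is estimated by
      \<open>1 / (\<mu> - ts)\<close>; the other is kept for \<open>sum1\<close>.\<close>
    have "D \<le> (\<Sum>\<rho>\<in>S. a \<rho> / (\<mu> - \<rho>) * (1 / (\<mu> - ts)))"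
      unfolding D_def
    proof (rule sum_mono)
      fix \<rho> assume \<rho>: "\<rho> \<in> S"
      have "1 / (\<mu> - \<rho>) \<le> 1 / (\<mu> - ts)" using d\<rho>[OF \<rho>] \<mu> by (intro divide_left_mono) auto
      then have "a \<rho> / (\<mu> - \<rho>) * (1 / (\<mu> - \<rho>)) \<le> a \<rho> / (\<mu> - \<rho>) * (1 / (\<mu> - ts))"
        using a[OF \<rho>] d\<rho>[OF \<rho>] by (intro mult_left_mono) auto
      then show "a \<rho> / (\<mu> - \<rho>)\<^sup>2 \<le> a \<rho> / (\<mu> - \<rho>) * (1 / (\<mu> - ts))"
        by (simp add: power2_eq_square)
    qed
    also have "\<dots> = 1 / (\<mu> - ts)" unfolding sum_distrib_right[symmetric] sum1 by simp
    finally have "D * s \<le> s / (\<mu> - ts)" using mult_right_mono[OF _ s0] by fastforce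
    then have s_bound: "c0 * (\<mu> - ts) \<le> s / (\<mu> - ts)\<^sup>2"
    proof -
      define d where "d = \<mu> - ts"
      have "d > 0" using \<mu> by (simp add: d_def)
      have "c0 * d\<^sup>2 \<le> s / d"
        using \<kappa>_bound[of \<mu>] \<mu> \<open>D * s \<le> s / (\<mu> - ts)\<close> by (simp add: \<kappa>s d_def)
      then have "c0 * d\<^sup>2 / d \<le> s / d / d" using \<open>d > 0\<close> by (intro divide_right_mono) auto
      then show ?thesis using \<open>d > 0\<close> by (simp add: d_def[symmetric] power2_eq_square)
    qed
    have "s / (\<mu> - ts)\<^sup>2 = (\<Sum>k | l k = \<mu>. c k / (ts - l k)\<^sup>2)"
      unfolding s_def sum_divide_distrib by (rule sum.cong) (auto simp: power2_commute)
    also have "\<dots> \<le> (\<Sum>k\<in>UNIV. c k / (ts - l k)\<^sup>2)"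
      by (rule sum_mono2) (auto simp: c)
    finally have lower: "c0 * (\<mu> - ts) \<le> (\<Sum>k\<in>UNIV. c k / (ts - l k)\<^sup>2)" using s_bound by linarith
    \<comment> \<open>The denominators at ts and at \<open>\<mu>\<close> differ by a factor of at
      most \<open>1 + (\<mu> - ts) / \<delta>\<close>, so \<open>sum1\<close> controls the sum at ts
      as well.\<close>
    have "(\<Sum>\<rho>\<in>S. a \<rho> / (ts - \<rho>)) \<le> (\<Sum>\<rho>\<in>S. a \<rho> / (\<mu> - \<rho>) * (1 + (\<mu> - ts) / \<delta>))"
    proof (rule sum_mono)
      fix \<rho> assume \<rho>: "\<rho> \<in> S"
      have t\<rho>: "ts - \<rho> > 0" using St[OF \<rho>] by simp
      have "(\<mu> - ts) / (ts - \<rho>) \<le> (\<mu> - ts) / \<delta>"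
        using \<delta>(1) \<delta>(2)[OF \<rho>] \<mu> by (intro divide_left_mono) auto
      moreover have "(\<mu> - \<rho>) / (ts - \<rho>) = 1 + (\<mu> - ts) / (ts - \<rho>)" using t\<rho> by (simp add: field_simps)
      ultimately have "a \<rho> / (\<mu> - \<rho>) * ((\<mu> - \<rho>) / (ts - \<rho>)) \<le> a \<rho> / (\<mu> - \<rho>) * (1 + (\<mu> - ts) / \<delta>)"
        using a[OF \<rho>] d\<rho>[OF \<rho>] by (intro mult_left_mono) auto
      then show "a \<rho> / (ts - \<rho>) \<le> a \<rho> / (\<mu> - \<rho>) * (1 + (\<mu> - ts) / \<delta>)"
        using d\<rho>[OF \<rho>] by simp
    qed
    also have "\<dots> = 1 + (\<mu> - ts) / \<delta>" unfolding sum_distrib_right[symmetric] sum1 by simp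
    finally have "(\<Sum>\<rho>\<in>S. a \<rho> / (ts - \<rho>)) - 1 \<le> (\<mu> - ts) / \<delta>" by simp
    then have "- poly p ts \<le> (\<Prod>s\<in>S. ts - s) * ((\<mu> - ts) / \<delta>)"
      using exp[of ts] \<omega>_pos[of ts] mult_left_mono[of "(\<Sum>\<rho>\<in>S. a \<rho> / (ts - \<rho>)) - 1" "(\<mu> - ts) / \<delta>" "\<Prod>s\<in>S. ts - s"]
      by (simp add: algebra_simps)
    then have "C * (- poly p ts) \<le> C * ((\<Prod>s\<in>S. ts - s) * ((\<mu> - ts) / \<delta>))"
      using \<open>C > 0\<close> by (intro mult_left_mono) auto
    also have "\<dots> = c0 * (\<mu> - ts)" using \<omega>_pos[of ts] \<delta> by (simp add: C_def)
    finally show ?thesis using lower by linarith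
  qed
  ultimately show ?thesis by (rule that)
qed

lemma pderiv_prod_linear_at_root:
  fixes x :: "'r::{idom_divide,field}"
  assumes "finite L" "x \<in> L"
  shows "poly (pderiv (\<Prod>y\<in>L. [:- y, 1:])) x = (\<Prod>y\<in>L-{x}. x - y)"
proof -
  have "poly (pderiv (\<Prod>y\<in>L. [:- y, 1:])) x = (\<Sum>a\<in>L. \<Prod>y\<in>L-{a}. x - y)"
    by (simp add: pderiv_prod poly_sum poly_prod pderiv_pCons)
  also have "\<dots> = (\<Sum>a\<in>L. if a = x then \<Prod>y\<in>L-{x}. x - y else 0)"
    using assms by (intro sum.cong refl) (auto simp: prod_zero_iff)
  finally show ?thesis using assms by simp
qed

lemma monic_poly_minus_infinity:
  fixes p :: "real poly"
  assumes "lead_coeff p = 1"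
  obtains x where "x < y" "(-1) ^ degree p * poly p x > 0"
proof -
  define r where "r = smult ((-1) ^ degree p) (pcompose p [:0, -1:])"
  have "lead_coeff (pcompose p [:0, -1:]) = (-1) ^ degree p"
    using assms by (subst lead_coeff_comp) auto
  then have "lead_coeff r = 1" by (simp add: r_def power_mult_distrib[symmetric])
  then obtain n where n: "\<And>x. x \<ge> n \<Longrightarrow> poly r x \<ge> 1"
    using poly_pinfty_gt_lc[of r] by auto
  have "poly r (max n (1 - y)) > 0" using n[of "max n (1 - y)"] by simp
  then show ?thesis by (intro that[of "- max n (1 - y)"]) (auto simp: r_def poly_pcompose)
qed

text \<open>At the roots of p the sign of pD is that of p', which alternates, so pD vanishes between
  neighbours. It vanishes once more below the smallest root, as its degree has the parity of
  \<open>card L\<close>. In the last claim the extra 1 counts the root of p right above s; this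
  offset turns the inequalities of the cell into nonnegative weights.\<close>

lemma interlacing_roots:
  fixes p pD :: "real poly"
  assumes L: "finite L" "L \<noteq> {}" and p: "p = (\<Prod>y\<in>L. [:- y, 1:])"
    and pD: "lead_coeff pD = 1" "degree pD = card L + 2"
    and pos: "\<And>x. x \<in> L \<Longrightarrow> poly pD x * poly (pderiv p) x > 0"
  obtains S where "finite S" "card S = card L" "\<And>s. s \<in> S \<Longrightarrow> poly pD s = 0" "\<And>s. s \<in> S \<Longrightarrow> s < Max L"
    "\<And>s. s \<in> S \<Longrightarrow> card {x\<in>L. x > s} = Suc (card {s'\<in>S. s' > s})"
proof -
  define N where "N x = card {y\<in>L. y > x}" for x
  have sq: "(-1) ^ N x * u * ((-1) ^ N x * v) = u * v" for x and u v :: real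
  proof -
    have "(-1) ^ N x * (-1) ^ N x = (1::real)" by (simp add: power_mult_distrib[symmetric])
    then have "((-1) ^ N x * (-1) ^ N x) * (u * v) = u * v" by simp
    then show ?thesis by (simp only: mult_ac)
  qed
  have sgn: "(-1) ^ N x * poly pD x > 0" if "x \<in> L" for x
  proof -
    have "{y \<in> L - {x}. y > x} = {y\<in>L. y > x}" by auto
    then have 1: "(-1) ^ N x * poly (pderiv p) x > 0"
      using sign_prod_linear[of "L - {x}" x] L by (simp add: N_def p pderiv_prod_linear_at_root that)
    have "(-1) ^ N x * poly pD x * ((-1) ^ N x * poly (pderiv p) x) > 0"
      unfolding sq by (rule pos[OF that])
    then show ?thesis using 1 by (simp add: zero_less_mult_iff)
  qed
  have "\<exists>r<x. poly pD r = 0 \<and> (\<forall>y\<in>L. y < x \<longrightarrow> y < r)" if x: "x \<in> L" for x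
  proof (cases "{y\<in>L. y < x} = {}")
    case True
    then have "{y\<in>L. y > x} = L - {x}" using x by force
    moreover have "card L > 0" using L by (simp add: card_gt_0_iff)
    ultimately have "Suc (N x) = card L" using L x by (simp add: N_def)
    \<comment> \<open>For the smallest root, \<open>N x = card L - 1\<close>. The numbers
      \<open>N x + 3\<close> and \<open>N x\<close> differ in parity, so pD has opposite signs at x
      and near minus infinity.\<close>
    then have d: "degree pD = N x + 3" using pD by simp
    obtain y where y: "y < x" "(-1) ^ degree pD * poly pD y > 0"
      using monic_poly_minus_infinity[OF pD(1)] by blast
    then have "(-1) ^ N x * poly pD y < 0" by (simp add: d power_add)
    then have "((-1) ^ N x * poly pD y) * ((-1) ^ N x * poly pD x) < 0"
      using sgn[OF x] by (rule mult_neg_pos)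
    then have "poly pD y * poly pD x < 0" unfolding sq .
    then obtain r where "y < r" "r < x" "poly pD r = 0" using poly_IVT[OF y(1)] by blast
    then show ?thesis using True by blast
  next
    case False
    define y where "y = Max {y\<in>L. y < x}"
    have fin: "finite {y\<in>L. y < x}" using L by simp
    have "y \<in> {y\<in>L. y < x}" unfolding y_def using fin False by (rule Max_in)
    then have y: "y \<in> L" "y < x" by auto
    have ymax: "z \<le> y" if "z \<in> L" "z < x" for z unfolding y_def using fin that by (intro Max_ge) auto
    have "{z\<in>L. z > y} = insert x {z\<in>L. z > x}" using x y ymax by force
    then have "N y = Suc (N x)" using L by (simp add: N_def)
    then have "(-1) ^ N x * poly pD y < 0" using sgn[OF y(1)] by simp
    then have "((-1) ^ N x * poly pD y) * ((-1) ^ N x * poly pD x) < 0"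
      using sgn[OF x] by (rule mult_neg_pos)
    then have "poly pD y * poly pD x < 0" unfolding sq .
    then obtain r where "y < r" "r < x" "poly pD r = 0" using poly_IVT[OF y(2)] by blast
    then show ?thesis using ymax by force
  qed
  then obtain r where r: "\<And>x. x \<in> L \<Longrightarrow> r x < x" "\<And>x. x \<in> L \<Longrightarrow> poly pD (r x) = 0"
    "\<And>x y. x \<in> L \<Longrightarrow> y \<in> L \<Longrightarrow> y < x \<Longrightarrow> y < r x" by metis
  have mono: "r y < r x \<longleftrightarrow> y < x" if "x \<in> L" "y \<in> L" for x y
    using r that by (metis less_trans linorder_neqE_linordered_idom less_irrefl)
  then have inj: "inj_on r L" by (metis inj_onI linorder_neqE_linordered_idom less_irrefl)
  show ?thesis
  proof (rule that[of "r ` L"])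
    show "finite (r ` L)" using L by simp
    show "card (r ` L) = card L" by (rule card_image[OF inj])
    fix s assume "s \<in> r ` L"
    then obtain x where x: "x \<in> L" "s = r x" by auto
    show "poly pD s = 0" using r x by simp
    have "r x < Max L" using r(1)[OF x(1)] L x by (meson Max_ge less_le_trans)
    then show "s < Max L" using x by simp
    have "{s' \<in> r ` L. s' > s} = r ` {y\<in>L. y > x}" using mono x by auto
    then have "card {s' \<in> r ` L. s' > s} = card {y\<in>L. y > x}"
      using inj by (simp add: card_image inj_on_subset)
    moreover have "{y\<in>L. y > s} = insert x {y\<in>L. y > x}"
    proof -
      have "y > s \<longleftrightarrow> x \<le> y" if "y \<in> L" for y
        using r(1)[OF x(1)] r(3)[OF x(1) that] x(2) by force
      then show ?thesis using x(1) by force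
    qed
    ultimately show "card {x\<in>L. x > s} = Suc (card {s' \<in> r ` L. s' > s})" using L by simp
  qed
qed

section \<open>Roots at a regular point\<close>

text \<open>A determinant in the form used by \<open>wedge_nonzero_at\<close>. Composition with the
  transposition of a and b changes the sign of every term and permutes the terms.\<close>

lemma alternating_sum_equal_rows:
  fixes F :: "'i \<Rightarrow> 'i \<Rightarrow> real"
  assumes I: "finite I" "a \<in> I" "b \<in> I" "a \<noteq> b" and eq: "\<And>j. j \<in> I \<Longrightarrow> F a j = F b j"
  shows "(\<Sum>\<sigma> | \<sigma> permutes I. of_int (sign \<sigma>) * (\<Prod>i\<in>I. F i (\<sigma> i))) = 0"
proof -
  let ?t = "Transposition.transpose a b"
  let ?f = "\<lambda>\<sigma>. of_int (sign \<sigma>) * (\<Prod>i\<in>I. F i (\<sigma> i))"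
  have t: "?t permutes I" using I by (simp add: permutes_swap_id)
  have "?f (\<sigma> \<circ> ?t) = - ?f \<sigma>" if \<sigma>: "\<sigma> permutes I" for \<sigma>
  proof -
    have "sign (\<sigma> \<circ> ?t) = - sign \<sigma>"
      using sign_compose[OF permutes_imp_permutation[OF I(1) \<sigma>] permutes_imp_permutation[OF I(1) t]] I(4)
      by (simp add: sign_swap_id)
    moreover have "(\<Prod>i\<in>I. F i ((\<sigma> \<circ> ?t) i)) = (\<Prod>i\<in>I. F i (\<sigma> i))"
    proof -
      have "(\<Prod>i\<in>I. F i ((\<sigma> \<circ> ?t) i)) = (\<Prod>i\<in>I. F (?t i) ((\<sigma> \<circ> ?t) (?t i)))"
        using prod.permute[OF t, of "\<lambda>i. F i ((\<sigma> \<circ> ?t) i)"] by (simp add: comp_def)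
      also have "\<dots> = (\<Prod>i\<in>I. F i (\<sigma> i))"
        using eq permutes_in_image[OF \<sigma>] I by (intro prod.cong refl) (auto simp: Transposition.transpose_def)
      finally show ?thesis .
    qed
    ultimately show ?thesis by simp
  qed
  moreover have "sum ?f {\<sigma>. \<sigma> permutes I} = sum (\<lambda>\<sigma>. ?f (\<sigma> \<circ> ?t)) {\<sigma>. \<sigma> permutes I}"
    by (rule sum.reindex_bij_witness[of _ "\<lambda>\<sigma>. \<sigma> \<circ> ?t" "\<lambda>\<sigma>. \<sigma> \<circ> ?t"])
      (auto simp: comp_assoc intro: permutes_compose[OF t])
  ultimately have "sum ?f {\<sigma>. \<sigma> permutes I} = - sum ?f {\<sigma>. \<sigma> permutes I}"
    by (simp add: sum_negf)
  then show ?thesis by simp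
qed

text \<open>Putting the vanishing combination into row a multiplies the determinant by
  \<open>\<gamma> a\<close>, since all other summands have two equal rows.\<close>

lemma alternating_sum_dependent_rows:
  fixes F :: "'i \<Rightarrow> 'i \<Rightarrow> real"
  assumes I: "finite I" "a \<in> I" and \<gamma>: "\<gamma> a \<noteq> 0" and dep: "\<And>j. j \<in> I \<Longrightarrow> (\<Sum>i\<in>I. \<gamma> i * F i j) = 0"
  shows "(\<Sum>\<sigma> | \<sigma> permutes I. of_int (sign \<sigma>) * (\<Prod>i\<in>I. F i (\<sigma> i))) = 0"
proof -
  define D where "D G = (\<Sum>\<sigma> | \<sigma> permutes I. of_int (sign \<sigma>) * (\<Prod>i\<in>I. G i (\<sigma> i)))" for G :: "'i \<Rightarrow> 'i \<Rightarrow> real"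
  have row: "(\<Prod>i\<in>I. (F(a := R)) i (\<sigma> i)) = R (\<sigma> a) * (\<Prod>i\<in>I-{a}. F i (\<sigma> i))" for R \<sigma>
    using I by (simp add: prod.remove[of I a])
  have "D (F(a := \<lambda>j. \<Sum>i\<in>I. \<gamma> i * F i j)) = (\<Sum>i\<in>I. \<gamma> i * D (F(a := F i)))"
    unfolding D_def row sum_distrib_left sum_distrib_right
    by (subst sum.swap) (simp add: mult_ac)
  also have "\<dots> = (\<Sum>i\<in>I. if i = a then \<gamma> a * D F else 0)"
  proof (rule sum.cong[OF refl])
    fix i assume i: "i \<in> I"
    show "\<gamma> i * D (F(a := F i)) = (if i = a then \<gamma> a * D F else 0)"
    proof (cases "i = a")
      case False
      have "D (F(a := F i)) = 0"
        unfolding D_def by (rule alternating_sum_equal_rows[OF I i]) (use False in auto)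
      then show ?thesis using False by simp
    qed simp
  qed
  also have "\<dots> = \<gamma> a * D F" using I by simp
  finally have "D (F(a := \<lambda>j. \<Sum>i\<in>I. \<gamma> i * F i j)) = \<gamma> a * D F" .
  moreover have "D (F(a := \<lambda>j. \<Sum>i\<in>I. \<gamma> i * F i j)) = 0"
    unfolding D_def row using dep I by (intro sum.neutral) (auto simp: permutes_in_image)
  ultimately show ?thesis using \<gamma> by (simp add: D_def)
qed

section \<open>Division by the constant factor and its compatibility with derivatives\<close>

lemma poly_mod_sum_left: "(\<Sum>i\<in>I. f i) mod q = (\<Sum>i\<in>I. f i mod q)" for q :: "'r::field poly"
  by (induction I rule: infinite_finite_induct) (simp_all add: poly_mod_add_left)

lemma poly_div_sum_left: "(\<Sum>i\<in>I. f i) div q = (\<Sum>i\<in>I. f i div q)" for q :: "'r::field poly"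
  by (induction I rule: infinite_finite_induct) (simp_all add: poly_div_add_left)

text \<open>Division by a fixed q is linear, so remainders can be differentiated through the
  coefficients.\<close>

lemma coeff_mod_expand:
  fixes p q :: "'r::field poly"
  assumes "degree p \<le> n"
  shows "coeff (p mod q) k = (\<Sum>j\<le>n. coeff p j * coeff (monom 1 j mod q) k)"
proof -
  have "p mod q = (\<Sum>j\<le>n. smult (coeff p j) (monom 1 j)) mod q"
    using poly_as_sum_of_monoms'[OF assms] by (simp add: smult_monom)
  then show ?thesis by (simp add: poly_mod_sum_left mod_smult_left coeff_sum)
qed

lemma poly_div_expand:
  fixes p q :: "'r::field poly"
  assumes "degree p \<le> n"
  shows "poly (p div q) x = (\<Sum>j\<le>n. coeff p j * poly (monom 1 j div q) x)"
proof -
  have "p div q = (\<Sum>j\<le>n. smult (coeff p j) (monom 1 j)) div q"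
    using poly_as_sum_of_monoms'[OF assms] by (simp add: smult_monom)
  then show ?thesis by (simp add: poly_div_sum_left div_smult_left poly_sum)
qed

lemma monom_div_monic:
  fixes q :: "'r::field poly"
  assumes "lead_coeff q = 1"
  shows "monom 1 (degree q) div q = 1"
proof -
  define r where "r = monom 1 (degree q) - q"
  have "q \<noteq> 0" using assms by auto
  have "r div q = 0"
  proof (cases "r = 0")
    case False
    have "degree r \<le> degree q" unfolding r_def by (intro degree_diff_le degree_monom_le) simp
    moreover have "coeff r (degree q) = 0" using assms by (simp add: r_def)
    ultimately have "degree r < degree q" using False by (metis le_neq_implies_less leading_coeff_0_iff)
    then show ?thesis by (rule div_poly_less)
  qed simp
  moreover have "monom 1 (degree q) = q + r" by (simp add: r_def)
  ultimately show ?thesis using \<open>q \<noteq> 0\<close> by (simp add: poly_div_add_left)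
qed

context bochner_kaehler_manifold
begin

text \<open>The remainder of p_h modulo q is 0 at every point and linear in the coefficients, so the
  differential has remainder 0 as well.\<close>

lemma dvd_dh_poly:
  assumes q: "\<And>y. q dvd h_poly A g H y" and sf: "spectral_frame c x B e l"
  shows "q dvd dh_poly c x B e l h"
proof -
  let ?n = "CARD('n)"
  have "coeff (dh_poly c x B e l h mod q) k = 0" for k
  proof -
    have "((\<lambda>z. coeff (h_poly A g H (chart_inv c z) mod q) k) has_derivative
        (\<lambda>h. \<Sum>j\<le>?n. coeff (dh_poly c x B e l h) j * coeff (monom 1 j mod q) k)) (at (snd c x))"
      unfolding coeff_mod_expand[OF eq_refl[OF degree_h_poly]]
      by (intro has_derivative_sum has_derivative_mult_left sf_coeff_derivative[OF sf])
    moreover have "((\<lambda>z. coeff (h_poly A g H (chart_inv c z) mod q) k) has_derivative (\<lambda>h. 0)) (at (snd c x))"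
      using q by (simp add: mod_eq_0_iff_dvd[THEN iffD2])
    ultimately have "(\<lambda>h. \<Sum>j\<le>?n. coeff (dh_poly c x B e l h) j * coeff (monom 1 j mod q) k) = (\<lambda>h. 0)"
      by (rule has_derivative_unique)
    from fun_cong[OF this, of h] show ?thesis
      using coeff_mod_expand[OF less_imp_le[OF degree_dh_poly[OF sf, of h]], of q k] by simp
  qed
  then have "dh_poly c x B e l h mod q = 0" by (intro poly_eqI) simp
  then show ?thesis by (simp add: mod_eq_0_iff_dvd)
qed

text \<open>The direction h with \<open>B h = T_k e_k\<close> isolates the k-th summand of
  \<open>dh_poly\<close>, with the nonzero factor \<open>-2 |T_k|^2\<close>.\<close>

lemma dvd_active_term:
  assumes q: "\<And>y. q dvd h_poly A g H y" and sf: "spectral_frame c x B e l" and T: "T_comp c x B e k \<noteq> 0"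
  shows "q dvd (\<Prod>j\<in>UNIV-{k}. [:- l j, 1:])"
proof -
  note fr = sf_frame[OF sf]
  have det: "det B \<noteq> 0" by (rule bundle_chart_invertible[OF sf_chart(1,3)[OF sf] fr(1)])
  define h where "h = Inv B *v (T_comp c x B e k *s e k)"
  have Bh: "B *v h = T_comp c x B e k *s e k" by (simp add: h_def Inv_mult_vec det)
  have "herm (e j) (B *v h) = (if j = k then T_comp c x B e k else 0)" for j
    using fr(2) by (simp add: Bh herm_scale_right onb_def)
  then have "dh_poly c x B e l h = (\<Sum>j\<in>UNIV. if j = k then
      smult (-2 * Re (cnj (T_comp c x B e k) * T_comp c x B e k)) (\<Prod>j\<in>UNIV-{k}. [:- l j, 1:]) else 0)"
    unfolding dh_poly_def[OF sf] by (intro sum.cong refl) auto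
  then have "dh_poly c x B e l h = smult (-2 * Re (cnj (T_comp c x B e k) * T_comp c x B e k)) (\<Prod>j\<in>UNIV-{k}. [:- l j, 1:])"
    by simp
  moreover have "Re (cnj (T_comp c x B e k) * T_comp c x B e k) = (cmod (T_comp c x B e k))\<^sup>2"
    unfolding cmod_power2 by (simp add: power2_eq_square)
  ultimately have "dh_poly c x B e l h = smult (-2 * (cmod (T_comp c x B e k))\<^sup>2) (\<Prod>j\<in>UNIV-{k}. [:- l j, 1:])"
    by (simp only:)
  then have "q dvd smult (-2 * (cmod (T_comp c x B e k))\<^sup>2) (\<Prod>j\<in>UNIV-{k}. [:- l j, 1:])"
    using dvd_dh_poly[OF q sf, of h] by (simp only:)
  then show ?thesis using T by (subst (asm) dvd_smult_iff) auto
qed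

text \<open>Makes the division that defines p_D exact: of the summands added to the multiple of p_h,
  those with \<open>T_k = 0\<close> vanish and the others are divisible by q.\<close>

lemma dvd_C_poly:
  assumes q: "\<And>y. q dvd h_poly A g H y"
  shows "q dvd C_poly A g H T V x"
proof -
  obtain c where "c \<in> charts_at A x" using charts_at_nonempty by blast
  then obtain B e l where sf: "spectral_frame c x B e l" using spectral_frame_exists by blast
  have "q dvd smult ((cmod (T_comp c x B e k))\<^sup>2) (\<Prod>j\<in>UNIV-{k}. [:- l j, 1:])" for k
    using dvd_active_term[OF q sf, of k] by (cases "T_comp c x B e k = 0") (auto intro: dvd_smult)
  moreover have "q dvd root_poly l" using q[of x] by (simp add: sf_h_poly[OF sf])
  ultimately show ?thesis
    unfolding sf_C_poly[OF sf] C_real_def by (intro dvd_add dvd_mult2 dvd_sum) auto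
qed

text \<open>If the components of \<open>T\<close> in the eigenspace of \<open>\<mu>\<close> vanish, then the functional
  \<open>s \<mapsto> (s div q)(\<mu>)\<close> annihilates all values of \<open>dp\<^sub>h\<close>, which is a linear relation between
  \<open>dh\<^sub>1, \<dots>, dh\<^sub>m\<close>.\<close>

lemma active_root:
  assumes q: "\<And>y. q dvd h_poly A g H y" "lead_coeff q = 1" "degree q + m = CARD('n)" and m: "m \<ge> 1"
    and wedge: "wedge_nonzero_at A m (h_fun A g H) x"
    and sf: "spectral_frame (some_chart A x) x B e l"
    and root: "q * p = root_poly l" "poly p \<mu> = 0"
  shows "(\<Sum>k | l k = \<mu>. (cmod (T_comp (some_chart A x) x B e k))\<^sup>2) > 0"
proof (rule ccontr)
  let ?c = "some_chart A x" and ?n = "CARD('n)"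
  let ?T = "T_comp ?c x B e" and ?dh = "dh_poly ?c x B e l"
  assume "\<not> ?thesis"
  moreover have "(\<Sum>k | l k = \<mu>. (cmod (?T k))\<^sup>2) \<ge> 0" by (intro sum_nonneg) auto
  ultimately have "(\<Sum>k | l k = \<mu>. (cmod (?T k))\<^sup>2) = 0" by linarith
  then have T0: "?T k = 0" if "l k = \<mu>" for k
    using that by (subst (asm) sum_nonneg_eq_0_iff) auto
  have q0: "q \<noteq> 0" using q(2) by auto
  have vanish: "poly (?dh h div q) \<mu> = 0" for h
  proof -
    \<comment> \<open>Here \<open>p = (t - l k) R\<close> with \<open>l k\<close> different from
      \<open>\<mu>\<close>, so R inherits the root \<open>\<mu>\<close>.\<close>
    have "poly (smult r (\<Prod>j\<in>UNIV-{k}. [:- l j, 1:]) div q) \<mu> = 0" if "?T k \<noteq> 0" for r k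
    proof -
      obtain R where R: "(\<Prod>j\<in>UNIV-{k}. [:- l j, 1:]) = q * R"
        using dvd_active_term[OF q(1) sf \<open>?T k \<noteq> 0\<close>] by blast
      have "q * p = [:- l k, 1:] * (\<Prod>j\<in>UNIV-{k}. [:- l j, 1:])"
        unfolding root root_poly_def by (rule prod.remove) auto
      then have "q * p = q * ([:- l k, 1:] * R)" unfolding R by (simp only: mult_ac)
      then have "p = [:- l k, 1:] * R" using q0 by simp
      moreover have "l k \<noteq> \<mu>" using T0 that by auto
      ultimately have "poly R \<mu> = 0" using root(2) by auto
      then show ?thesis by (simp add: R div_smult_left q0)
    qed
    then have "poly (smult (-2 * Re (cnj (herm (e k) (B *v h)) * ?T k)) (\<Prod>j\<in>UNIV-{k}. [:- l j, 1:]) div q) \<mu> = 0" for k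
      by (cases "?T k = 0") auto
    then show ?thesis unfolding dh_poly_def[OF sf] by (simp add: poly_div_sum_left poly_sum)
  qed
  \<comment> \<open>The coefficient of \<open>dh_k\<close> in the relation: the functional on the
    monomial of degree \<open>CARD('n) - k\<close>, with the sign by which \<open>h_k\<close>
    differs from the coefficient of p_h. For k = m the quotient is 1 because q is monic.\<close>
  define \<gamma> where "\<gamma> k = (-1) ^ k * poly (monom 1 (?n - k) div q) \<mu>" for k
  have \<gamma>m: "\<gamma> m \<noteq> 0"
  proof -
    have "?n - m = degree q" using q(3) by simp
    then show ?thesis using monom_div_monic[OF q(2)] by (simp add: \<gamma>_def)
  qed
  have diff: "differential A (h_fun A g H k) x v = (-1) ^ k * coeff (?dh (v ?c)) (?n - k)" if "k \<le> ?n" for k v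
  proof -
    have "((\<lambda>z. (-1) ^ k * coeff (h_poly A g H (chart_inv ?c z)) (?n - k)) has_derivative
       (\<lambda>h. (-1) ^ k * coeff (?dh h) (?n - k))) (at (snd ?c x))"
      by (intro has_derivative_mult_right sf_coeff_derivative[OF sf])
    then have "(h_fun A g H k \<circ> chart_inv ?c has_derivative (\<lambda>h. (-1) ^ k * coeff (?dh h) (?n - k))) (at (snd ?c x))"
      by (simp add: h_fun_eq[OF that] comp_def)
    from frechet_derivative_at[OF this] show ?thesis
      by (simp add: differential_def Let_def) metis
  qed
  have dep: "(\<Sum>k\<in>{1..m}. \<gamma> k * differential A (h_fun A g H k) x v) = 0" for v
  proof -
    have "0 = poly (?dh (v ?c) div q) \<mu>" by (simp add: vanish)
    also have "\<dots> = (\<Sum>j\<le>?n - 1. coeff (?dh (v ?c)) j * poly (monom 1 j div q) \<mu>)"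
      using degree_dh_poly[OF sf, of "v ?c"] by (intro poly_div_expand) simp
    \<comment> \<open>Monomials of degree below \<open>degree q = CARD('n) - m\<close> have quotient
      0, so only \<open>dh_1\<close> to \<open>dh_m\<close> occur.\<close>
    also have "\<dots> = (\<Sum>j\<in>{?n - m..?n - 1}. coeff (?dh (v ?c)) j * poly (monom 1 j div q) \<mu>)"
    proof (rule sum.mono_neutral_right)
      show "\<forall>j\<in>{..?n - 1} - {?n - m..?n - 1}. coeff (?dh (v ?c)) j * poly (monom 1 j div q) \<mu> = 0"
      proof
        fix j assume "j \<in> {..?n - 1} - {?n - m..?n - 1}"
        then have "j < degree q" using q(3) by auto
        then have "monom 1 j div q = 0" by (intro div_poly_less) (simp add: degree_monom_eq)
        then show "coeff (?dh (v ?c)) j * poly (monom 1 j div q) \<mu> = 0" by simp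
      qed
    qed auto
    also have "\<dots> = (\<Sum>k\<in>{1..m}. coeff (?dh (v ?c)) (?n - k) * poly (monom 1 (?n - k) div q) \<mu>)"
      using q(3) m
      by (intro sum.reindex_bij_witness[of _ "\<lambda>k. ?n - k" "\<lambda>j. ?n - j"]) auto
    also have "\<dots> = (\<Sum>k\<in>{1..m}. \<gamma> k * differential A (h_fun A g H k) x v)"
    proof (rule sum.cong[OF refl])
      fix k assume "k \<in> {1..m}"
      then have "k \<le> ?n" using q(3) by auto
      have "(-1) ^ k * (-1) ^ k = (1::real)" by (simp add: power_mult_distrib[symmetric])
      then show "coeff (?dh (v ?c)) (?n - k) * poly (monom 1 (?n - k) div q) \<mu> =
          \<gamma> k * differential A (h_fun A g H k) x v"
        unfolding diff[OF \<open>k \<le> ?n\<close>] \<gamma>_def by (simp add: algebra_simps)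
    qed
    finally show ?thesis by simp
  qed
  obtain v where "(\<Sum>\<sigma> | \<sigma> permutes {1..m}. of_int (sign \<sigma>) *
      (\<Prod>i\<in>{1..m}. differential A (h_fun A g H i) x (v (\<sigma> i)))) \<noteq> 0"
    using wedge unfolding wedge_nonzero_at_def by blast
  moreover have "(\<Sum>\<sigma> | \<sigma> permutes {1..m}. of_int (sign \<sigma>) *
      (\<Prod>i\<in>{1..m}. differential A (h_fun A g H i) x (v (\<sigma> i)))) = 0"
    using m \<gamma>m dep by (intro alternating_sum_dependent_rows[of "{1..m}" m \<gamma>]) auto
  ultimately show False by simp
qed

end

section \<open>The Riemannian distance\<close>

text \<open>Contrapositive of Ekeland's variational principle.\<close>

lemma ekeland_descent:
  fixes d :: "'p \<Rightarrow> 'p \<Rightarrow> real" and f :: "'p \<Rightarrow> real"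
  assumes d: "\<And>x y z. d x z \<le> d x y + d y z" "\<And>x y. d x y \<ge> 0" "\<And>x y. d x y = d y x" "\<And>x. d x x = 0"
    and complete: "\<And>\<sigma> :: nat \<Rightarrow> 'p. \<forall>\<epsilon>>0. \<exists>N. \<forall>i\<ge>N. \<forall>j\<ge>N. d (\<sigma> i) (\<sigma> j) < \<epsilon> \<Longrightarrow> \<exists>x. (\<lambda>i. d (\<sigma> i) x) \<longlonglongrightarrow> 0"
    and R: "x0 \<in> R" "\<And>\<sigma> x. (\<And>i. \<sigma> i \<in> R) \<Longrightarrow> (\<lambda>i. d (\<sigma> i) x) \<longlonglongrightarrow> 0 \<Longrightarrow> x \<in> R \<and> (\<lambda>i. f (\<sigma> i)) \<longlonglongrightarrow> f x"
    and f: "\<And>x. x \<in> R \<Longrightarrow> f x \<ge> 0" and c: "c > 0"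
    and descent: "\<And>x. x \<in> R \<Longrightarrow> \<exists>y\<in>R. f y < f x - c * d x y"
  shows False
proof -
  \<comment> \<open>The points that precede x in Ekeland's order; the sequence chosen below moves in
    \<open>S x\<close> to a value within \<open>(1/2) ^ k\<close> of the infimum.\<close>
  define S where "S x = {y\<in>R. c * d x y \<le> f x - f y}" for x
  have S_refl: "x \<in> S x" if "x \<in> R" for x using that d by (simp add: S_def)
  have bdd: "bdd_below (f ` S x)" for x by (rule bdd_belowI[of _ 0]) (auto simp: S_def f)
  have ex: "\<exists>y. y \<in> S x \<and> f y < Inf (f ` S x) + (1/2) ^ k" if "x \<in> R" for x and k :: nat
  proof -
    have lt: "Inf (f ` S x) < Inf (f ` S x) + (1/2) ^ k" by simp
    have "f ` S x \<noteq> {}" using S_refl[OF that] by auto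
    from cInf_lessD[OF this lt] obtain v where "v \<in> f ` S x" "v < Inf (f ` S x) + (1/2) ^ k" ..
    then show ?thesis by auto
  qed
  define next_pt where "next_pt k x = (SOME y. y \<in> S x \<and> f y < Inf (f ` S x) + (1/2) ^ k)" for k x
  have nx: "next_pt k x \<in> S x" "f (next_pt k x) < Inf (f ` S x) + (1/2) ^ k" if "x \<in> R" for k x
  proof -
    have "next_pt k x \<in> S x \<and> f (next_pt k x) < Inf (f ` S x) + (1/2) ^ k"
      unfolding next_pt_def by (rule someI_ex[OF ex[OF that]])
    then show "next_pt k x \<in> S x" "f (next_pt k x) < Inf (f ` S x) + (1/2) ^ k" by blast+
  qed
  define \<sigma> where "\<sigma> = rec_nat x0 next_pt"
  have \<sigma>0: "\<sigma> 0 = x0" and \<sigma>S: "\<sigma> (Suc k) = next_pt k (\<sigma> k)" for k by (simp_all add: \<sigma>_def)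
  have \<sigma>R: "\<sigma> k \<in> R" for k
  proof (induction k)
    case (Suc k)
    then show ?case using nx(1)[of "\<sigma> k" k] by (simp add: \<sigma>S S_def)
  qed (simp add: \<sigma>0 R)
  have step: "c * d (\<sigma> k) (\<sigma> (Suc k)) \<le> f (\<sigma> k) - f (\<sigma> (Suc k))" for k
    using nx(1)[OF \<sigma>R, of k k] by (simp add: \<sigma>S S_def)
  have chain: "c * d (\<sigma> i) (\<sigma> (i + k)) \<le> f (\<sigma> i) - f (\<sigma> (i + k))" for i k
  proof (induction k)
    case (Suc k)
    have "c * d (\<sigma> i) (\<sigma> (i + Suc k)) \<le> c * (d (\<sigma> i) (\<sigma> (i + k)) + d (\<sigma> (i + k)) (\<sigma> (Suc (i + k))))"
      using c d(1) by (intro mult_left_mono) auto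
    then show ?case using Suc step[of "i + k"] by (simp add: algebra_simps)
  qed (simp add: d)
  have dec: "f (\<sigma> (Suc k)) \<le> f (\<sigma> k)" for k
    using step[of k] mult_nonneg_nonneg[of c "d (\<sigma> k) (\<sigma> (Suc k))"] c d(2) by fastforce
  then have "decseq (\<lambda>k. f (\<sigma> k))" by (simp add: decseq_Suc_iff)
  moreover have "bounded (range (\<lambda>k. f (\<sigma> k)))"
  proof (rule boundedI)
    fix v assume "v \<in> range (\<lambda>k. f (\<sigma> k))"
    then obtain k where "v = f (\<sigma> k)" by auto
    moreover have "f (\<sigma> k) \<le> f (\<sigma> 0)" using \<open>decseq (\<lambda>k. f (\<sigma> k))\<close> by (simp add: decseq_def)
    ultimately show "norm v \<le> f (\<sigma> 0)" using f[OF \<sigma>R, of k] by simp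
  qed
  ultimately have conv: "convergent (\<lambda>k. f (\<sigma> k))"
    by (metis Bseq_eq_bounded Bseq_monoseq_convergent decseq_imp_monoseq)
  then have "Cauchy (\<lambda>k. f (\<sigma> k))" by (rule convergent_Cauchy)
  have "\<forall>\<epsilon>>0. \<exists>N. \<forall>i\<ge>N. \<forall>j\<ge>N. d (\<sigma> i) (\<sigma> j) < \<epsilon>"
  proof (intro allI impI)
    fix \<epsilon> :: real assume "\<epsilon> > 0"
    then obtain N where N: "\<And>i j. i \<ge> N \<Longrightarrow> j \<ge> N \<Longrightarrow> dist (f (\<sigma> i)) (f (\<sigma> j)) < c * \<epsilon>"
      using \<open>Cauchy (\<lambda>k. f (\<sigma> k))\<close> c unfolding Cauchy_def by (meson mult_pos_pos)
    have main: "d (\<sigma> i) (\<sigma> j) < \<epsilon>" if "i \<ge> N" "j \<ge> N" "i \<le> j" for i j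
    proof -
      from \<open>i \<le> j\<close> obtain k where k: "j = i + k" using le_Suc_ex by blast
      have "c * d (\<sigma> i) (\<sigma> j) < c * \<epsilon>"
        using chain[of i k] N[OF that(1,2)] by (simp add: k dist_real_def)
      then show ?thesis using c by simp
    qed
    then have "d (\<sigma> i) (\<sigma> j) < \<epsilon>" if "i \<ge> N" "j \<ge> N" for i j
    proof (cases "i \<le> j")
      case False
      then have "d (\<sigma> j) (\<sigma> i) < \<epsilon>" using main that by simp
      then show ?thesis by (subst d(3))
    qed (use main that in blast)
    then show "\<exists>N. \<forall>i\<ge>N. \<forall>j\<ge>N. d (\<sigma> i) (\<sigma> j) < \<epsilon>" by blast
  qed
  then obtain x where lim: "(\<lambda>i. d (\<sigma> i) x) \<longlonglongrightarrow> 0" using complete by blast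
  then have x: "x \<in> R" "(\<lambda>i. f (\<sigma> i)) \<longlonglongrightarrow> f x" using R(2)[OF \<sigma>R] by auto
  have fx: "f x \<le> f (\<sigma> i)" for i
    using \<open>decseq (\<lambda>k. f (\<sigma> k))\<close> x(2) by (rule decseq_ge)
  obtain y where y: "y \<in> R" "f y < f x - c * d x y" using descent[OF x(1)] by blast
  \<comment> \<open>The strict descent at the limit x leaves a margin, so y eventually lies in
    \<open>S (\<sigma> i)\<close>; the near-minimal choice of the next point then gives
    \<open>f x <= f y\<close>.\<close>
  define s where "s = f x - c * d x y - f y"
  have s: "s > 0" using y by (simp add: s_def)
  have "(\<lambda>i. c * d (\<sigma> i) x) \<longlonglongrightarrow> c * 0" by (intro tendsto_intros lim)
  then have "\<forall>\<^sub>F i in sequentially. c * d (\<sigma> i) x < s" using s by (intro order_tendstoD(2)[of _ 0]) auto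
  then have "\<forall>\<^sub>F i in sequentially. f (\<sigma> (Suc i)) \<le> f y + (1/2) ^ i"
  proof eventually_elim
    case (elim i)
    have "c * d (\<sigma> i) y \<le> c * (d (\<sigma> i) x + d x y)" using c d(1) by (intro mult_left_mono) auto
    then have "c * d (\<sigma> i) y \<le> f (\<sigma> i) - f y"
      using elim fx[of i] by (simp add: s_def algebra_simps)
    then have "y \<in> S (\<sigma> i)" using y by (simp add: S_def)
    then have "Inf (f ` S (\<sigma> i)) \<le> f y" using bdd by (intro cInf_lower) auto
    then show ?case using nx(2)[OF \<sigma>R, of i i] by (simp add: \<sigma>S)
  qed
  moreover have "(\<lambda>i. f (\<sigma> (Suc i))) \<longlonglongrightarrow> f x" using x(2) by (rule LIMSEQ_Suc)
  moreover have "(\<lambda>i. f y + (1/2) ^ i) \<longlonglongrightarrow> f y + 0"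
    by (intro tendsto_intros LIMSEQ_power_zero) simp
  ultimately have "f x \<le> f y + 0" by (intro tendsto_le[OF sequentially_bot, rotated]) 
  moreover have "c * d x y \<ge> 0" using c d(2) by simp
  ultimately show False using y by linarith
qed

section \<open>Rectifiable curves, their speed and length\<close>

context kaehler
begin

lemma velocity_eq:
  assumes c: "c \<in> A" "\<gamma> t \<in> fst c" and D: "((snd c \<circ> \<gamma>) has_vector_derivative w) (at t)" and cont: "isCont \<gamma> t"
  shows "velocity A \<gamma> t = coord_vector A c (\<gamma> t) w"
proof
  fix c'
  have cc: "c \<in> charts_at A (\<gamma> t)" using c by (simp add: charts_at_iff)
  show "velocity A \<gamma> t c' = coord_vector A c (\<gamma> t) w c'"
  proof (cases "c' \<in> charts_at A (\<gamma> t)")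
    case True
    have "((\<lambda>s. (snd c' \<circ> chart_inv c) ((snd c \<circ> \<gamma>) s)) has_derivative (\<lambda>h. J c c' (\<gamma> t) (h *\<^sub>R w))) (at t)"
      by (rule has_derivative_compose[OF D[unfolded has_vector_derivative_def]])
        (simp add: transition_derivative(1)[OF cc True, unfolded comp_def] comp_def)
    moreover have "\<forall>\<^sub>F s in at t. (snd c' \<circ> chart_inv c) ((snd c \<circ> \<gamma>) s) = (snd c' \<circ> \<gamma>) s"
    proof -
      have "\<forall>\<^sub>F s in at t. \<gamma> s \<in> fst c"
        using cont open_chart[OF c(1)] c(2) by (simp add: isCont_def topological_tendstoD)
      then show ?thesis by eventually_elim (simp add: chart_inv_chart[OF c(1)])
    qed
    ultimately have "((snd c' \<circ> \<gamma>) has_derivative (\<lambda>h. J c c' (\<gamma> t) (h *\<^sub>R w))) (at t)"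
      by (rule has_derivative_transform_eventually) (simp_all add: chart_inv_chart[OF c])
    then have "((snd c' \<circ> \<gamma>) has_vector_derivative J c c' (\<gamma> t) w) (at t)"
      by (simp add: has_vector_derivative_def linear_scale[OF J_linear[OF cc True]])
    then show ?thesis using True by (simp add: velocity_def coord_vector_apply vector_derivative_at)
  qed (simp add: velocity_def coord_vector_apply)
qed

lemma speed_eq:
  assumes c: "c \<in> A" "\<gamma> t \<in> fst c" and D: "((snd c \<circ> \<gamma>) has_vector_derivative w) (at t)" and cont: "isCont \<gamma> t"
  shows "speed A g \<gamma> t = sqrt (gc c (snd c (\<gamma> t)) w w)"
  using velocity_eq[where \<gamma> = \<gamma> and t = t and c = c, OF assms] by (simp add: speed_def gc_def chart_inv_chart[OF c])

definition smooth_at :: "(real \<Rightarrow> 'a) \<Rightarrow> real \<Rightarrow> bool" where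
  "smooth_at \<gamma> t \<longleftrightarrow> isCont \<gamma> t \<and> (\<forall>c\<in>A. \<gamma> t \<in> fst c \<longrightarrow> (snd c \<circ> \<gamma>) differentiable (at t))"

lemma smooth_atE:
  assumes "smooth_at \<gamma> t" "c \<in> A" "\<gamma> t \<in> fst c"
  obtains w where "((snd c \<circ> \<gamma>) has_vector_derivative w) (at t)" "isCont \<gamma> t"
    "speed A g \<gamma> t = sqrt (gc c (snd c (\<gamma> t)) w w)"
proof -
  have d: "(snd c \<circ> \<gamma>) differentiable (at t)" "isCont \<gamma> t" using assms by (auto simp: smooth_at_def)
  then have "((snd c \<circ> \<gamma>) has_vector_derivative vector_derivative (snd c \<circ> \<gamma>) (at t)) (at t)"
    by (simp add: vector_derivative_works)
  from that[OF this d(2) speed_eq[where \<gamma> = \<gamma> and t = t and c = c, OF assms(2,3) this d(2)]] show ?thesis .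
qed

lemma gc_nonneg: "c \<in> A \<Longrightarrow> z \<in> chart_image c \<Longrightarrow> gc c z w w \<ge> 0"
  using gc_bilinear(5)[of c z w] gc_bilinear(2)[of c z 0 0 0] by (cases "w = 0") auto

lemma speed_nonneg:
  assumes "smooth_at \<gamma> t"
  shows "speed A g \<gamma> t \<ge> 0"
proof -
  obtain c where "c \<in> charts_at A (\<gamma> t)" using charts_at_nonempty by blast
  then have c: "c \<in> A" "\<gamma> t \<in> fst c" by (auto simp: charts_at_iff)
  from smooth_atE[OF assms c] obtain w where "speed A g \<gamma> t = sqrt (gc c (snd c (\<gamma> t)) w w)" by metis
  then show ?thesis using gc_nonneg[OF c(1) chart_in[OF c]] by simp
qed

text \<open>The end points are put into F because a path is continuous there from one side only,
  whereas \<open>smooth_at\<close> is two-sided.\<close>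

definition regular_off :: "(real \<Rightarrow> 'a) \<Rightarrow> real set \<Rightarrow> bool" where
  "regular_off \<gamma> F \<longleftrightarrow> finite F \<and> 0 \<in> F \<and> 1 \<in> F \<and> (\<forall>t\<in>{0..1} - F. smooth_at \<gamma> t) \<and>
    (\<forall>c\<in>A. (snd c \<circ> \<gamma>) C1_differentiable_on {t \<in> {0..1} - F. \<gamma> t \<in> fst c})"

lemma regular_offD:
  assumes "regular_off \<gamma> F"
  shows "finite F" "0 \<in> F" "1 \<in> F" "t \<in> {0..1} - F \<Longrightarrow> smooth_at \<gamma> t"
    "c \<in> A \<Longrightarrow> (snd c \<circ> \<gamma>) C1_differentiable_on {t \<in> {0..1} - F. \<gamma> t \<in> fst c}"
  using assms unfolding regular_off_def by blast+

lemma rectifiable_regular_off: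
  assumes "rectifiable_curve A g \<gamma>"
  shows "\<exists>F. regular_off \<gamma> F"
proof -
  obtain F where F: "finite F" "\<And>c. c \<in> A \<Longrightarrow> (snd c \<circ> \<gamma>) C1_differentiable_on {t \<in> {0..1} - F. \<gamma> t \<in> fst c}"
    and path: "path \<gamma>"
    using assms unfolding rectifiable_curve_def by blast
  have "regular_off \<gamma> (F \<union> {0, 1})"
    unfolding regular_off_def
  proof (intro conjI ballI)
    fix t :: real assume t: "t \<in> {0..1} - (F \<union> {0, 1})"
    have "continuous_on {0<..<1} \<gamma>" using path unfolding path_def by (rule continuous_on_subset) auto
    then have "isCont \<gamma> t" using t by (simp add: continuous_on_eq_continuous_at)
    moreover have "(snd c \<circ> \<gamma>) differentiable (at t)" if "c \<in> A" "\<gamma> t \<in> fst c" for c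
      using F(2)[OF that(1)] t that(2) unfolding C1_differentiable_on_eq by auto
    ultimately show "smooth_at \<gamma> t" by (simp add: smooth_at_def)
  next
    fix c assume "c \<in> A"
    show "(snd c \<circ> \<gamma>) C1_differentiable_on {t \<in> {0..1} - (F \<union> {0, 1}). \<gamma> t \<in> fst c}"
      by (rule C1_differentiable_on_subset[OF F(2)[OF \<open>c \<in> A\<close>]]) auto
  qed (use F in auto)
  then show ?thesis by blast
qed

definition curve_length :: "(real \<Rightarrow> 'a) \<Rightarrow> real" where
  "curve_length \<gamma> = integral {0..1} (speed A g \<gamma>)"

lemma curve_length_has_integral:
  "rectifiable_curve A g \<gamma> \<Longrightarrow> (speed A g \<gamma> has_integral curve_length \<gamma>) {0..1}"
  unfolding curve_length_def rectifiable_curve_def by (simp add: integrable_integral)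

lemma curve_length_nonneg:
  assumes "rectifiable_curve A g \<gamma>"
  shows "curve_length \<gamma> \<ge> 0"
proof -
  obtain F where "regular_off \<gamma> F" using rectifiable_regular_off[OF assms] by blast
  note F = regular_offD(1,4)[OF this]
  \<comment> \<open>At the points of F the speed is uncontrolled; it is replaced by 0 there.\<close>
  have "((\<lambda>t. if t \<in> F then 0 else speed A g \<gamma> t) has_integral curve_length \<gamma>) {0..1}"
    by (rule has_integral_spike_finite[OF F(1) _ curve_length_has_integral[OF assms]]) auto
  then show ?thesis by (rule has_integral_nonneg) (use F speed_nonneg in auto)
qed

end

section \<open>Reparametrization, concatenation and reversal of curves\<close>

lemma C1_differentiable_on_local:
  fixes f :: "real \<Rightarrow> 'b::real_normed_vector"
  assumes "\<And>t. t \<in> S \<Longrightarrow> \<exists>I. open I \<and> t \<in> I \<and> f C1_differentiable_on (S \<inter> I)"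
  shows "f C1_differentiable_on S"
  unfolding C1_differentiable_on_eq
proof (intro conjI ballI)
  fix t assume "t \<in> S"
  then show "f differentiable (at t)" using assms[of t] by (auto simp: C1_differentiable_on_eq)
next
  show "continuous_on S (\<lambda>x. vector_derivative f (at x))"
    unfolding continuous_on_eq_continuous_within
  proof
    fix t assume t: "t \<in> S"
    then obtain I where I: "open I" "t \<in> I" "f C1_differentiable_on (S \<inter> I)" using assms by blast
    then have "continuous (at t within (S \<inter> I)) (\<lambda>x. vector_derivative f (at x))"
      using t by (simp add: C1_differentiable_on_eq continuous_on_eq_continuous_within)
    moreover have "at t within (S \<inter> I) = at t within S"
      by (rule at_within_nhd[OF I(2,1)]) auto
    ultimately show "continuous (at t within S) (\<lambda>x. vector_derivative f (at x))" by simp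
  qed
qed

lemma C1_differentiable_on_reparam:
  fixes f :: "real \<Rightarrow> 'b::real_normed_vector"
  assumes f: "f C1_differentiable_on S" and I: "open I" and eq: "\<And>s. s \<in> I \<Longrightarrow> f' s = f (a * s + b)"
    and S': "\<And>s. s \<in> S' \<Longrightarrow> s \<in> I \<and> a * s + b \<in> S"
  shows "f' C1_differentiable_on S'"
proof -
  obtain D where D: "\<And>x. x \<in> S \<Longrightarrow> (f has_vector_derivative D x) (at x)" "continuous_on S D"
    using f unfolding C1_differentiable_on_def by blast
  have "(f' has_vector_derivative a *\<^sub>R D (a * s + b)) (at s)" if s: "s \<in> S'" for s
  proof -
    have "((\<lambda>s. a * s + b) has_vector_derivative a) (at s)"
      by (auto intro!: derivative_eq_intros simp: has_real_derivative_iff_has_vector_derivative[symmetric])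
    from vector_diff_chain_at[OF this D(1)]
    have "((\<lambda>s. f (a * s + b)) has_vector_derivative a *\<^sub>R D (a * s + b)) (at s)"
      using S'[OF s] by (simp add: comp_def)
    then show ?thesis
      by (rule has_vector_derivative_transform_within_open[OF _ I]) (use S'[OF s] eq in auto)
  qed
  moreover have "continuous_on S' (\<lambda>s. a *\<^sub>R D (a * s + b))"
  proof -
    have "continuous_on S' (\<lambda>s. a * s + b)" by (intro continuous_intros)
    from continuous_on_compose2[OF D(2) this] have "continuous_on S' (\<lambda>s. D (a * s + b))"
      using S' by blast
    then show ?thesis by (intro continuous_on_scaleR continuous_on_const)
  qed
  ultimately show ?thesis
    unfolding C1_differentiable_on_def by (intro exI[of _ "\<lambda>s. a *\<^sub>R D (a * s + b)"] conjI ballI)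
qed

lemma has_integral_reparam:
  fixes f :: "real \<Rightarrow> real"
  assumes "(f has_integral i) {0..1}" "a \<noteq> 0"
  shows "((\<lambda>t. \<bar>a\<bar> * f (a * t + b)) has_integral i) ((\<lambda>t. (t - b) / a) ` {0..1})"
proof -
  have "((\<lambda>x. f (a *\<^sub>R x + b)) has_integral (1 / (\<bar>a\<bar> ^ DIM(real))) *\<^sub>R i)
      ((\<lambda>x. (1 / a) *\<^sub>R x + - ((1 / a) *\<^sub>R b)) ` cbox 0 1)"
    using assms by (intro has_integral_affinity) auto
  from has_integral_mult_right[OF this, of "\<bar>a\<bar>"] show ?thesis
    using assms(2) by (simp add: diff_divide_distrib)
qed

context kaehler
begin

lemma gc_scaleR:
  assumes "c \<in> A" "z \<in> chart_image c"
  shows "gc c z (r *\<^sub>R w) (r *\<^sub>R w) = r\<^sup>2 * gc c z w w"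
  using gc_bilinear(2,3)[OF assms] by (simp add: power2_eq_square)

lemma smooth_at_reparam:
  assumes s: "smooth_at \<gamma> (a * t + b)" and a: "a \<noteq> 0" and I: "open I" "t \<in> I"
    and eq: "\<And>s. s \<in> I \<Longrightarrow> \<gamma>' s = \<gamma> (a * s + b)"
  shows "smooth_at \<gamma>' t" "speed A g \<gamma>' t = \<bar>a\<bar> * speed A g \<gamma> (a * t + b)"
proof -
  have ev: "\<forall>\<^sub>F s in nhds t. \<gamma>' s = \<gamma> (a * s + b)"
    using eventually_nhds_in_open[OF I] by eventually_elim (rule eq)
  have t: "\<gamma>' t = \<gamma> (a * t + b)" by (rule eq[OF I(2)])
  have "isCont (\<lambda>s. \<gamma> (a * s + b)) t"
    by (rule isCont_o2[of t "\<lambda>s. a * s + b"]) (use s in \<open>auto simp: smooth_at_def intro!: continuous_intros\<close>)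
  then have cont: "isCont \<gamma>' t" using isCont_cong[OF ev] by simp
  have D: "((snd c \<circ> \<gamma>') has_vector_derivative a *\<^sub>R w) (at t)"
    if "((snd c \<circ> \<gamma>) has_vector_derivative w) (at (a * t + b))" for c :: "('a, 'n) chart" and w
  proof -
    have "((\<lambda>s. a * s + b) has_vector_derivative a) (at t)"
      by (auto intro!: derivative_eq_intros simp: has_real_derivative_iff_has_vector_derivative[symmetric])
    from vector_diff_chain_at[OF this that]
    have "((\<lambda>s. snd c (\<gamma> (a * s + b))) has_vector_derivative a *\<^sub>R w) (at t)"
      by (simp add: comp_def)
    then show ?thesis
      by (rule has_vector_derivative_transform_within_open[OF _ I]) (simp add: eq)
  qed
  have diff: "(snd c \<circ> \<gamma>') differentiable (at t)" if "c \<in> A" "\<gamma>' t \<in> fst c" for c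
  proof -
    have "\<gamma> (a * t + b) \<in> fst c" using that(2) t by simp
    then obtain w where "((snd c \<circ> \<gamma>) has_vector_derivative w) (at (a * t + b))"
      by (rule smooth_atE[OF s \<open>c \<in> A\<close>])
    from D[OF this] show ?thesis by (rule differentiableI_vector)
  qed
  then show "smooth_at \<gamma>' t" using cont by (simp add: smooth_at_def)
  obtain c where "c \<in> charts_at A (\<gamma> (a * t + b))" using charts_at_nonempty by blast
  then have c: "c \<in> A" "\<gamma> (a * t + b) \<in> fst c" by (auto simp: charts_at_iff)
  obtain w where w: "((snd c \<circ> \<gamma>) has_vector_derivative w) (at (a * t + b))"
    "speed A g \<gamma> (a * t + b) = sqrt (gc c (snd c (\<gamma> (a * t + b))) w w)"
    by (rule smooth_atE[OF s c])
  have "speed A g \<gamma>' t = sqrt (gc c (snd c (\<gamma>' t)) (a *\<^sub>R w) (a *\<^sub>R w))"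
    by (rule speed_eq[where \<gamma> = \<gamma>' and t = t and c = c, OF c(1) _ D[OF w(1)] cont]) (simp add: t c)
  then show "speed A g \<gamma>' t = \<bar>a\<bar> * speed A g \<gamma> (a * t + b)"
    using gc_scaleR[OF c(1) chart_in[OF c]] by (simp add: t w(2) real_sqrt_mult)
qed

lemma rectifiableI:
  assumes "path \<gamma>" "finite F" "\<And>c. c \<in> A \<Longrightarrow> (snd c \<circ> \<gamma>) C1_differentiable_on {t \<in> {0..1} - F. \<gamma> t \<in> fst c}"
    "(speed A g \<gamma> has_integral L) {0..1}"
  shows "rectifiable_curve A g \<gamma>" "curve_length \<gamma> = L"
proof -
  show "rectifiable_curve A g \<gamma>"
    unfolding rectifiable_curve_def
    by (intro conjI exI[of _ F] ballI assms(1,2) has_integral_integrable[OF assms(4)]) (rule assms(3))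
  show "curve_length \<gamma> = L" unfolding curve_length_def using assms(4) by (rule integral_unique)
qed

lemma rectifiable_join:
  assumes r1: "rectifiable_curve A g \<gamma>1" and r2: "rectifiable_curve A g \<gamma>2"
    and ends: "pathfinish \<gamma>1 = pathstart \<gamma>2"
  shows "rectifiable_curve A g (\<gamma>1 +++ \<gamma>2)" "curve_length (\<gamma>1 +++ \<gamma>2) = curve_length \<gamma>1 + curve_length \<gamma>2"
proof -
  let ?\<gamma> = "\<gamma>1 +++ \<gamma>2"
  obtain F1 where "regular_off \<gamma>1 F1" using rectifiable_regular_off[OF r1] by blast
  note F1 = regular_offD[OF this]
  obtain F2 where "regular_off \<gamma>2 F2" using rectifiable_regular_off[OF r2] by blast
  note F2 = regular_offD[OF this]
  define F where "F = (\<lambda>t. t / 2) ` F1 \<union> (\<lambda>t. (t + 1) / 2) ` F2"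
  have F: "finite F" using F1 F2 by (simp add: F_def)
  \<comment> \<open>Since 1 belongs to F1. A point off F therefore lies strictly on one side, where
    the join is an affine reparametrization of one of the curves.\<close>
  have half: "1 / 2 \<in> F" using F1(3) by (auto simp: F_def)
  have inF1: "2 * t \<in> {0..1} - F1" if "t \<in> {0..1} - F" "t < 1/2" for t
  proof -
    have "2 * t \<notin> F1"
    proof
      assume "2 * t \<in> F1"
      then have "2 * t / 2 \<in> F" unfolding F_def by blast
      then show False using that by simp
    qed
    then show ?thesis using that by auto
  qed
  have inF2: "2 * t + - 1 \<in> {0..1} - F2" if "t \<in> {0..1} - F" "t > 1/2" for t
  proof -
    have "2 * t + - 1 \<notin> F2"
    proof
      assume "2 * t + - 1 \<in> F2"
      then have "(2 * t + - 1 + 1) / 2 \<in> F" unfolding F_def by blast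
      then show False using that by simp
    qed
    then show ?thesis using that by auto
  qed
  have eq1: "?\<gamma> s = \<gamma>1 (2 * s + 0)" if "s \<in> {..<1/2}" for s using that by (simp add: joinpaths_def)
  have eq2: "?\<gamma> s = \<gamma>2 (2 * s + - 1)" if "s \<in> {1/2<..}" for s using that by (simp add: joinpaths_def)
  have sp1: "speed A g ?\<gamma> t = 2 * speed A g \<gamma>1 (2 * t)" if "t \<in> {0..1} - F" "t < 1/2" for t
  proof -
    have "speed A g ?\<gamma> t = \<bar>2\<bar> * speed A g \<gamma>1 (2 * t + 0)"
      by (rule smooth_at_reparam(2)[where I = "{..<1/2}"]) (use F1(4)[OF inF1[OF that]] that eq1 in simp_all)
    then show ?thesis by simp
  qed
  have sp2: "speed A g ?\<gamma> t = 2 * speed A g \<gamma>2 (2 * t + - 1)" if "t \<in> {0..1} - F" "t > 1/2" for t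
  proof -
    have "speed A g ?\<gamma> t = \<bar>2\<bar> * speed A g \<gamma>2 (2 * t + - 1)"
      by (rule smooth_at_reparam(2)[where I = "{1/2<..}"]) (use F2(4)[OF inF2[OF that]] that eq2 in simp_all)
    then show ?thesis by simp
  qed
  have "((\<lambda>t. \<bar>2\<bar> * speed A g \<gamma>1 (2 * t + 0)) has_integral curve_length \<gamma>1) {0..1/2}"
    using has_integral_reparam[OF curve_length_has_integral[OF r1], of 2 0] by simp
  then have i1: "(speed A g ?\<gamma> has_integral curve_length \<gamma>1) {0..1/2}"
  proof (rule has_integral_spike_finite[OF F, rotated])
    fix t assume "t \<in> {0..1/2} - F"
    moreover from this have "t \<noteq> 1/2" using half by blast
    ultimately have "t \<in> {0..1} - F" "t < 1/2" by (auto simp del: divide_less_eq_numeral1 less_divide_eq_numeral1)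
    then show "speed A g ?\<gamma> t = \<bar>2\<bar> * speed A g \<gamma>1 (2 * t + 0)" using sp1 by simp
  qed
  have "(\<lambda>t. (t - -1) / 2) ` {0..1} = {1/2..1::real}"
  proof -
    have e: "(\<lambda>t. (t - -1) / 2) = (\<lambda>t::real. t / 2 + 1 / 2)" by (simp add: add_divide_distrib)
    show ?thesis unfolding e using image_affinity_atLeastAtMost_div[of 2 "1/2" 0 "1::real"] by simp
  qed
  then have "((\<lambda>t. \<bar>2\<bar> * speed A g \<gamma>2 (2 * t + -1)) has_integral curve_length \<gamma>2) {1/2..1}"
    using has_integral_reparam[OF curve_length_has_integral[OF r2], of 2 "-1"] by simp
  then have i2: "(speed A g ?\<gamma> has_integral curve_length \<gamma>2) {1/2..1}"
  proof (rule has_integral_spike_finite[OF F, rotated])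
    fix t assume "t \<in> {1/2..1} - F"
    moreover from this have "t \<noteq> 1/2" using half by blast
    ultimately have "t \<in> {0..1} - F" "t > 1/2" by (auto simp del: divide_less_eq_numeral1 less_divide_eq_numeral1)
    then show "speed A g ?\<gamma> t = \<bar>2\<bar> * speed A g \<gamma>2 (2 * t + -1)" using sp2 by simp
  qed
  have int: "(speed A g ?\<gamma> has_integral (curve_length \<gamma>1 + curve_length \<gamma>2)) {0..1}"
    by (rule has_integral_combine[OF _ _ i1 i2]) auto
  have C1: "(snd c \<circ> ?\<gamma>) C1_differentiable_on {t \<in> {0..1} - F. ?\<gamma> t \<in> fst c}" if c: "c \<in> A" for c
  proof (rule C1_differentiable_on_local)
    let ?S = "{t \<in> {0..1} - F. ?\<gamma> t \<in> fst c}"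
    have aux1: "2 * s + 0 \<in> {t \<in> {0..1} - F1. \<gamma>1 t \<in> fst c}" if "s \<in> ?S \<inter> {..<1/2}" for s
      using that inF1[of s] eq1[of s] by simp
    have aux2: "2 * s + - 1 \<in> {t \<in> {0..1} - F2. \<gamma>2 t \<in> fst c}" if "s \<in> ?S \<inter> {1/2<..}" for s
      using that inF2[of s] eq2[of s] by simp
    fix t assume t: "t \<in> ?S"
    then have "t \<noteq> 1/2" using half by blast
    then consider "t < 1/2" | "t > 1/2" by linarith
    then show "\<exists>I. open I \<and> t \<in> I \<and> (snd c \<circ> ?\<gamma>) C1_differentiable_on (?S \<inter> I)"
    proof cases
      case 1
      have "(snd c \<circ> ?\<gamma>) C1_differentiable_on (?S \<inter> {..<1/2})"
        by (rule C1_differentiable_on_reparam[OF F1(5)[OF c] open_lessThan[of "1/2"], where a = 2 and b = 0])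
          (simp only: comp_apply eq1, rule conjI, blast, rule aux1)
      then show ?thesis using 1 by (intro exI[of _ "{..<1/2}"]) auto
    next
      case 2
      have "(snd c \<circ> ?\<gamma>) C1_differentiable_on (?S \<inter> {1/2<..})"
        by (rule C1_differentiable_on_reparam[OF F2(5)[OF c] open_greaterThan[of "1/2"], where a = 2 and b = "-1"])
          (simp only: comp_apply eq2, rule conjI, blast, rule aux2)
      then show ?thesis using 2 by (intro exI[of _ "{1/2<..}"]) auto
    qed
  qed
  have path: "path ?\<gamma>" using r1 r2 ends by (simp add: rectifiable_curve_def)
  show "rectifiable_curve A g ?\<gamma>" "curve_length ?\<gamma> = curve_length \<gamma>1 + curve_length \<gamma>2"
    by (rule rectifiableI[OF path F C1 int], assumption)+
qed

lemma rectifiable_reverse: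
  assumes r: "rectifiable_curve A g \<gamma>"
  shows "rectifiable_curve A g (reversepath \<gamma>)" "curve_length (reversepath \<gamma>) = curve_length \<gamma>"
proof -
  let ?\<gamma> = "reversepath \<gamma>"
  obtain F0 where "regular_off \<gamma> F0" using rectifiable_regular_off[OF r] by blast
  note F0 = regular_offD(1,4,5)[OF this]
  define F where "F = (\<lambda>t. 1 - t) ` F0"
  have F: "finite F" using F0 by (simp add: F_def)
  have eq: "?\<gamma> s = \<gamma> (- 1 * s + 1)" for s by (simp add: reversepath_def)
  have inF: "- 1 * t + 1 \<in> {0..1} - F0" if "t \<in> {0..1} - F" for t
  proof -
    have "- 1 * t + 1 \<notin> F0"
    proof
      assume "- 1 * t + 1 \<in> F0"
      then have "1 - (- 1 * t + 1) \<in> F" unfolding F_def by blast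
      then show False using that by simp
    qed
    then show ?thesis using that by auto
  qed
  have sp: "speed A g ?\<gamma> t = \<bar>- 1\<bar> * speed A g \<gamma> (- 1 * t + 1)" if "t \<in> {0..1} - F" for t
    by (rule smooth_at_reparam(2)[OF F0(2)[OF inF[OF that]] _ open_UNIV]) (auto simp: eq)
  have "(\<lambda>t. (t - 1) / - 1) ` {0..1} = {0..1::real}"
  proof -
    have "(\<lambda>t. (t - 1) / - 1) = (\<lambda>t::real. 1 - t)" by auto
    then show ?thesis using image_minus_const_atLeastAtMost'[of 0 1 1] image_diff_atLeastAtMost[of 1 0 1] by simp
  qed
  then have "((\<lambda>t. \<bar>- 1\<bar> * speed A g \<gamma> (- 1 * t + 1)) has_integral curve_length \<gamma>) {0..1}"
    using has_integral_reparam[OF curve_length_has_integral[OF r], of "-1" 1] by simp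
  then have int: "(speed A g ?\<gamma> has_integral curve_length \<gamma>) {0..1}"
    by (rule has_integral_spike_finite[OF F, rotated]) (simp add: sp)
  have C1: "(snd c \<circ> ?\<gamma>) C1_differentiable_on {t \<in> {0..1} - F. ?\<gamma> t \<in> fst c}" if c: "c \<in> A" for c
    by (rule C1_differentiable_on_reparam[OF F0(3)[OF c] open_UNIV, where a = "-1" and b = 1])
      (use eq inF in \<open>simp_all only: comp_apply eq\<close>, use inF in \<open>simp add: eq\<close>)
  have path: "path ?\<gamma>" using r by (simp add: rectifiable_curve_def)
  show "rectifiable_curve A g ?\<gamma>" "curve_length ?\<gamma> = curve_length \<gamma>"
    by (rule rectifiableI[OF path F C1 int], assumption)+
qed

section \<open>Straight segments in a chart\<close>

lemma gc_continuous:
  assumes "c \<in> A"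
  shows "continuous_on (chart_image c) (\<lambda>z. gc c z w w)"
proof -
  have "continuous_on (chart_image c) (Gm c)"
    using Gm_differentiable[OF assms] differentiable_imp_continuous_within
    by (auto intro!: continuous_at_imp_continuous_on)
  then have "continuous_on (chart_image c) (\<lambda>z. Re (herm w (Gm c z *v w)))"
    by (intro continuous_on_Re bounded_bilinear.continuous_on[OF bounded_bilinear_herm]
        bounded_bilinear.continuous_on[OF bounded_bilinear_matrix_vector_mult] continuous_on_const)
  then show ?thesis by (rule continuous_on_cong[THEN iffD1, OF refl, rotated]) (simp add: Gm(1)[OF assms])
qed

text \<open>Along a straight line in a chart the transition maps are holomorphic functions of one
  variable, hence automatically continuously differentiable.\<close>

lemma line_C1:
  assumes c: "c \<in> A" and c': "c' \<in> A"
    and S: "\<And>t. t \<in> S \<Longrightarrow> z0 + t *\<^sub>R w \<in> chart_image c \<and> chart_inv c (z0 + t *\<^sub>R w) \<in> fst c'"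
  shows "(snd c' \<circ> (\<lambda>t. chart_inv c (z0 + t *\<^sub>R w))) C1_differentiable_on S"
proof -
  define \<Omega> where "\<Omega> = {\<zeta>. z0 + \<zeta> *s w \<in> {z \<in> chart_image c. chart_inv c z \<in> fst c'}}"
  define F where "F i \<zeta> = snd c' (chart_inv c (z0 + \<zeta> *s w)) $ i" for i and \<zeta> :: complex
  have cont: "continuous_on UNIV (\<lambda>\<zeta>::complex. z0 + \<zeta> *s w)"
    unfolding vector_scalar_mult_def
    by (intro continuous_on_add continuous_on_const continuous_on_vec_lambda continuous_intros)
  have op: "open \<Omega>"
    using continuous_on_open_vimage[OF open_UNIV, THEN iffD1, OF cont, rule_format,
        OF chart_inv_vimage_open[OF c open_chart[OF c']]]
    by (simp add: \<Omega>_def vimage_def)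
  have D: "(F i has_field_derivative (J c c' (chart_inv c (z0 + \<zeta> *s w)) w $ i)) (at \<zeta>)" if \<zeta>: "\<zeta> \<in> \<Omega>" for i \<zeta>
  proof -
    let ?z = "z0 + \<zeta> *s w" let ?x = "chart_inv c ?z"
    have z: "?z \<in> chart_image c" "?x \<in> fst c'" using \<zeta> by (auto simp: \<Omega>_def)
    have ca: "c \<in> charts_at A ?x" "c' \<in> charts_at A ?x"
      using chart_at_inv[OF c z(1)] c' z(2) by (auto simp: charts_at_iff)
    have zx: "snd c ?x = ?z" by (rule chart_chart_inv[OF c z(1)])
    have lin: "((\<lambda>\<zeta>. z0 + \<zeta> *s w) has_derivative (\<lambda>h. h *s w)) (at \<zeta>)"
    proof -
      have "((\<lambda>\<zeta>. \<chi> i. \<zeta> * w $ i) has_derivative (\<lambda>h. \<chi> i. h * w $ i)) (at \<zeta>)"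
        by (intro has_derivative_vec_componentwise) (simp, intro has_derivative_mult_left has_derivative_ident)
      from has_derivative_add[OF has_derivative_const this] show ?thesis
        by (simp add: vector_scalar_mult_def)
    qed
    have "((\<lambda>\<zeta>. (snd c' \<circ> chart_inv c) (z0 + \<zeta> *s w)) has_derivative (\<lambda>h. J c c' ?x (h *s w))) (at \<zeta>)"
      by (rule has_derivative_compose[OF lin]) (use transition_derivative(1)[OF ca] zx in \<open>simp add: comp_def\<close>)
    from bounded_linear.has_derivative[OF bounded_linear_vec_nth this, of i]
    have "(F i has_derivative (\<lambda>h. J c c' ?x w $ i * h)) (at \<zeta>)"
      by (simp add: F_def[abs_def] comp_def transition_derivative(2)[OF ca] mult.commute)
    then show ?thesis by (simp add: has_field_derivative_def)
  qed
  then have hol: "F i holomorphic_on \<Omega>" for i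
    by (meson op holomorphic_on_open)
  have dF: "continuous_on \<Omega> (deriv (F i))" for i
    using holomorphic_deriv[OF hol op] by (rule holomorphic_on_imp_continuous_on)
  have tS: "complex_of_real t \<in> \<Omega>" if "t \<in> S" for t
    using S[OF that] by (simp add: \<Omega>_def scaleR_eq_scale)
  have "((snd c' \<circ> (\<lambda>t. chart_inv c (z0 + t *\<^sub>R w))) has_vector_derivative (\<chi> i. deriv (F i) (complex_of_real t))) (at t)"
    if "t \<in> S" for t
  proof -
    have "((\<lambda>t. F i (complex_of_real t)) has_vector_derivative deriv (F i) (complex_of_real t)) (at t)" for i
      by (rule has_vector_derivative_real_field) (use D[OF tS[OF that], of i] DERIV_imp_deriv in metis)
    then show ?thesis
      unfolding has_vector_derivative_def
      by (intro has_derivative_vec_componentwise) (simp add: F_def comp_def flip: scaleR_eq_scale)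
  qed
  moreover have "continuous_on S (\<lambda>t. \<chi> i. deriv (F i) (complex_of_real t))"
  proof (intro continuous_on_vec_lambda)
    fix i
    have "continuous_on S complex_of_real" by (intro continuous_intros)
    from continuous_on_compose2[OF dF this] show "continuous_on S (\<lambda>t. deriv (F i) (complex_of_real t))"
      using tS by blast
  qed
  ultimately show ?thesis
    unfolding C1_differentiable_on_def
    by (intro exI[of _ "\<lambda>t. \<chi> i. deriv (F i) (complex_of_real t)"] conjI ballI)
qed

lemma rectifiable_segment:
  assumes c: "c \<in> A" and r: "ball z0 r \<subseteq> chart_image c" "r > 0" and w: "norm w < r"
    and K: "\<And>t. t \<in> {0..1} \<Longrightarrow> sqrt (gc c (z0 + t *\<^sub>R w) w w) \<le> K"
  defines "\<gamma> \<equiv> \<lambda>t. chart_inv c (z0 + t *\<^sub>R w)"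
  shows "rectifiable_curve A g \<gamma>" "curve_length \<gamma> \<le> K"
proof -
  have pz: "z0 + t *\<^sub>R w \<in> chart_image c" if "t \<in> {0..1}" for t
  proof -
    have "norm (t *\<^sub>R w) \<le> norm w" using that by (simp add: mult_left_le_one_le)
    then show ?thesis using w r(1) by (auto simp: dist_norm)
  qed
  have cont_p: "continuous_on S (\<lambda>t. z0 + t *\<^sub>R w)" for S by (intro continuous_intros)
  have cont: "continuous_on {0..1} \<gamma>"
    unfolding \<gamma>_def using continuous_on_compose2[OF continuous_chart_inv[OF c] cont_p] pz by blast
  then have path: "path \<gamma>" by (simp add: path_def)
  have speed: "speed A g \<gamma> t = sqrt (gc c (z0 + t *\<^sub>R w) w w)" if t: "t \<in> {0..1} - {0, 1}" for t
  proof -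
    have t01: "t \<in> {0<..<1}" using t by auto
    have "continuous_on {0<..<1} \<gamma>" using cont by (rule continuous_on_subset) auto
    then have ic: "isCont \<gamma> t" using t01 by (simp add: continuous_on_eq_continuous_at)
    have zt: "z0 + t *\<^sub>R w \<in> chart_image c" using pz t by auto
    have in_c: "\<gamma> t \<in> fst c" unfolding \<gamma>_def by (rule chart_inv_in[OF c zt])
    have "((\<lambda>t. z0 + t *\<^sub>R w) has_vector_derivative w) (at t)"
      by (auto intro!: derivative_eq_intros)
    then have "((snd c \<circ> \<gamma>) has_vector_derivative w) (at t)"
      by (rule has_vector_derivative_transform_within_open[OF _ open_greaterThanLessThan t01])
        (simp add: \<gamma>_def chart_chart_inv[OF c pz])
    from speed_eq[where \<gamma> = \<gamma> and t = t and c = c, OF c in_c this ic] show ?thesis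
      by (simp add: \<gamma>_def chart_chart_inv[OF c zt])
  qed
  have "continuous_on {0..1} (\<lambda>t. sqrt (gc c (z0 + t *\<^sub>R w) w w))"
    by (intro continuous_on_real_sqrt continuous_on_compose2[OF gc_continuous[OF c] cont_p]) (use pz in blast)
  then obtain L where L: "((\<lambda>t. sqrt (gc c (z0 + t *\<^sub>R w) w w)) has_integral L) {0..1}"
    using integrable_continuous_real integrable_on_def by metis
  have L': "(speed A g \<gamma> has_integral L) {0..1}"
  proof (rule has_integral_spike_finite[OF _ _ L])
    show "finite {0, 1 :: real}" by simp
  qed (rule speed)
  have C1: "(snd c' \<circ> \<gamma>) C1_differentiable_on {t \<in> {0..1} - {0, 1}. \<gamma> t \<in> fst c'}" if "c' \<in> A" for c'
    unfolding \<gamma>_def by (rule line_C1[OF c that]) (use pz in auto)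
  show "rectifiable_curve A g \<gamma>" by (rule rectifiableI(1)[OF path _ C1 L']) auto
  have "curve_length \<gamma> = L" by (rule rectifiableI(2)[OF path _ C1 L']) auto
  moreover have "L \<le> K"
    using has_integral_le[OF L has_integral_const_real[of K 0 1]] K by simp
  ultimately show "curve_length \<gamma> \<le> K" by simp
qed

section \<open>Comparison of the length of curves with the Euclidean norm in a chart\<close>

lemma gc_frame:
  assumes "c \<in> A" "z \<in> chart_image c" "(z, B) \<in> bundle_chart A g c"
  shows "gc c z w w = (norm (B *v w))\<^sup>2"
proof -
  have "gc c z w w = Re (herm w (adjoint_matrix B *v (B *v w)))"
    using assms by (simp only: bundle_chart_iff Gm(1)[symmetric] matrix_vector_mul_assoc)
  also have "\<dots> = Re (herm (B *v w) (B *v w))" by (simp add: herm_mult_left)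
  finally show ?thesis by (simp add: herm_self flip: of_real_power)
qed

text \<open>The coframe of a local section is continuous at its base point and invertible there, so
  nearby it still does not shrink vectors by more than a fixed factor.\<close>

lemma metric_lower_bound:
  assumes c: "c \<in> charts_at A x"
  obtains \<delta> r where "\<delta> > 0" "r > 0" "cball (snd c x) r \<subseteq> chart_image c"
    "\<And>z w. z \<in> cball (snd c x) r \<Longrightarrow> \<delta> * norm w \<le> sqrt (gc c z w w)"
proof -
  have cA: "c \<in> A" "x \<in> fst c" using c by (auto simp: charts_at_iff)
  let ?z0 = "snd c x"
  have z0: "?z0 \<in> chart_image c" by (rule chart_in[OF cA])
  obtain B0 where B0: "(?z0, B0) \<in> bundle_chart A g c" using bundle_chart_nonempty[OF cA(1) z0] by blast
  define B where "B z = snd (local_frame c B0 z)" for z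
  have B_in: "(z, B z) \<in> bundle_chart A g c" if "z \<in> chart_image c" for z
    using local_frame_in[OF cA(1) z0 B0 that] by (simp add: B_def local_frame_def)
  have Bz0: "B ?z0 = B0" using local_frame_at[OF cA(1) z0 B0] by (simp add: B_def)
  obtain D where "(local_frame c B0 has_derivative D) (at ?z0)"
    using local_frame_derivative[OF cA(1) z0 B0] by blast
  then have "isCont (local_frame c B0) ?z0" by (rule has_derivative_continuous)
  then have B_cont: "isCont B ?z0" unfolding B_def by (intro continuous_intros)
  obtain C where C: "\<And>(X::complex^'n^'n) v. norm (X *v v) \<le> norm X * norm v * C" and C0: "C > 0"
    using bounded_bilinear.pos_bounded[OF bounded_bilinear_matrix_vector_mult] by blast
  have det: "det B0 \<noteq> 0" by (rule bundle_chart_invertible[OF cA(1) z0 B0])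
  define k where "k = norm (Inv B0) * C + 1"
  have k: "k > 0" using C0 by (simp add: k_def add_nonneg_pos)
  have B0_low: "norm w \<le> k * norm (B0 *v w)" for w
  proof -
    have "norm w = norm (Inv B0 *v (B0 *v w))" by (simp add: Inv_mult_vec det)
    also have "\<dots> \<le> norm (Inv B0) * norm (B0 *v w) * C" by (rule C)
    also have "\<dots> \<le> k * norm (B0 *v w)" by (simp add: k_def algebra_simps)
    finally show ?thesis .
  qed
  \<comment> \<open>Chosen so that \<open>2 \<delta> |w| <= |B0 w|\<close>; half of this is spent on
    replacing B0 by a nearby coframe.\<close>
  define \<delta> where "\<delta> = 1 / (2 * k)"
  have \<delta>: "\<delta> > 0" using k by (simp add: \<delta>_def)
  have "\<forall>\<^sub>F z in nhds ?z0. dist (B z) B0 < \<delta> / C"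
    using B_cont \<delta> C0 unfolding continuous_at Bz0 tendsto_iff
    by (auto simp: eventually_nhds_conv_at Bz0)
  moreover have "\<forall>\<^sub>F z in nhds ?z0. z \<in> chart_image c"
    using open_chart_image[OF cA(1)] z0 by (rule eventually_nhds_in_open)
  ultimately have "\<forall>\<^sub>F z in nhds ?z0. z \<in> chart_image c \<and> dist (B z) B0 < \<delta> / C"
    by eventually_elim auto
  then obtain r where r: "r > 0" "\<And>z. dist z ?z0 < r \<Longrightarrow> z \<in> chart_image c \<and> dist (B z) B0 < \<delta> / C"
    unfolding eventually_nhds_metric by blast
  show ?thesis
  proof (rule that[OF \<delta>, of "r/2"])
    show "r / 2 > 0" using r by simp
    have near: "z \<in> chart_image c" "dist (B z) B0 < \<delta> / C" if "z \<in> cball ?z0 (r/2)" for z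
      using r(2)[of z] that r(1) by (auto simp: dist_commute)
    then show "cball ?z0 (r/2) \<subseteq> chart_image c" by blast
    fix z w assume z: "z \<in> cball ?z0 (r/2)"
    have "norm (B0 *v w) \<le> norm (B z *v w) + norm ((B z - B0) *v w)"
      using norm_triangle_ineq4[of "B z *v w" "(B z - B0) *v w"] by (simp add: matrix_vector_mult_diff_rdistrib)
    also have "norm ((B z - B0) *v w) \<le> norm (B z - B0) * norm w * C" by (rule C)
    also have "\<dots> \<le> \<delta> / C * norm w * C"
      using near(2)[OF z] C0 by (intro mult_right_mono) (auto simp: dist_norm)
    also have "\<dots> = \<delta> * norm w" using C0 by simp
    finally have 1: "norm (B0 *v w) \<le> norm (B z *v w) + \<delta> * norm w" by simp
    have "2 * \<delta> * norm w \<le> norm (B0 *v w)"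
      using B0_low[of w] k by (simp add: \<delta>_def field_simps)
    with 1 have "\<delta> * norm w \<le> norm (B z *v w)" by linarith
    also have "\<dots> = sqrt (gc c z w w)"
      using gc_frame[OF cA(1) near(1)[OF z] B_in[OF near(1)[OF z]], of w] by simp
    finally show "\<delta> * norm w \<le> sqrt (gc c z w w)" .
  qed
qed

text \<open>The fundamental theorem of calculus for the curve in the chart, whose derivative is
  bounded by the speed divided by \<open>\<delta>\<close>.\<close>

lemma curve_start_bound:
  assumes c: "c \<in> charts_at A x" and \<delta>: "\<delta> > 0"
    and low: "\<And>z w. z \<in> cball (snd c x) r \<Longrightarrow> \<delta> * norm w \<le> sqrt (gc c z w w)"
    and rect: "rectifiable_curve A g \<gamma>" and start: "pathstart \<gamma> = x"
    and s: "s \<in> {0..1}" and inside: "\<And>t. t \<in> {0..s} \<Longrightarrow> \<gamma> t \<in> fst c \<and> snd c (\<gamma> t) \<in> cball (snd c x) r"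
  shows "norm (snd c (\<gamma> s) - snd c x) \<le> curve_length \<gamma> / \<delta>"
proof -
  have cA: "c \<in> A" "x \<in> fst c" using c by (auto simp: charts_at_iff)
  obtain F where "regular_off \<gamma> F" using rectifiable_regular_off[OF rect] by blast
  note F = regular_offD[OF this]
  define f where "f = snd c \<circ> \<gamma>"
  \<comment> \<open>\<open>f'\<close> and the bound v are 0 on the exceptional set, where derivative
    and speed are uncontrolled; the integrals do not see this finite set.\<close>
  define f' where "f' t = (if t \<in> F \<union> {s} then 0 else vector_derivative f (at t))" for t
  define v where "v t = (if t \<in> F \<union> {s} then 0 else speed A g \<gamma> t / \<delta>)" for t
  have path: "continuous_on {0..1} \<gamma>" using rect by (simp add: rectifiable_curve_def path_def)
  have fin: "finite (F \<union> {s})" using F(1) by simp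
  have D: "(f has_vector_derivative f' t) (at t)" "norm (f' t) \<le> v t"
    if t: "t \<in> {0<..<s} - (F \<union> {s})" for t
  proof -
    have t01: "t \<in> {0..1} - F" and ts: "t \<in> {0..s}" using t s by auto
    have in_c: "\<gamma> t \<in> fst c" and in_r: "snd c (\<gamma> t) \<in> cball (snd c x) r" using inside[OF ts] by auto
    obtain w where w: "((snd c \<circ> \<gamma>) has_vector_derivative w) (at t)"
      "speed A g \<gamma> t = sqrt (gc c (snd c (\<gamma> t)) w w)"
      by (rule smooth_atE[OF F(4)[OF t01] cA(1) in_c])
    have f't: "f' t = w" using t vector_derivative_at[OF w(1)] by (simp add: f'_def f_def)
    show "(f has_vector_derivative f' t) (at t)" using w(1) by (simp add: f't f_def)
    have "\<delta> * norm w \<le> speed A g \<gamma> t" using low[OF in_r] by (simp add: w(2))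
    then show "norm (f' t) \<le> v t" using t \<delta> by (simp add: f't v_def field_simps)
  qed
  have cont: "continuous_on {0..s} f"
    unfolding f_def
    by (rule continuous_on_compose[OF continuous_on_subset[OF path] continuous_on_subset[OF continuous_chart[OF cA(1)]]])
      (use s inside in auto)
  have int: "(f' has_integral (f s - f 0)) {0..s}"
    using fundamental_theorem_of_calculus_interior_strong[OF fin _ D(1) cont] s by auto
  have "((\<lambda>t. speed A g \<gamma> t / \<delta>) has_integral curve_length \<gamma> / \<delta>) {0..1}"
    using has_integral_divide[OF curve_length_has_integral[OF rect]] .
  then have v1: "(v has_integral curve_length \<gamma> / \<delta>) {0..1}"
  proof (rule has_integral_spike_finite[OF fin, rotated])
    fix t assume "t \<in> {0..1} - (F \<union> {s})"
    then show "v t = speed A g \<gamma> t / \<delta>" by (simp add: v_def)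
  qed
  have v0: "v t \<ge> 0" if "t \<in> {0..1}" for t
  proof (cases "t \<in> F \<union> {s}")
    case False
    then have "smooth_at \<gamma> t" using F(4) that by simp
    then show ?thesis using False speed_nonneg \<delta> by (simp add: v_def)
  qed (simp add: v_def)
  have vs: "v integrable_on {0..s}"
    by (rule integrable_on_subinterval[OF has_integral_integrable[OF v1]]) (use s in auto)
  have "norm (integral {0..s} f') \<le> integral {0..s} v"
  proof (rule integral_norm_bound_integral[OF has_integral_integrable[OF int] vs])
    fix t assume t: "t \<in> {0..s}"
    show "norm (f' t) \<le> v t"
    proof (cases "t \<in> F \<union> {s}")
      case False
      then have "t \<noteq> 0" using F(2) by auto
      then show ?thesis using False t by (intro D(2)) auto
    qed (simp add: f'_def v_def)
  qed
  also have "\<dots> \<le> integral {0..1} v"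
    by (rule integral_subset_le[OF _ vs has_integral_integrable[OF v1]]) (use s v0 in auto)
  finally have "norm (f s - f 0) \<le> curve_length \<gamma> / \<delta>"
    using integral_unique[OF int] integral_unique[OF v1] by simp
  then show ?thesis using start by (simp add: f_def pathstart_def)
qed

text \<open>Before a first exit from the open set U the curve stays in K, the compact coordinate
  ball of radius length over \<open>\<delta>\<close>, smaller than r. K is closed, so the exit point
  would still lie in K and hence in U.\<close>

lemma curve_stays:
  assumes c: "c \<in> charts_at A x" and \<delta>: "\<delta> > 0" and r: "cball (snd c x) r \<subseteq> chart_image c" "r > 0"
    and low: "\<And>z w. z \<in> cball (snd c x) r \<Longrightarrow> \<delta> * norm w \<le> sqrt (gc c z w w)"
    and rect: "rectifiable_curve A g \<gamma>" and start: "pathstart \<gamma> = x" and short: "curve_length \<gamma> < \<delta> * r"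
  shows "pathfinish \<gamma> \<in> fst c" "norm (snd c (pathfinish \<gamma>) - snd c x) \<le> curve_length \<gamma> / \<delta>"
proof -
  have cA: "c \<in> A" "x \<in> fst c" using c by (auto simp: charts_at_iff)
  define U where "U = {y \<in> fst c. snd c y \<in> ball (snd c x) r}"
  have U: "open U"
    using continuous_open_preimage[OF continuous_chart[OF cA(1)] open_chart[OF cA(1)] open_ball]
    by (simp add: U_def vimage_def Int_def)
  have path: "continuous_on {0..1} \<gamma>" using rect by (simp add: rectifiable_curve_def path_def)
  define \<rho> where "\<rho> = curve_length \<gamma> / \<delta>"
  have \<rho>: "\<rho> < r" "\<rho> \<ge> 0"
    using short \<delta> curve_length_nonneg[OF rect] by (simp_all add: \<rho>_def field_simps)
  define K where "K = chart_inv c ` cball (snd c x) \<rho>"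
  have sub: "cball (snd c x) \<rho> \<subseteq> chart_image c" using r \<rho> by (meson less_imp_le order_trans subset_cball)
  have "compact K"
    unfolding K_def by (intro compact_continuous_image continuous_on_subset[OF continuous_chart_inv[OF cA(1)] sub] compact_cball)
  then have K: "closed K" by (rule compact_imp_closed)
  have KU: "K \<subseteq> U"
  proof
    fix y assume "y \<in> K"
    then obtain z where z: "z \<in> cball (snd c x) \<rho>" "y = chart_inv c z" by (auto simp: K_def)
    then have "z \<in> chart_image c" using sub by blast
    then show "y \<in> U" using z \<rho> chart_inv_in[OF cA(1)] chart_chart_inv[OF cA(1)] by (auto simp: U_def)
  qed
  have bound: "norm (snd c (\<gamma> s) - snd c x) \<le> \<rho>" if s: "s \<in> {0..1}" "\<And>t. t \<in> {0..s} \<Longrightarrow> \<gamma> t \<in> U" for s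
    unfolding \<rho>_def
    by (rule curve_start_bound[OF c \<delta> low rect start s(1)]) (use s(2) in \<open>auto simp: U_def intro: less_imp_le\<close>)
  have all_U: "\<gamma> t \<in> U" if "t \<in> {0..1}" for t
  proof (rule ccontr)
    assume "\<gamma> t \<notin> U"
    define B where "B = {t \<in> {0..1}. \<gamma> t \<in> - U}"
    have B: "B \<noteq> {}" using that \<open>\<gamma> t \<notin> U\<close> by (auto simp: B_def)
    have "closed B"
      using continuous_closed_preimage[OF path closed_atLeastAtMost, of "- U"] U
      by (simp add: B_def vimage_def Int_def closed_Compl)
    moreover have bdd: "bdd_below B" by (rule bdd_belowI[of _ 0]) (auto simp: B_def)
    ultimately have \<tau>B: "Inf B \<in> B" using B closed_contains_Inf by blast
    define \<tau> where "\<tau> = Inf B"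
    have \<tau>: "\<tau> \<in> {0..1}" "\<gamma> \<tau> \<notin> U" using \<tau>B by (auto simp: \<tau>_def B_def)
    have before: "\<gamma> t \<in> U" if "t \<in> {0..<\<tau>}" for t
    proof (rule ccontr)
      assume "\<gamma> t \<notin> U"
      then have "t \<in> B" using that \<tau> by (auto simp: B_def)
      then have "\<tau> \<le> t" unfolding \<tau>_def using bdd by (intro cInf_lower)
      then show False using that by simp
    qed
    have "\<gamma> 0 \<in> U" using start r cA by (simp add: U_def pathstart_def)
    then have \<tau>0: "\<tau> > 0" using \<tau> by (cases "\<tau> = 0") auto
    have inK: "\<gamma> t \<in> K" if t: "t \<in> {0..<\<tau>}" for t
    proof -
      have "norm (snd c (\<gamma> t) - snd c x) \<le> \<rho>"
        using before t \<tau> by (intro bound) auto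
      moreover have "\<gamma> t \<in> fst c" using before[OF t] by (simp add: U_def)
      ultimately show ?thesis
        unfolding K_def using chart_inv_chart[OF cA(1)]
        by (intro image_eqI[of _ _ "snd c (\<gamma> t)"]) (auto simp: dist_norm norm_minus_commute)
    qed
    have "closed {t \<in> {0..\<tau>}. \<gamma> t \<in> K}"
      using continuous_closed_preimage[OF continuous_on_subset[OF path] closed_atLeastAtMost K, of 0 \<tau>] \<tau>
      by (simp add: vimage_def Int_def)
    moreover have "{0..<\<tau>} \<subseteq> {t \<in> {0..\<tau>}. \<gamma> t \<in> K}" using inK by auto
    ultimately have "closure {0..<\<tau>} \<subseteq> {t \<in> {0..\<tau>}. \<gamma> t \<in> K}" by (rule closure_minimal[rotated])
    moreover have "\<tau> \<in> closure {0..<\<tau>}" using \<tau>0 by simp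
    ultimately have "\<gamma> \<tau> \<in> K" by blast
    with KU \<tau> show False by blast
  qed
  then show "pathfinish \<gamma> \<in> fst c" by (simp add: U_def pathfinish_def)
  show "norm (snd c (pathfinish \<gamma>) - snd c x) \<le> curve_length \<gamma> / \<delta>"
    using bound[of 1] all_U by (simp add: pathfinish_def \<rho>_def)
qed

section \<open>The Riemannian distance as an infimum of lengths of joining curves\<close>

definition joined :: "'a \<Rightarrow> 'a \<Rightarrow> real \<Rightarrow> bool" where
  "joined x y L \<longleftrightarrow> (\<exists>\<gamma>. rectifiable_curve A g \<gamma> \<and> pathstart \<gamma> = x \<and> pathfinish \<gamma> = y \<and> curve_length \<gamma> = L)"

lemma joined_nonneg: "joined x y L \<Longrightarrow> L \<ge> 0"
  using curve_length_nonneg by (auto simp: joined_def)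

lemma joined_sym: "joined x y L \<Longrightarrow> joined y x L"
  unfolding joined_def by (metis rectifiable_reverse pathstart_reversepath pathfinish_reversepath)

lemma joined_trans: "joined x y L \<Longrightarrow> joined y z L' \<Longrightarrow> joined x z (L + L')"
  unfolding joined_def by (metis rectifiable_join pathstart_join pathfinish_join)

lemma joined_segment:
  assumes c: "c \<in> A" and r: "ball z0 r \<subseteq> chart_image c" "r > 0" and w: "norm w < r"
    and K: "\<And>t. t \<in> {0..1} \<Longrightarrow> sqrt (gc c (z0 + t *\<^sub>R w) w w) \<le> K"
  shows "\<exists>L\<le>K. joined (chart_inv c z0) (chart_inv c (z0 + w)) L"
  using rectifiable_segment[OF c r w K] unfolding joined_def
  by (intro exI[of _ "curve_length (\<lambda>t. chart_inv c (z0 + t *\<^sub>R w))"] conjI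
      exI[of _ "\<lambda>t. chart_inv c (z0 + t *\<^sub>R w)"]) (auto simp: pathstart_def pathfinish_def)

lemma segment_speed_bounded:
  assumes c: "c \<in> A" and r: "ball z0 r \<subseteq> chart_image c" and w: "norm w < r"
  shows "\<exists>K. \<forall>t\<in>{0..1}. sqrt (gc c (z0 + t *\<^sub>R w) w w) \<le> K"
proof -
  have pz: "z0 + t *\<^sub>R w \<in> chart_image c" if "t \<in> {0..1}" for t
  proof -
    have "norm (t *\<^sub>R w) \<le> norm w" using that by (simp add: mult_left_le_one_le)
    then show ?thesis using w r by (auto simp: dist_norm)
  qed
  have "continuous_on {0..1} (\<lambda>t. z0 + t *\<^sub>R w)" by (intro continuous_intros)
  from continuous_on_compose2[OF gc_continuous[OF c] this]
  have "continuous_on {0..1} (\<lambda>t. sqrt (gc c (z0 + t *\<^sub>R w) w w))"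
    using pz by (intro continuous_on_real_sqrt) blast
  then have "compact ((\<lambda>t. sqrt (gc c (z0 + t *\<^sub>R w) w w)) ` {0..1})"
    by (intro compact_continuous_image) auto
  then have "bdd_above ((\<lambda>t. sqrt (gc c (z0 + t *\<^sub>R w) w w)) ` {0..1})"
    by (simp add: bounded_imp_bdd_above compact_imp_bounded)
  then show ?thesis by (auto simp: bdd_above_def)
qed

lemma joined_near:
  assumes c: "c \<in> A" and r: "ball z0 r \<subseteq> chart_image c" "r > 0" and w: "norm w < r"
  shows "\<exists>L. joined (chart_inv c z0) (chart_inv c (z0 + w)) L"
  using segment_speed_bounded[OF c r(1) w] joined_segment[OF c r w] by meson

lemma joined_refl: "joined x x 0"
proof -
  obtain c where "c \<in> charts_at A x" using charts_at_nonempty by blast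
  then have c: "c \<in> A" "x \<in> fst c" by (auto simp: charts_at_iff)
  obtain r where r: "r > 0" "ball (snd c x) r \<subseteq> chart_image c"
    using open_chart_image[OF c(1)] chart_in[OF c] open_contains_ball by blast
  have g0: "gc c z 0 0 = 0" if "z \<in> chart_image c" for z using gc_bilinear(2)[OF c(1) that, of 0 0 0] by simp
  have "\<exists>L\<le>0. joined (chart_inv c (snd c x)) (chart_inv c (snd c x + 0)) L"
    by (rule joined_segment[OF c(1) r(2,1)]) (use r g0[OF chart_in[OF c]] in auto)
  then obtain L where L: "L \<le> 0" "joined x x L" by (auto simp: chart_inv_chart[OF c])
  then have "L = 0" using joined_nonneg by force
  with L show ?thesis by simp
qed

text \<open>Ensures that the infimum in the distance is over a nonempty set. Being joined is an
  equivalence relation, and every point is joined to a coordinate ball around it.\<close>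

lemma all_joined:
  assumes "connected (UNIV :: 'a set)"
  shows "\<exists>L. joined x y L"
proof (rule connected_equivalence_relation[OF assms UNIV_I UNIV_I, of "\<lambda>x y. \<exists>L. joined x y L"])
  fix a
  obtain c where "c \<in> charts_at A a" using charts_at_nonempty by blast
  then have c: "c \<in> A" "a \<in> fst c" by (auto simp: charts_at_iff)
  obtain r where r: "r > 0" "ball (snd c a) r \<subseteq> chart_image c"
    using open_chart_image[OF c(1)] chart_in[OF c] open_contains_ball by blast
  let ?T = "{y \<in> fst c. snd c y \<in> ball (snd c a) r}"
  have "open ?T"
    using continuous_open_preimage[OF continuous_chart[OF c(1)] open_chart[OF c(1)] open_ball]
    by (simp add: vimage_def Int_def)
  moreover have "\<exists>L. joined a y L" if "y \<in> ?T" for y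
  proof -
    have "\<exists>L. joined (chart_inv c (snd c a)) (chart_inv c (snd c a + (snd c y - snd c a))) L"
      by (rule joined_near[OF c(1) r(2,1)]) (use that in \<open>simp add: dist_norm norm_minus_commute\<close>)
    then show ?thesis using that c by (simp add: chart_inv_chart)
  qed
  ultimately show "\<exists>T. openin (top_of_set UNIV) T \<and> a \<in> T \<and> (\<forall>x\<in>T. \<exists>L. joined a x L)"
    using c r by (intro exI[of _ ?T]) auto
qed (blast intro: joined_sym joined_trans)+

lemma riemannian_dist_eq: "riemannian_dist A g x y = Inf {L. joined x y L}"
  unfolding riemannian_dist_def joined_def curve_length_def by (rule arg_cong[where f = Inf]) auto

lemma riemannian_dist_le: "joined x y L \<Longrightarrow> riemannian_dist A g x y \<le> L"
  unfolding riemannian_dist_eq by (rule cInf_lower) (auto intro: bdd_belowI[of _ 0] joined_nonneg)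

context
  assumes conn: "connected (UNIV :: 'a set)"
begin

lemma riemannian_dist_approx:
  assumes "\<epsilon> > 0"
  shows "\<exists>L. joined x y L \<and> L < riemannian_dist A g x y + \<epsilon>"
proof -
  have ne: "{L. joined x y L} \<noteq> {}" using all_joined[OF conn] by auto
  have "Inf {L. joined x y L} < riemannian_dist A g x y + \<epsilon>" using assms by (simp add: riemannian_dist_eq)
  from cInf_lessD[OF ne this] show ?thesis by blast
qed

lemma riemannian_dist_nonneg: "riemannian_dist A g x y \<ge> 0"
  unfolding riemannian_dist_eq using all_joined[OF conn] by (intro cInf_greatest) (auto intro: joined_nonneg)

lemma riemannian_dist_sym: "riemannian_dist A g x y = riemannian_dist A g y x"
  unfolding riemannian_dist_eq using joined_sym by (intro arg_cong[where f = Inf]) blast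

lemma riemannian_dist_refl: "riemannian_dist A g x x = 0"
  using riemannian_dist_le[OF joined_refl] riemannian_dist_nonneg by (rule antisym)

lemma riemannian_dist_triangle:
  "riemannian_dist A g x z \<le> riemannian_dist A g x y + riemannian_dist A g y z"
proof (rule field_le_epsilon)
  fix e :: real assume "e > 0"
  then have e: "e / 2 > 0" by simp
  obtain L where L: "joined x y L" "L < riemannian_dist A g x y + e / 2"
    using riemannian_dist_approx[OF e] by blast
  obtain L' where L': "joined y z L'" "L' < riemannian_dist A g y z + e / 2"
    using riemannian_dist_approx[OF e] by blast
  have "riemannian_dist A g x z \<le> L + L'" by (rule riemannian_dist_le[OF joined_trans[OF L(1) L'(1)]])
  then show "riemannian_dist A g x z \<le> riemannian_dist A g x y + riemannian_dist A g y z + e"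
    using L(2) L'(2) by linarith
qed

text \<open>A short curve cannot leave a small coordinate ball, so a small distance means a small
  coordinate distance. This carries continuity in charts over to the distance.\<close>

lemma riemannian_dist_chart_limit:
  assumes c: "c \<in> charts_at A x" and lim: "(\<lambda>i. riemannian_dist A g (\<sigma> i) x) \<longlonglongrightarrow> 0"
  shows "\<forall>\<^sub>F i in sequentially. \<sigma> i \<in> fst c" "(\<lambda>i. snd c (\<sigma> i)) \<longlonglongrightarrow> snd c x"
proof -
  obtain \<delta> r where \<delta>: "\<delta> > 0" and r: "r > 0" "cball (snd c x) r \<subseteq> chart_image c"
    and low: "\<And>z w. z \<in> cball (snd c x) r \<Longrightarrow> \<delta> * norm w \<le> sqrt (gc c z w w)"
    using metric_lower_bound[OF c] by blast
  have key: "y \<in> fst c \<and> norm (snd c y - snd c x) \<le> e" 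
    if d: "riemannian_dist A g y x < \<delta> * e" and e: "e > 0" "e \<le> r" for y e
  proof -
    have "\<delta> * e - riemannian_dist A g y x > 0" using d by simp
    from riemannian_dist_approx[OF this, of x y] obtain L where "joined x y L" "L < \<delta> * e"
      by (auto simp: riemannian_dist_sym[of x y])
    then obtain \<gamma> where \<gamma>: "rectifiable_curve A g \<gamma>" "pathstart \<gamma> = x" "pathfinish \<gamma> = y" "curve_length \<gamma> < \<delta> * e"
      by (auto simp: joined_def)
    have "curve_length \<gamma> < \<delta> * r" using \<gamma>(4) e \<delta> by (meson less_le_trans mult_left_mono less_imp_le)
    from curve_stays[OF c \<delta> r(2,1) low \<gamma>(1,2) this]
    have "y \<in> fst c" "norm (snd c y - snd c x) \<le> curve_length \<gamma> / \<delta>" using \<gamma>(3) by auto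
    moreover have "curve_length \<gamma> / \<delta> \<le> e" using \<gamma>(4) \<delta> by (simp add: field_simps)
    ultimately show ?thesis by linarith
  qed
  have "\<forall>\<^sub>F i in sequentially. riemannian_dist A g (\<sigma> i) x < \<delta> * r"
    by (rule order_tendstoD(2)[OF lim]) (use \<delta> r in simp)
  then show "\<forall>\<^sub>F i in sequentially. \<sigma> i \<in> fst c"
    by eventually_elim (use key[of _ r] r in auto)
  show "(\<lambda>i. snd c (\<sigma> i)) \<longlonglongrightarrow> snd c x"
  proof (rule tendstoI)
    fix \<epsilon> :: real assume "\<epsilon> > 0"
    define e where "e = min (\<epsilon> / 2) r"
    have e: "e > 0" "e \<le> r" "e < \<epsilon>" using \<open>\<epsilon> > 0\<close> r by (auto simp: e_def)
    have "\<forall>\<^sub>F i in sequentially. riemannian_dist A g (\<sigma> i) x < \<delta> * e"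
      by (rule order_tendstoD(2)[OF lim]) (use \<delta> e in simp)
    then show "\<forall>\<^sub>F i in sequentially. dist (snd c (\<sigma> i)) (snd c x) < \<epsilon>"
    proof eventually_elim
      case (elim i)
      then have "norm (snd c (\<sigma> i) - snd c x) \<le> e" using key e by blast
      then show ?case using e by (simp add: dist_norm)
    qed
  qed
qed

end

end

section \<open>Boundedness of the momentum cell\<close>

text \<open>Points of the cell as monic polynomials: the expression tested in
  \<open>momentum_cell\<close> is, up to sign, the value of this polynomial at r.\<close>

definition cell_poly :: "nat \<Rightarrow> (nat \<Rightarrow> real) \<Rightarrow> real poly" where
  "cell_poly m X = monom 1 m + (\<Sum>k=1..m. monom ((-1) ^ k * X k) (m - k))"

lemma coeff_cell_poly:
  assumes "k \<in> {1..m}"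
  shows "coeff (cell_poly m X) (m - k) = (-1) ^ k * X k"
proof -
  have "coeff (cell_poly m X) (m - k) = (\<Sum>j=1..m. if j = k then (-1) ^ k * X k else 0)"
  proof -
    have "coeff (monom 1 m) (m - k) = (0::real)" using assms by auto
    moreover have "(\<Sum>j=1..m. coeff (monom ((-1) ^ j * X j) (m - j)) (m - k)) =
        (\<Sum>j=1..m. if j = k then (-1) ^ k * X k else 0)"
      by (rule sum.cong) (use assms in auto)
    ultimately show ?thesis unfolding cell_poly_def coeff_add coeff_sum by simp
  qed
  then show ?thesis using assms by simp
qed

lemma cell_poly_monic: "degree (cell_poly m X) = m" "lead_coeff (cell_poly m X) = 1"
proof -
  have c: "coeff (cell_poly m X) m = 1"
  proof -
    have "(\<Sum>j=1..m. coeff (monom ((-1) ^ j * X j) (m - j)) m) = 0" by (rule sum.neutral) auto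
    then show ?thesis unfolding cell_poly_def coeff_add coeff_sum by simp
  qed
  have "degree (cell_poly m X) \<le> m"
    unfolding cell_poly_def
    by (intro degree_add_le degree_sum_le order_trans[OF degree_monom_le]) auto
  then show "degree (cell_poly m X) = m" using c le_degree[of "cell_poly m X" m] by simp
  with c show "lead_coeff (cell_poly m X) = 1" by simp
qed

lemma poly_cell_poly: "poly (cell_poly m X) r = r ^ m + (\<Sum>k=1..m. (-1) ^ k * r ^ (m - k) * X k)"
  by (simp add: cell_poly_def poly_sum poly_monom mult_ac)

lemma momentum_cellD:
  assumes "X \<in> momentum_cell m p \<mu>" "poly p r = 0"
  shows "(-1) ^ \<mu> r * poly (cell_poly m X) r \<ge> 0"
  using assms unfolding momentum_cell_def Let_def poly_cell_poly by (auto split: if_splits intro: less_imp_le)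

lemma monic_eq_prod_roots:
  fixes p :: "'r::field poly"
  assumes "lead_coeff p = 1" "degree p = card {t. poly p t = 0}"
  shows "p = (\<Prod>y\<in>{t. poly p t = 0}. [:- y, 1:])"
proof -
  let ?L = "{t. poly p t = 0}"
  let ?w = "\<Prod>y\<in>?L. [:- y, 1:]"
  have p0: "p \<noteq> 0" using assms(1) by auto
  obtain r where r: "p = ?w * r"
    using prod_linear_dvd[OF poly_roots_finite[OF p0], of p] by (auto elim: dvdE)
  then have nz: "?w \<noteq> 0" "r \<noteq> 0" using p0 by auto
  have "degree p = degree ?w + degree r"
    using degree_mult_eq[OF nz] unfolding r[symmetric] .
  then have "degree r = 0" using assms(2) degree_prod_linear[of "\<lambda>y. y" ?L] by simp
  then obtain a where a: "r = [:a:]" by (rule degree_eq_zeroE)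
  have "lead_coeff p = lead_coeff ?w * lead_coeff r"
    using lead_coeff_mult[of ?w r] unfolding r[symmetric] .
  then have "lead_coeff r = 1" using assms(1) monic_prod_linear[of "\<lambda>y. y" ?L] by simp
  then have "r = 1" by (simp add: a one_pCons)
  with r show ?thesis by simp
qed

lemma C_real_monic: "degree (C_real (l :: 'n::finite \<Rightarrow> real) c v) = CARD('n) + 2" "lead_coeff (C_real l c v) = 1"
proof -
  let ?a = "root_poly l * [:v, \<Sum>k\<in>UNIV. l k, 1:]"
  let ?b = "\<Sum>k\<in>UNIV. smult (c k) (\<Prod>j\<in>UNIV-{k}. [:- l j, 1:])"
  have lc: "lead_coeff (root_poly l) = 1" unfolding root_poly_def by (rule monic_prod_linear)
  then have "root_poly l \<noteq> 0" by auto
  then have da: "degree ?a = CARD('n) + 2" by (subst degree_mult_eq) (simp_all add: degree_root_poly)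
  have la: "lead_coeff ?a = 1" by (subst lead_coeff_mult) (simp add: lc del: mult_pCons_right)
  have "degree ?b < CARD('n) + 2"
  proof (rule degree_sum_less)
    fix k :: 'n
    show "degree (smult (c k) (\<Prod>j\<in>UNIV-{k}. [:- l j, 1:])) < CARD('n) + 2"
      by (rule le_less_trans[OF degree_smult_le]) (simp add: degree_prod_linear)
  qed simp
  then have b: "degree ?b < degree ?a" using da by simp
  show "degree (C_real l c v) = CARD('n) + 2"
    unfolding C_real_def using degree_add_eq_left[OF b] da by simp
  show "lead_coeff (C_real l c v) = 1"
    unfolding C_real_def using lead_coeff_add_le[OF b] la by (simp add: add.commute)
qed

lemma bounded_in_Rm_coeff:
  assumes "\<And>X k. X \<in> C \<Longrightarrow> k \<in> {1..m} \<Longrightarrow> \<bar>coeff (cell_poly m X) (m - k)\<bar> \<le> b k"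
  shows "bounded_in_Rm m C"
  unfolding bounded_in_Rm_def
proof (intro exI ballI)
  fix X assume X: "X \<in> C"
  have "L2_set X {1..m} \<le> (\<Sum>k\<in>{1..m}. \<bar>X k\<bar>)" by (rule L2_set_le_sum_abs)
  also have "\<dots> \<le> (\<Sum>k\<in>{1..m}. b k)"
  proof (rule sum_mono)
    fix k assume k: "k \<in> {1..m}"
    show "\<bar>X k\<bar> \<le> b k" using assms[OF X k] by (simp add: coeff_cell_poly[OF k] abs_mult power_abs)
  qed
  finally show "L2_set X {1..m} \<le> (\<Sum>k\<in>{1..m}. b k)" .
qed

lemma poly_pos_after_last_root:
  fixes p :: "real poly"
  assumes "poly p a > 0" "\<And>t. t > a \<Longrightarrow> poly p t \<noteq> 0" "t \<ge> a"
  shows "poly p t > 0"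
proof (rule ccontr)
  assume "\<not> poly p t > 0"
  then have t: "a < t" "poly p t < 0" using assms by (auto simp: not_less less_le)
  from poly_IVT_neg[OF t(1) assms(1) t(2)] show False using assms(2) by blast
qed

section \<open>Descent on a complete manifold, and the bound for the cell\<close>

context bochner_kaehler_manifold
begin

text \<open>With \<open>G = - p\<^sub>h(t) / q(t)\<close>, the hypothesis says that \<open>1 / sqrt G\<close>, which is bounded below, has
  gradient of norm at least \<open>sqrt C\<close> wherever \<open>G > 0\<close>.\<close>

lemma no_escape:
  assumes conn: "connected (UNIV :: 'a set)" and complete: "complete_metric A g"
    and qt: "poly q ts \<noteq> 0" and G0: "- poly (h_poly A g H x0) ts / poly q ts > 0" and C: "C > 0"
    and slope: "\<And>c x B e l. spectral_frame c x B e l \<Longrightarrow> - poly (h_poly A g H x) ts / poly q ts > 0 \<Longrightarrow>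
      (\<Sum>k\<in>UNIV. (cmod (T_comp c x B e k))\<^sup>2 / (ts - l k)\<^sup>2) \<ge> C * (- poly (h_poly A g H x) ts / poly q ts)"
  shows False
proof -
  define G where "G x = - poly (h_poly A g H x) ts / poly q ts" for x
  \<comment> \<open>A superlevel set instead of the region \<open>G > 0\<close>: it is closed under
    limits in the distance, and steps that increase G stay in it.\<close>
  define R where "R = {x. G x \<ge> G x0}"
  define f where "f x = 1 / sqrt (G x)" for x
  let ?d = "riemannian_dist A g"
  have Gpos: "G x > 0" if "x \<in> R" for x using that G0 by (simp add: R_def G_def)
  have D: "((\<lambda>z. G (chart_inv c z)) has_derivative (\<lambda>h. - 2 * G x * ((B *v h) \<bullet> w))) (at (snd c x))
      \<and> (norm w)\<^sup>2 \<ge> C * G x"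
    if sf: "spectral_frame c x B e l" and x: "x \<in> R"
      and w: "w = Inv (mat (complex_of_real ts) - H (coframe_of A c (snd c x, B))) *v T (coframe_of A c (snd c x, B))"
    for c x B e l w
  proof
    have hp: "poly (root_poly l) ts = - poly q ts * G x"
      using qt by (simp add: G_def sf_h_poly[OF sf])
    then have "poly (root_poly l) ts \<noteq> 0" using qt Gpos[OF x] by simp
    then have ts: "ts \<notin> range l" by (auto simp: poly_root_poly)
    have "((\<lambda>z. - (1 / poly q ts) * poly (h_poly A g H (chart_inv c z)) ts) has_derivative
        (\<lambda>h. - (1 / poly q ts) * (- 2 * poly (root_poly l) ts * ((B *v h) \<bullet> w)))) (at (snd c x))"
      unfolding w by (intro has_derivative_mult_right sf_derivative_at(1)[OF sf ts])
    moreover have "- (1 / poly q ts) * (- 2 * poly (root_poly l) ts * ((B *v h) \<bullet> w)) = - 2 * G x * ((B *v h) \<bullet> w)" for h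
      using qt by (simp add: hp)
    moreover have "- (1 / poly q ts) * poly (h_poly A g H (chart_inv c z)) ts = G (chart_inv c z)" for z
      by (simp add: G_def)
    ultimately show "((\<lambda>z. G (chart_inv c z)) has_derivative (\<lambda>h. - 2 * G x * ((B *v h) \<bullet> w))) (at (snd c x))"
      by simp
    show "(norm w)\<^sup>2 \<ge> C * G x"
      unfolding w sf_derivative_at(2)[OF sf ts] using slope[OF sf] Gpos[OF x] by (simp add: G_def)
  qed
  have cont: "isCont (\<lambda>z. G (chart_inv c z)) (snd c x)" if c: "c \<in> charts_at A x" for c x
  proof -
    obtain B e l where sf: "spectral_frame c x B e l" using spectral_frame_exists[OF c] by blast
    have coeff: "isCont (\<lambda>z. coeff (h_poly A g H (chart_inv c z)) k) (snd c x)" for k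
      using sf_coeff_derivative[OF sf] by (rule has_derivative_continuous)
    have "poly (h_poly A g H y) ts = (\<Sum>k\<le>CARD('n). coeff (h_poly A g H y) k * ts ^ k)" for y
      by (simp add: poly_altdef degree_h_poly)
    then show ?thesis unfolding G_def using qt by (simp only:) (intro continuous_intros coeff)
  qed
  have closed: "x \<in> R \<and> (\<lambda>i. f (\<sigma> i)) \<longlonglongrightarrow> f x"
    if \<sigma>: "\<And>i. \<sigma> i \<in> R" and lim: "(\<lambda>i. ?d (\<sigma> i) x) \<longlonglongrightarrow> 0" for \<sigma> x
  proof -
    obtain c where c: "c \<in> charts_at A x" using charts_at_nonempty by blast
    then have cA: "c \<in> A" "x \<in> fst c" by (auto simp: charts_at_iff)
    note cl = riemannian_dist_chart_limit[OF conn c lim]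
    have "(\<lambda>i. G (chart_inv c (snd c (\<sigma> i)))) \<longlonglongrightarrow> G (chart_inv c (snd c x))"
      using isCont_tendsto_compose[OF cont[OF c] cl(2)] .
    moreover have "\<forall>\<^sub>F i in sequentially. G (chart_inv c (snd c (\<sigma> i))) = G (\<sigma> i)"
      using cl(1) by eventually_elim (simp add: chart_inv_chart[OF cA(1)])
    ultimately have G_lim: "(\<lambda>i. G (\<sigma> i)) \<longlonglongrightarrow> G x"
      by (simp add: tendsto_cong chart_inv_chart[OF cA])
    have "G x \<ge> G x0"
      by (rule tendsto_lowerbound[OF G_lim]) (use \<sigma> in \<open>auto simp: R_def\<close>)
    then have x: "x \<in> R" by (simp add: R_def)
    have "(\<lambda>i. f (\<sigma> i)) \<longlonglongrightarrow> f x"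
      unfolding f_def using Gpos[OF x] by (intro tendsto_intros G_lim) simp
    with x show ?thesis by blast
  qed
  have descent: "\<exists>y\<in>R. f y < f x - sqrt C / 2 * ?d x y" if x: "x \<in> R" for x
  proof -
    obtain c where c: "c \<in> charts_at A x" using charts_at_nonempty by blast
    then have cA: "c \<in> A" "x \<in> fst c" by (auto simp: charts_at_iff)
    obtain B e l where sf: "spectral_frame c x B e l" using spectral_frame_exists[OF c] by blast
    define w where "w = Inv (mat (complex_of_real ts) - H (coframe_of A c (snd c x, B))) *v T (coframe_of A c (snd c x, B))"
    let ?z0 = "snd c x"
    have z0: "?z0 \<in> chart_image c" by (rule chart_in[OF cA])
    note DG = D[OF sf x w_def, THEN conjunct1] and w_low = D[OF sf x w_def, THEN conjunct2]
    have Gx: "G x > 0" by (rule Gpos[OF x])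
    have "(norm w)\<^sup>2 > 0" using w_low C Gx by (meson less_le_trans mult_pos_pos)
    then have w0: "norm w > 0" by simp
    have det: "det B \<noteq> 0" by (rule bundle_chart_invertible[OF cA(1) z0 sf_frame(1)[OF sf]])
    \<comment> \<open>The coordinates of the unit vector along which G increases fastest.\<close>
    define h where "h = Inv B *v (- (1 / norm w) *\<^sub>R w)"
    have Bh: "B *v h = - (1 / norm w) *\<^sub>R w" by (simp add: h_def Inv_mult_vec det)
    have g1: "gc c ?z0 h h = 1"
      using gc_frame[OF cA(1) z0 sf_frame(1)[OF sf]] w0 by (simp add: Bh)
    have Dh: "- 2 * G x * ((B *v h) \<bullet> w) = 2 * G x * norm w"
      using w0 by (simp add: Bh dot_square_norm power2_eq_square)
    have line: "((\<lambda>s. ?z0 + s *\<^sub>R h) has_derivative (\<lambda>s. s *\<^sub>R h)) (at 0)"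
      by (auto intro!: derivative_eq_intros)
    define \<psi> where "\<psi> s = G (chart_inv c (?z0 + s *\<^sub>R h))" for s
    have \<psi>0: "\<psi> 0 = G x" by (simp add: \<psi>_def chart_inv_chart[OF cA])
    have "(\<psi> has_derivative (\<lambda>s. - 2 * G x * ((B *v (s *\<^sub>R h)) \<bullet> w))) (at 0)"
      unfolding \<psi>_def by (rule has_derivative_compose[OF line]) (use DG in simp)
    moreover have "(\<lambda>s. - 2 * G x * ((B *v (s *\<^sub>R h)) \<bullet> w)) = (*) (2 * G x * norm w)"
    proof
      fix s
      have "B *v (s *\<^sub>R h) = s *\<^sub>R (B *v h)" by (simp only: scaleR_eq_scale mult_vec_scale)
      then have "- 2 * G x * ((B *v (s *\<^sub>R h)) \<bullet> w) = - 2 * G x * (s * ((B *v h) \<bullet> w))"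
        by (simp only: inner_scaleR_left)
      also have "\<dots> = (- 2 * G x * ((B *v h) \<bullet> w)) * s" by (simp only: mult_ac)
      also have "\<dots> = 2 * G x * norm w * s" by (simp only: Dh)
      finally show "- 2 * G x * ((B *v (s *\<^sub>R h)) \<bullet> w) = 2 * G x * norm w * s" .
    qed
    ultimately have D\<psi>: "(\<psi> has_real_derivative 2 * G x * norm w) (at 0)"
      by (simp add: has_field_derivative_def)
    \<comment> \<open>The derivative of \<open>G^{-1/2}\<close> is \<open>- G^{-3/2} G' / 2\<close>,
      with \<open>G' = 2 G |w|\<close> in the direction h.\<close>
    have D\<phi>: "((\<lambda>s. 1 / sqrt (\<psi> s)) has_real_derivative - (norm w / sqrt (G x))) (at 0)"
    proof -
      have p: "\<psi> 0 > 0" using Gx \<psi>0 by simp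
      have D1: "((\<lambda>s. sqrt (\<psi> s)) has_real_derivative inverse (sqrt (\<psi> 0)) / 2 * (2 * G x * norm w)) (at 0)"
        by (rule DERIV_chain2[OF DERIV_real_sqrt[OF p] D\<psi>])
      note D2 = DERIV_inverse'[OF D1, unfolded \<psi>0]
      have eq: "inverse r * (inverse r / 2 * (2 * (r * r) * N)) * inverse r = N / r" if "r > 0" for r N :: real
        using that by (simp add: field_simps)
      have r: "sqrt (G x) * sqrt (G x) = G x" "sqrt (G x) > 0" using Gx by simp_all
      have D3: "((\<lambda>s. inverse (sqrt (\<psi> s))) has_real_derivative - (norm w / sqrt (G x))) (at 0)"
        using D2[OF r(2)[THEN less_imp_neq, symmetric]] eq[OF r(2), of "norm w"] by (simp only: r(1))
      show ?thesis unfolding divide_inverse[of 1] mult_1_left by (rule D3)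
    qed
    have slope_low: "sqrt C \<le> norm w / sqrt (G x)"
    proof -
      have "sqrt (C * G x) \<le> norm w" by (rule real_le_lsqrt[OF norm_ge_zero w_low])
      then have "sqrt C * sqrt (G x) \<le> norm w" by (simp only: real_sqrt_mult)
      then show ?thesis using Gx by (simp only: pos_le_divide_eq real_sqrt_gt_0_iff)
    qed
    have sC: "sqrt C > 0" using C by simp
    have "((\<lambda>s. (1 / sqrt (\<psi> s) - 1 / sqrt (\<psi> 0)) / (s - 0)) \<longlongrightarrow> - (norm w / sqrt (G x))) (at 0)"
      using D\<phi> by (simp add: has_field_derivative_iff)
    \<comment> \<open>The initial slope is at most \<open>- sqrt C\<close>. Keeping 3/4 of it and
      allowing length 5/4 per unit of s yields the descent rate \<open>sqrt C / 2\<close>, because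
      half of 5/4 is less than 3/4.\<close>
    then have "\<forall>\<^sub>F s in at 0. (1 / sqrt (\<psi> s) - 1 / sqrt (\<psi> 0)) / (s - 0) < - (3 / 4 * sqrt C)"
      by (rule order_tendstoD(2)) (use slope_low sC in linarith)
    then have ev1: "\<forall>\<^sub>F s in at_right 0. (1 / sqrt (\<psi> s) - 1 / sqrt (\<psi> 0)) / (s - 0) < - (3 / 4 * sqrt C)"
      by (rule eventually_at_split[THEN iffD1, THEN conjunct2])
    have "((\<lambda>s. (\<psi> s - \<psi> 0) / (s - 0)) \<longlongrightarrow> 2 * G x * norm w) (at 0)"
      using D\<psi> by (simp add: has_field_derivative_iff)
    then have "\<forall>\<^sub>F s in at 0. (\<psi> s - \<psi> 0) / (s - 0) > 0"
      by (rule order_tendstoD(1)) (use Gx w0 in simp)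
    then have ev2: "\<forall>\<^sub>F s in at_right 0. (\<psi> s - \<psi> 0) / (s - 0) > 0"
      by (rule eventually_at_split[THEN iffD1, THEN conjunct2])
    have "isCont (\<lambda>z. sqrt (gc c z h h)) ?z0"
      using gc_continuous[OF cA(1)] open_chart_image[OF cA(1)] z0
      by (intro continuous_intros) (simp add: continuous_on_eq_continuous_at)
    then have "((\<lambda>z. sqrt (gc c z h h)) \<longlongrightarrow> sqrt (gc c ?z0 h h)) (nhds ?z0)"
      unfolding isCont_def by (rule tendsto_at_iff_tendsto_nhds[THEN iffD1])
    then have "\<forall>\<^sub>F z in nhds ?z0. sqrt (gc c z h h) < 5 / 4"
      by (rule order_tendstoD(2)) (simp add: g1)
    then obtain r1 where r1: "r1 > 0" "\<And>z. dist z ?z0 < r1 \<Longrightarrow> sqrt (gc c z h h) < 5 / 4"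
      unfolding eventually_nhds_metric by blast
    obtain r2 where r2: "r2 > 0" "ball ?z0 r2 \<subseteq> chart_image c"
      using open_chart_image[OF cA(1)] z0 open_contains_ball by blast
    define r where "r = min r1 r2"
    have r: "r > 0" "ball ?z0 r \<subseteq> chart_image c" "\<And>z. dist z ?z0 < r \<Longrightarrow> sqrt (gc c z h h) < 5 / 4"
      using r1 r2 by (auto simp: r_def)
    have "((\<lambda>s. norm (s *\<^sub>R h)) \<longlongrightarrow> norm (0 *\<^sub>R h)) (at_right (0::real))" by (intro tendsto_intros)
    then have ev3: "\<forall>\<^sub>F s in at_right 0. norm (s *\<^sub>R h) < r"
      by (rule order_tendstoD(2)) (use r in simp)
    have ev4: "\<forall>\<^sub>F s in at_right 0. s > (0::real)" by (simp add: eventually_at_right_less)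
    have "\<exists>s. (1 / sqrt (\<psi> s) - 1 / sqrt (\<psi> 0)) / (s - 0) < - (3 / 4 * sqrt C) \<and> (\<psi> s - \<psi> 0) / (s - 0) > 0
        \<and> norm (s *\<^sub>R h) < r \<and> s > 0"
      using eventually_happens[OF eventually_conj[OF ev1 eventually_conj[OF ev2 eventually_conj[OF ev3 ev4]]]] by simp
    then obtain s where s: "s > 0" "norm (s *\<^sub>R h) < r" and s1: "(1 / sqrt (\<psi> s) - 1 / sqrt (\<psi> 0)) / (s - 0) < - (3 / 4 * sqrt C)"
      and s2: "(\<psi> s - \<psi> 0) / (s - 0) > 0" by blast
    define y where "y = chart_inv c (?z0 + s *\<^sub>R h)"
    have Gy: "G y = \<psi> s" by (simp add: y_def \<psi>_def)
    have "G y > G x" using s2 s(1) by (simp add: Gy \<psi>0 zero_less_divide_iff)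
    then have y: "y \<in> R" using x by (simp add: R_def)
    have fy: "f y < f x - s * (3 / 4 * sqrt C)"
      using s1 s(1) by (simp add: f_def Gy \<psi>0 divide_less_eq algebra_simps)
    have "\<exists>L\<le>s * (5 / 4). joined (chart_inv c ?z0) (chart_inv c (?z0 + s *\<^sub>R h)) L"
    proof (rule joined_segment[OF cA(1) r(2,1) s(2)])
      fix t :: real assume t: "t \<in> {0..1}"
      let ?y = "?z0 + t *\<^sub>R s *\<^sub>R h"
      have "norm (t *\<^sub>R s *\<^sub>R h) = t * norm (s *\<^sub>R h)" using t by (simp add: abs_mult)
      also have "\<dots> \<le> norm (s *\<^sub>R h)" by (rule mult_left_le_one_le) (use t in auto)
      finally have "norm (t *\<^sub>R s *\<^sub>R h) \<le> norm (s *\<^sub>R h)" .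
      then have near: "dist ?y ?z0 < r" using s(2) unfolding dist_norm add_diff_cancel_left' by linarith
      then have z: "?y \<in> chart_image c" using r(2) by (auto simp: dist_commute)
      have "sqrt (gc c ?y (s *\<^sub>R h) (s *\<^sub>R h)) = s * sqrt (gc c ?y h h)"
        using s(1) by (simp only: gc_scaleR[OF cA(1) z]) (simp add: real_sqrt_mult)
      also have "\<dots> \<le> s * (5 / 4)" using r(3)[OF near] s(1) by (intro mult_left_mono) auto
      finally show "sqrt (gc c ?y (s *\<^sub>R h) (s *\<^sub>R h)) \<le> s * (5 / 4)" .
    qed
    then obtain L where "L \<le> s * (5 / 4)" "joined x y L" by (auto simp: y_def chart_inv_chart[OF cA])
    then have dxy: "?d x y \<le> s * (5 / 4)" using riemannian_dist_le by fastforce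
    have "sqrt C / 2 * ?d x y \<le> sqrt C / 2 * (s * (5 / 4))" using dxy sC by (intro mult_left_mono) auto
    also have "\<dots> \<le> s * (3 / 4 * sqrt C)" using sC s(1) by (simp add: field_simps)
    finally show ?thesis using fy y by (intro bexI[of _ y]) auto
  qed
  show False
  proof (rule ekeland_descent[of ?d x0 R f "sqrt C / 2"])
    show "\<exists>x. (\<lambda>i. ?d (\<sigma> i) x) \<longlonglongrightarrow> 0"
      if "\<forall>\<epsilon>>0. \<exists>N. \<forall>i\<ge>N. \<forall>j\<ge>N. ?d (\<sigma> i) (\<sigma> j) < \<epsilon>" for \<sigma>
      using complete that unfolding complete_metric_def by blast
    show "x0 \<in> R" by (simp add: R_def)
    show "f x \<ge> 0" if "x \<in> R" for x using Gpos[OF that] by (simp add: f_def)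
    show "sqrt C / 2 > 0" using C by simp
  qed (fact riemannian_dist_triangle[OF conn] riemannian_dist_nonneg[OF conn] riemannian_dist_sym[OF conn]
      riemannian_dist_refl[OF conn] closed descent)+
qed

text \<open>The cell in terms of polynomials, with the weak inequality at multiple roots too; it
  contains the image of the momentum cell under \<open>cell_poly\<close>.\<close>

definition poly_cell :: "nat \<Rightarrow> real poly \<Rightarrow> (real \<Rightarrow> nat) \<Rightarrow> real poly set" where
  "poly_cell m pD \<mu> = {p. lead_coeff p = 1 \<and> degree p = m \<and> (\<forall>r. poly pD r = 0 \<longrightarrow> (-1) ^ \<mu> r * poly p r \<ge> 0)}"

lemma poly_cell_bounded:
  assumes conn: "connected (UNIV :: 'a set)" and complete: "complete_metric A g"
    and q: "lead_coeff q = 1" "degree q + m = CARD('n)" and m: "m \<ge> 1"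
    and hq: "\<And>x. h_poly A g H x = q * P x" and wedge: "wedge_nonzero_at A m (h_fun A g H) x0"
    and distinct: "card {t. poly (P x0) t = 0} = m"
    and pD: "q * pD = C_poly A g H T V x0"
    and P: "\<And>x. P x \<in> poly_cell m pD (\<lambda>r. card {t. poly (P x0) t = 0 \<and> t > r})"
  shows "\<exists>b. \<forall>p \<in> poly_cell m pD (\<lambda>r. card {t. poly (P x0) t = 0 \<and> t > r}). \<forall>j. \<bar>coeff p j\<bar> \<le> b j"
proof -
  define L where "L = {t. poly (P x0) t = 0}"
  let ?cell = "poly_cell m pD (\<lambda>r. card {t. poly (P x0) t = 0 \<and> t > r})"
  have q0: "q \<noteq> 0" using q by auto
  have Pm: "lead_coeff (P x) = 1" "degree (P x) = m" for x using P[of x] by (auto simp: poly_cell_def)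
  have L: "finite L" "L \<noteq> {}" "card L = m"
    using distinct m unfolding L_def[symmetric] by (auto intro: card_ge_0_finite)
  have Px0: "P x0 = (\<Prod>y\<in>L. [:- y, 1:])"
    unfolding L_def by (rule monic_eq_prod_roots) (use Pm distinct in auto)
  define c where "c = some_chart A x0"
  have "c \<in> charts_at A x0" unfolding c_def by (rule some_chart)
  then obtain B e l where sf: "spectral_frame c x0 B e l" using spectral_frame_exists by blast
  note sf' = sf[unfolded c_def]
  have ql: "q * P x0 = root_poly l" using hq sf_h_poly[OF sf] by simp
  have qC: "q * pD = C_real l (\<lambda>k. (cmod (T_comp c x0 B e k))\<^sup>2) (V (coframe_of A c (snd c x0, B)))"
    using pD sf_C_poly[OF sf] by simp
  have pD_monic: "lead_coeff pD = 1" "degree pD = m + 2"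
  proof -
    have "lead_coeff (q * pD) = 1" unfolding qC by (rule C_real_monic)
    then show 1: "lead_coeff pD = 1" using q by (simp add: lead_coeff_mult)
    then have "pD \<noteq> 0" by auto
    then have "degree (q * pD) = degree q + degree pD" using q0 by (rule degree_mult_eq[rotated])
    then show "degree pD = m + 2" unfolding qC C_real_monic using q by simp
  qed
  have pos: "poly pD r * poly (pderiv (P x0)) r > 0" if r: "r \<in> L" for r
  proof -
    have root: "poly (P x0) r = 0" using r by (simp add: L_def)
    have 1: "(\<Sum>k | l k = r. (cmod (T_comp c x0 B e k))\<^sup>2) > 0"
      unfolding c_def by (rule active_root[OF _ q m wedge sf' ql root]) (simp add: hq)
    have "poly (pderiv (P x0)) r = (\<Prod>y\<in>L-{r}. r - y)"
      unfolding Px0 by (rule pderiv_prod_linear_at_root[OF L(1) r])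
    then have "poly (pderiv (P x0)) r \<noteq> 0" using L by (simp add: prod_zero_iff)
    then have "(poly (pderiv (P x0)) r)\<^sup>2 > 0" by simp
    then have "(poly (pderiv (P x0)) r)\<^sup>2 * (\<Sum>k | l k = r. (cmod (T_comp c x0 B e k))\<^sup>2) > 0"
      using 1 by (rule mult_pos_pos)
    then show ?thesis unfolding residue_formula[OF ql qC root] by (simp only: power2_eq_square mult_ac)
  qed
  obtain S where S: "finite S" "card S = card L" "\<And>s. s \<in> S \<Longrightarrow> poly pD s = 0" "\<And>s. s \<in> S \<Longrightarrow> s < Max L"
    "\<And>s. s \<in> S \<Longrightarrow> card {x\<in>L. x > s} = Suc (card {s'\<in>S. s' > s})"
    by (rule interlacing_roots[OF L(1,2) Px0 pD_monic(1) _ pos]) (simp add: pD_monic L, assumption, rule that)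
  have S0: "S \<noteq> {}" "card S = m" using S(1,2) L(3) m by auto
  have Lset: "{t. poly (P x0) t = 0 \<and> t > r} = {x\<in>L. x > r}" for r by (auto simp: L_def)
  have weight: "weight S p \<rho> \<ge> 0" if p: "p \<in> ?cell" and \<rho>: "\<rho> \<in> S" for p \<rho>
  proof (rule weight_nonneg[OF S(1) \<rho>])
    \<comment> \<open>The count for L exceeds the count for S by one, which reverses the
      inequality.\<close>
    have "(-1) ^ card {x\<in>L. x > \<rho>} * poly p \<rho> \<ge> 0"
      using p S(3)[OF \<rho>] by (simp add: poly_cell_def Lset)
    then show "(-1) ^ card {s\<in>S. s > \<rho>} * poly p \<rho> \<le> 0" by (simp add: S(5)[OF \<rho>])
  qed
  let ?M = "Max L"
  have M: "?M \<in> L" using L by (intro Max_in)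
  have M_max: "y \<le> ?M" if "y \<in> L" for y using L that by (intro Max_ge)
  show ?thesis
  proof (cases "\<exists>R>?M. poly pD R = 0")
    case True
    then obtain R where R: "R > ?M" "poly pD R = 0" by blast
    \<comment> \<open>No root of \<open>P x0\<close> lies above R, so the sign of the cell condition
      at R is +1.\<close>
    have empty: "{x\<in>L. x > R} = {}" using R(1) M_max by force
    have *: "poly p R \<ge> 0" if "p \<in> ?cell" for p
    proof -
      have "(-1) ^ card {x\<in>L. x > R} * poly p R \<ge> 0"
        using that R(2) by (simp add: poly_cell_def Lset)
      then show ?thesis unfolding empty by simp
    qed
    have "\<bar>coeff p j\<bar> \<le> \<bar>coeff (\<Prod>s\<in>S. [:- s, 1:]) j\<bar> + (\<Sum>\<rho>\<in>S. (R - \<rho>) * \<bar>coeff (lagrange_basis S \<rho>) j\<bar>)"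
      if p: "p \<in> ?cell" for p j
    proof (rule coeff_bound_of_weights[OF S(1) S0(1)])
      show "lead_coeff p = 1" "degree p = card S" using p S0 by (auto simp: poly_cell_def)
      show "\<rho> < R" if "\<rho> \<in> S" for \<rho> using S(4)[OF that] R(1) by linarith
    qed (use weight[OF p] *[OF p] in auto)
    then show ?thesis
      by (intro exI[of _ "\<lambda>j. \<bar>coeff (\<Prod>s\<in>S. [:- s, 1:]) j\<bar> + (\<Sum>\<rho>\<in>S. (R - \<rho>) * \<bar>coeff (lagrange_basis S \<rho>) j\<bar>)"]) auto
  next
    case False
    have "pD \<noteq> 0" using pD_monic by auto
    \<comment> \<open>ts is placed between F and \<open>?M\<close>: beyond the lower roots of pD and
      thus beyond S, away from the roots of q, and beyond all other roots of \<open>P x0\<close>.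
      The point \<open>?M - 1\<close> keeps F nonempty.\<close>
    define F where "F = insert (?M - 1) ({t. poly pD t = 0 \<and> t < ?M} \<union> {t. poly q t = 0 \<and> t < ?M} \<union> (L - {?M}))"
    have F: "finite F" "F \<noteq> {}"
      using poly_roots_finite[OF \<open>pD \<noteq> 0\<close>] poly_roots_finite[OF q0] L by (auto simp: F_def)
    have F_less: "t < ?M" if "t \<in> F" for t using that M_max[of t] by (auto simp: F_def)
    have "Max F < ?M" using F_less F by simp
    then obtain ts where ts: "Max F < ts" "ts < ?M" using dense by blast
    have F_ts: "t < ts" if "t \<in> F" for t using Max_ge[OF F(1) that] ts(1) by linarith
    have "(\<Prod>y\<in>L-{?M}. ?M - y) > 0"
      using M_max by (intro prod_pos) (auto simp: less_le)
    then have "poly (pderiv (P x0)) ?M > 0"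
      unfolding Px0 pderiv_prod_linear_at_root[OF L(1) M] .
    then have pD_M: "poly pD ?M > 0" using pos[OF M] by (simp add: zero_less_mult_iff)
    have noroot: "poly pD t \<noteq> 0" if "t \<ge> ts" for t
    proof
      assume t0: "poly pD t = 0"
      show False
      proof (cases t ?M rule: linorder_cases)
        case less
        then have "t \<in> F" using t0 by (simp add: F_def)
        then show False using F_ts that by fastforce
      qed (use t0 pD_M False in auto)
    qed
    have "poly pD ts > 0"
    proof (rule ccontr)
      assume "\<not> poly pD ts > 0"
      then have "poly pD ts < 0" using noroot[of ts] by auto
      from poly_IVT_pos[OF ts(2) this pD_M] show False using noroot by auto
    qed
    then have pD_pos: "poly pD t > 0" if "t \<ge> ts" for t
      using poly_pos_after_last_root[of pD ts t] noroot that by auto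
    have St: "s < ts" if "s \<in> S" for s using F_ts[of s] S(3,4)[OF that] by (auto simp: F_def)
    have qt: "poly q ts \<noteq> 0"
    proof
      assume "poly q ts = 0"
      then have "ts \<in> F" using ts(2) by (simp add: F_def)
      then show False using F_ts by blast
    qed
    have "(\<Prod>y\<in>L-{?M}. ts - y) > 0"
    proof (rule prod_pos)
      fix y assume "y \<in> L - {?M}"
      then have "y \<in> F" by (simp add: F_def)
      then show "ts - y > 0" using F_ts by simp
    qed
    \<comment> \<open>Exactly one linear factor of \<open>P x0\<close>, that of \<open>?M\<close>,
      is negative at ts.\<close>
    then have "poly (P x0) ts < 0"
      unfolding Px0 poly_prod using ts(2) L(1) M by (simp add: prod.remove[of L ?M] mult_less_0_iff)
    have GP: "- poly (h_poly A g H x) ts / poly q ts = - poly (P x) ts" for x using qt by (simp add: hq)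
    have False
    \<comment> \<open>The estimate applies at all points with the same C: pD is constant by
      \<open>C_poly_constant\<close>, and the weights of \<open>P x\<close> are nonnegative because
      every \<open>P x\<close> lies in the cell.\<close>
    proof (rule escape_estimate[OF S(1) S0(1) St pD_monic(1) _ S(3) pD_pos, where ?'n = 'n])
      show "degree pD = card S + 2" by (simp add: S0 pD_monic)
      fix C :: real
      assume C: "C > 0" "\<And>(l :: 'n \<Rightarrow> real) p q c v. \<lbrakk>lead_coeff p = 1; degree p = card S;
        \<And>\<rho>. \<rho> \<in> S \<Longrightarrow> weight S p \<rho> \<ge> 0; q * p = root_poly l; q * pD = C_real l c v;
        \<And>k. c k \<ge> 0; poly p ts < 0\<rbrakk> \<Longrightarrow> (\<Sum>k\<in>UNIV. c k / (ts - l k)\<^sup>2) \<ge> C * (- poly p ts)"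
      show False
      proof (rule no_escape[OF conn complete qt _ C(1)])
        show "- poly (h_poly A g H x0) ts / poly q ts > 0" unfolding GP using \<open>poly (P x0) ts < 0\<close> by simp
        fix c x B e l
        assume sf: "spectral_frame c x B e l" and neg: "- poly (h_poly A g H x) ts / poly q ts > 0"
        show "(\<Sum>k\<in>UNIV. (cmod (T_comp c x B e k))\<^sup>2 / (ts - l k)\<^sup>2) \<ge> C * (- poly (h_poly A g H x) ts / poly q ts)"
          unfolding GP
        proof (rule C(2))
          show "q * P x = root_poly l" using hq sf_h_poly[OF sf] by simp
          show "q * pD = C_real l (\<lambda>k. (cmod (T_comp c x B e k))\<^sup>2) (V (coframe_of A c (snd c x, B)))"
            unfolding pD C_poly_constant[OF conn, of x0 x] by (rule sf_C_poly[OF sf])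
          show "poly (P x) ts < 0" using neg unfolding GP by simp
        qed (use Pm S0 weight[OF P] in auto)
      qed
    qed
    then show ?thesis ..
  qed
qed

end

theorem proposition8:
  fixes A :: "('a::{t2_space,second_countable_topology}, 'n::finite) chart set"
    and g :: "('a, 'n) metric"
    and H :: "('a, 'n) coframe \<Rightarrow> complex^'n^'n"
    and T :: "('a, 'n) coframe \<Rightarrow> complex^'n"
    and V :: "('a, 'n) coframe \<Rightarrow> real"
    and q :: "real poly" and x\<^sub>0 :: 'a
  defines "m \<equiv> cohomogeneity A g H"
    and "p\<^sub>D \<equiv> reduced_char_poly A g H T V q x\<^sub>0"
    and "\<mu> \<equiv> root_index A g H q x\<^sub>0"
  assumes "connected (UNIV :: 'a set)"
    and "kaehler_manifold A g"
    and "bochner_kaehler A g H T V"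
    and "complete_metric A g"
    and "constant_factor A g H q"
    and "x\<^sub>0 \<in> regular_set A g H"
    and "range (reduced_momentum A g H q) \<subseteq> momentum_cell m p\<^sub>D \<mu>"
  shows "bounded_in_Rm m (momentum_cell m p\<^sub>D \<mu>)"
proof (cases "m = 0")
  case True
  \<comment> \<open>Over the empty index set the norm is 0.\<close>
  then show ?thesis unfolding bounded_in_Rm_def by (intro exI[of _ 0]) simp
next
  case False
  interpret bochner_kaehler_manifold A g H T V
    using assms(5,6) by unfold_locales
  let ?P = "reduced_poly A g H q"
  have q: "lead_coeff q = 1" "degree q + m = CARD('n)" and hq: "\<And>x. h_poly A g H x = q * ?P x"
    and distinct: "card {t. poly (?P x\<^sub>0) t = 0} = m"
    using assms(8,9) unfolding constant_factor_def Let_def m_def by auto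
  have q0: "q \<noteq> 0" using q by auto
  have pD: "q * p\<^sub>D = C_poly A g H T V x\<^sub>0"
    unfolding p\<^sub>D_def reduced_char_poly_def by (rule dvd_mult_div_cancel[OF dvd_C_poly]) (simp add: hq)
  have monic: "lead_coeff (?P x) = 1" "degree (?P x) = m" for x
  proof -
    obtain c where "c \<in> charts_at A x" using charts_at_nonempty by blast
    then obtain B e l where sf: "spectral_frame c x B e l" using spectral_frame_exists by blast
    have "lead_coeff (q * ?P x) = 1"
      unfolding hq[symmetric] sf_h_poly[OF sf] root_poly_def by (rule monic_prod_linear)
    then show 1: "lead_coeff (?P x) = 1" using q by (simp add: lead_coeff_mult)
    then have "?P x \<noteq> 0" by auto
    then have "degree (q * ?P x) = degree q + degree (?P x)" using q0 by (rule degree_mult_eq[rotated])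
    then show "degree (?P x) = m"
      unfolding hq[symmetric] sf_h_poly[OF sf] using q by (simp add: degree_root_poly)
  qed
  have cell: "cell_poly m X \<in> poly_cell m p\<^sub>D \<mu>" if "X \<in> momentum_cell m p\<^sub>D \<mu>" for X
    using cell_poly_monic[of m X] momentum_cellD[OF that] by (simp add: poly_cell_def)
  \<comment> \<open>The sign in \<open>reduced_h\<close> cancels the one in
    \<open>cell_poly\<close>, so the momentum image corresponds to the polynomials
    \<open>?P x\<close> themselves.\<close>
  have "cell_poly m (reduced_momentum A g H q x) = ?P x" for x
  proof (rule poly_eqI)
    fix j
    consider "j > m" | "j = m" | "j < m" by linarith
    then show "coeff (cell_poly m (reduced_momentum A g H q x)) j = coeff (?P x) j"
    proof cases
      case 3
      then have k: "m - j \<in> {1..m}" "m - (m - j) = j" by auto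
      have "coeff (cell_poly m (reduced_momentum A g H q x)) j = (-1) ^ (m - j) * ((-1) ^ (m - j) * coeff (?P x) j)"
        using coeff_cell_poly[OF k(1), of "reduced_momentum A g H q x"] k
        by (simp add: reduced_momentum_def reduced_h_def m_def)
      also have "\<dots> = coeff (?P x) j"
        unfolding mult.assoc[symmetric] power_mult_distrib[symmetric] by simp
      finally show ?thesis .
    qed (use cell_poly_monic monic in \<open>auto simp: coeff_eq_0\<close>)
  qed
  then have P: "?P x \<in> poly_cell m p\<^sub>D \<mu>" for x
    using cell[of "reduced_momentum A g H q x"] assms(10) by auto
  have \<mu>: "\<mu> = (\<lambda>r. card {t. poly (?P x\<^sub>0) t = 0 \<and> t > r})"
    by (simp add: \<mu>_def root_index_def fun_eq_iff)
  have "\<exists>b. \<forall>p \<in> poly_cell m p\<^sub>D \<mu>. \<forall>j. \<bar>coeff p j\<bar> \<le> b j"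
    unfolding \<mu>
  proof (rule poly_cell_bounded[OF assms(4,7) q _ hq _ distinct pD P[unfolded \<mu>]])
    show "wedge_nonzero_at A m (h_fun A g H) x\<^sub>0" using assms(9) by (simp add: regular_set_def m_def)
  qed (use False in simp)
  then obtain b where b: "\<And>p j. p \<in> poly_cell m p\<^sub>D \<mu> \<Longrightarrow> \<bar>coeff p j\<bar> \<le> b j" by blast
  show ?thesis by (rule bounded_in_Rm_coeff[of _ m "\<lambda>k. b (m - k)"]) (rule b[OF cell])
qed

end
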